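(* The problem \textsc{Unlabelled Directed Token Moving} (UDTM) is fixed-parameter tractable when parameterized by $\ell$: there is an algorithm deciding every instance $(D,S,T,\ell)$ in time $g(\ell)\cdot n^{O(1)}$ for some computable function $g$, where $n$ is the size of the instance.
   Context: Tokens sit on vertices of a directed graph $D$. An (unlabelled) configuration is a set $C\subseteq V(D)$, meaning one token on each vertex of $C$. A move is a pair $(s,t)$ of vertices; executing it moves the token on $s$ to $t$. A vertex is free if it carries no token; a directed path is free if all its intermediate vertices are free. A move $(s,t)$ in a sequence is valid if, after executing the preceding moves of the sequence, there is a token on $s$, $t$ is free, and there is a free directed path from $s$ to $t$. A transforming sequence from $S$ to $T$ is a sequence of valid moves whose execution starting from configuration $S$ yields configuration $T$. UDTM: given a digraph $D$, configurations $S,T\subseteq V(D)$ with $|S|=|T|=k$, and an integer $\ell$, decide whether there is a transforming sequence from $S$ to $T$ of length at most $\ell$ (and output one). *)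

theory Defs
  imports "Graph_Theory.Kuratowski"
begin

section \<open>Token moving on digraphs\<close>

text \<open>A digraph has a finite vertex set and at most one arc per ordered pair of vertices; loops are
  allowed (they lie on no directed path). Configurations are sets of vertices.\<close>

definition free_path ::
  "'a pair_pre_digraph \<Rightarrow> 'a set \<Rightarrow> 'a \<Rightarrow> ('a \<times> 'a) awalk \<Rightarrow> 'a \<Rightarrow> bool" where
  "free_path D C s p t \<longleftrightarrow> pre_digraph.apath (with_proj D) s p t \<and>
     set (pre_digraph.inner_verts (with_proj D) p) \<inter> C = {}"

fun valid_move :: "'a pair_pre_digraph \<Rightarrow> 'a set \<Rightarrow> 'a \<times> 'a \<Rightarrow> bool" where
  "valid_move D C (s, t) \<longleftrightarrow> s \<in> C \<and> t \<notin> C \<and> (\<exists>p. free_path D C s p t)"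

fun execute_move :: "'a set \<Rightarrow> 'a \<times> 'a \<Rightarrow> 'a set" where
  "execute_move C (s, t) = insert t (C - {s})"

fun transforming ::
  "'a pair_pre_digraph \<Rightarrow> 'a set \<Rightarrow> ('a \<times> 'a) list \<Rightarrow> 'a set \<Rightarrow> bool" where
  "transforming D S [] T \<longleftrightarrow> S = T"
| "transforming D S (m # ms) T \<longleftrightarrow> valid_move D S m \<and> transforming D (execute_move S m) ms T"


section \<open>Model of computation\<close>

text \<open>
  The language WHILE of N. D. Jones (Computability and Complexity from a Programming Perspective,
  MIT Press 1997): imperative programs over binary trees. Every elementary operation touches one
  cell (the only test is whether a tree is a leaf) and costs one time unit. Trees are immutable and
  can be stored as shared graphs, so WHILE programs and Turing machines simulate each other with
  polynomial overhead. In particular, fixed-parameter tractability does not depend on which of the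
  two models is used.
\<close>

datatype tree_data = Leaf | Node tree_data tree_data

fun data_size :: "tree_data \<Rightarrow> nat" where
  "data_size Leaf = 1"
| "data_size (Node a b) = 1 + data_size a + data_size b"

fun hd_data :: "tree_data \<Rightarrow> tree_data" where
  "hd_data Leaf = Leaf"
| "hd_data (Node a b) = a"

fun tl_data :: "tree_data \<Rightarrow> tree_data" where
  "tl_data Leaf = Leaf"
| "tl_data (Node a b) = b"

datatype expr = Var nat | LeafE | NodeE expr expr | HdE expr | TlE expr

type_synonym store = "nat \<Rightarrow> tree_data"

fun eval_expr :: "expr \<Rightarrow> store \<Rightarrow> tree_data" where
  "eval_expr (Var x) \<sigma> = \<sigma> x"
| "eval_expr LeafE \<sigma> = Leaf"
| "eval_expr (NodeE e f) \<sigma> = Node (eval_expr e \<sigma>) (eval_expr f \<sigma>)"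
| "eval_expr (HdE e) \<sigma> = hd_data (eval_expr e \<sigma>)"
| "eval_expr (TlE e) \<sigma> = tl_data (eval_expr e \<sigma>)"

fun expr_time :: "expr \<Rightarrow> nat" where
  "expr_time (Var x) = 1"
| "expr_time LeafE = 1"
| "expr_time (NodeE e f) = 1 + expr_time e + expr_time f"
| "expr_time (HdE e) = 1 + expr_time e"
| "expr_time (TlE e) = 1 + expr_time e"

datatype com =
    Skip
  | Assign nat expr
  | Seq com com
  | Cond expr com com
  | While expr com

text \<open>\<open>exec c \<sigma> n \<tau>\<close>: started in store \<open>\<sigma>\<close>, the program \<open>c\<close> halts after \<open>n\<close> time units in store
  \<open>\<tau>\<close>. In tests, a leaf means false and any other tree means true.\<close>

inductive exec :: "com \<Rightarrow> store \<Rightarrow> nat \<Rightarrow> store \<Rightarrow> bool" where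
  Skip: "exec Skip \<sigma> 1 \<sigma>"
| Assign: "exec (Assign x e) \<sigma> (1 + expr_time e) (\<sigma>(x := eval_expr e \<sigma>))"
| Seq: "exec c \<sigma> m \<sigma>' \<Longrightarrow> exec d \<sigma>' n \<tau> \<Longrightarrow> exec (Seq c d) \<sigma> (m + n) \<tau>"
| CondTrue: "eval_expr e \<sigma> \<noteq> Leaf \<Longrightarrow> exec c \<sigma> n \<tau> \<Longrightarrow>
    exec (Cond e c d) \<sigma> (1 + expr_time e + n) \<tau>"
| CondFalse: "eval_expr e \<sigma> = Leaf \<Longrightarrow> exec d \<sigma> n \<tau> \<Longrightarrow>
    exec (Cond e c d) \<sigma> (1 + expr_time e + n) \<tau>"
| WhileFalse: "eval_expr e \<sigma> = Leaf \<Longrightarrow> exec (While e c) \<sigma> (1 + expr_time e) \<sigma>"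
| WhileTrue: "eval_expr e \<sigma> \<noteq> Leaf \<Longrightarrow> exec c \<sigma> m \<sigma>' \<Longrightarrow> exec (While e c) \<sigma>' n \<tau> \<Longrightarrow>
    exec (While e c) \<sigma> (1 + expr_time e + m + n) \<tau>"

inductive_cases SkipE: "exec Skip \<sigma> n \<tau>"
inductive_cases AssignE: "exec (Assign x e) \<sigma> n \<tau>"
inductive_cases SeqE: "exec (Seq c d) \<sigma> n \<tau>"
inductive_cases CondE: "exec (Cond e c d) \<sigma> n \<tau>"
inductive_cases WhileE: "exec (While e c) \<sigma> n \<tau>"

lemma exec_deterministic:
  "exec c \<sigma> n \<tau> \<Longrightarrow> exec c \<sigma> n' \<tau>' \<Longrightarrow> n = n' \<and> \<tau> = \<tau>'"
proof (induction arbitrary: n' \<tau>' rule: exec.induct)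
  case (Skip \<sigma>)
  from Skip.prems show ?case by (rule SkipE) simp
next
  case (Assign x e \<sigma>)
  from Assign.prems show ?case by (rule AssignE) simp
next
  case (Seq c \<sigma> m \<sigma>' d n \<tau>)
  from Seq.prems show ?case
  proof (rule SeqE)
    fix m1 \<rho> n1
    assume *: "n' = m1 + n1" "exec c \<sigma> m1 \<rho>" "exec d \<rho> n1 \<tau>'"
    from Seq.IH(1)[OF *(2)] have "m = m1" "\<sigma>' = \<rho>" by auto
    then show ?thesis using Seq.IH(2)[of n1 \<tau>'] * by simp
  qed
next
  case (CondTrue e \<sigma> c n \<tau> d)
  from CondTrue.prems obtain n1 where *: "n' = 1 + expr_time e + n1" "exec c \<sigma> n1 \<tau>'"
    by (rule CondE) (simp_all add: CondTrue.hyps)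
  from CondTrue.IH[OF *(2)] * show ?case by simp
next
  case (CondFalse e \<sigma> d n \<tau> c)
  from CondFalse.prems obtain n1 where *: "n' = 1 + expr_time e + n1" "exec d \<sigma> n1 \<tau>'"
    by (rule CondE) (simp_all add: CondFalse.hyps)
  from CondFalse.IH[OF *(2)] * show ?case by simp
next
  case (WhileFalse e \<sigma> c)
  from WhileFalse.prems show ?case
    by (rule WhileE) (simp_all add: WhileFalse.hyps)
next
  case (WhileTrue e \<sigma> c m \<sigma>' n \<tau>)
  from WhileTrue.prems obtain m1 \<rho> n1 where
    *: "n' = 1 + expr_time e + m1 + n1" "exec c \<sigma> m1 \<rho>" "exec (While e c) \<rho> n1 \<tau>'"
    by (rule WhileE) (simp_all add: WhileTrue.hyps)
  from WhileTrue.IH(1)[OF *(2)] have "m = m1" "\<sigma>' = \<rho>" by auto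
  then show ?case using WhileTrue.IH(2)[of n1 \<tau>'] * by simp
qed

text \<open>Variable 0 holds the input and receives the output; all other variables are initially leaves.\<close>

definition computes :: "com \<Rightarrow> tree_data \<Rightarrow> nat \<Rightarrow> tree_data \<Rightarrow> bool" where
  "computes c x n y \<longleftrightarrow> (\<exists>\<tau>. exec c ((\<lambda>_. Leaf)(0 := x)) n \<tau> \<and> \<tau> 0 = y)"


section \<open>Encodings\<close>

text \<open>Binary notation: the list of bits, least significant bit first, without leading zeros.\<close>

fun enc_nat :: "nat \<Rightarrow> tree_data" where
  "enc_nat n = (if n = 0 then Leaf
     else Node (if even n then Leaf else Node Leaf Leaf) (enc_nat (n div 2)))"

declare enc_nat.simps [simp del]

fun enc_list :: "('a \<Rightarrow> tree_data) \<Rightarrow> 'a list \<Rightarrow> tree_data" where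
  "enc_list f [] = Leaf"
| "enc_list f (x # xs) = Node (f x) (enc_list f xs)"

fun enc_pair :: "('a \<Rightarrow> tree_data) \<Rightarrow> ('b \<Rightarrow> tree_data) \<Rightarrow> 'a \<times> 'b \<Rightarrow> tree_data" where
  "enc_pair f g (a, b) = Node (f a) (g b)"

fun enc_option :: "('a \<Rightarrow> tree_data) \<Rightarrow> 'a option \<Rightarrow> tree_data" where
  "enc_option f None = Leaf"
| "enc_option f (Some a) = Node Leaf (f a)"

text \<open>A finite set is given as a list of its elements without repetitions, in any order. Hence
  encodings of sets are relations.\<close>

definition encodes_set :: "('a \<Rightarrow> tree_data) \<Rightarrow> 'a set \<Rightarrow> tree_data \<Rightarrow> bool" where
  "encodes_set f A x \<longleftrightarrow> (\<exists>xs. distinct xs \<and> set xs = A \<and> x = enc_list f xs)"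


section \<open>Fixed-parameter tractability\<close>

definition computable :: "(nat \<Rightarrow> nat) \<Rightarrow> bool" where
  "computable g \<longleftrightarrow> (\<exists>c. \<forall>k. \<exists>n. computes c (enc_nat k) n (enc_nat (g k)))"

text \<open>
  A parameterized problem is given by the relation \<open>encodes\<close> between instances and their encodings,
  the parameter of an instance, and the relation \<open>answer\<close> between instances and the outputs that
  are correct for them. Only encodings of instances count as inputs.
\<close>

definition fixed_parameter_tractable ::
  "('i \<Rightarrow> tree_data \<Rightarrow> bool) \<Rightarrow> ('i \<Rightarrow> nat) \<Rightarrow> ('i \<Rightarrow> tree_data \<Rightarrow> bool) \<Rightarrow> bool" where
  "fixed_parameter_tractable encodes param answer \<longleftrightarrow>
     (\<exists>c g d. computable g \<and>
        (\<forall>i x. encodes i x \<longrightarrow>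
           (\<exists>n y. computes c x n y \<and> answer i y \<and> n \<le> g (param i) * data_size x ^ d)))"


section \<open>The problem Unlabelled Directed Token Moving\<close>

type_synonym udtm_instance = "nat pair_pre_digraph \<times> nat set \<times> nat set \<times> nat"

fun udtm_wf :: "udtm_instance \<Rightarrow> bool" where
  "udtm_wf (D, S, T, l) \<longleftrightarrow>
     pair_fin_digraph D \<and> S \<subseteq> pverts D \<and> T \<subseteq> pverts D \<and> card S = card T"

fun udtm_encodes :: "udtm_instance \<Rightarrow> tree_data \<Rightarrow> bool" where
  "udtm_encodes (D, S, T, l) x \<longleftrightarrow> udtm_wf (D, S, T, l) \<and>
     (\<exists>v a s t. encodes_set enc_nat (pverts D) v \<and>
        encodes_set (enc_pair enc_nat enc_nat) (parcs D) a \<and>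
        encodes_set enc_nat S s \<and> encodes_set enc_nat T t \<and>
        x = Node v (Node a (Node s (Node t (enc_nat l)))))"

fun udtm_param :: "udtm_instance \<Rightarrow> nat" where
  "udtm_param (D, S, T, l) = l"

text \<open>The output is a leaf (\<open>None\<close>) for no-instances; for yes-instances it is a node that carries a
  transforming sequence of length at most \<open>l\<close>. The root of the output thus decides the instance.\<close>

fun udtm_answer :: "udtm_instance \<Rightarrow> tree_data \<Rightarrow> bool" where
  "udtm_answer (D, S, T, l) y \<longleftrightarrow>
     (if \<exists>ms. transforming D S ms T \<and> length ms \<le> l
      then \<exists>ms. transforming D S ms T \<and> length ms \<le> l \<and>
             y = enc_option (enc_list (enc_pair enc_nat enc_nat)) (Some ms)
      else y = enc_option (enc_list (enc_pair enc_nat enc_nat)) (None :: (nat \<times> nat) list option))"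

lemma encodes_set_exists: "finite A \<Longrightarrow> \<exists>x. encodes_set f A x"
  unfolding encodes_set_def using finite_distinct_list by metis

lemma udtm_encoding_exists:
  assumes "udtm_wf i"
  shows "\<exists>x. udtm_encodes i x"
proof (cases i)
  case (fields D S T l)
  interpret pair_fin_digraph D using assms fields by simp
  have sub: "S \<subseteq> pverts D" "T \<subseteq> pverts D"
    using assms unfolding fields udtm_wf.simps by blast+
  obtain v where "encodes_set enc_nat (pverts D) v"
    using encodes_set_exists[OF pair_finite_verts] by blast
  moreover obtain a where "encodes_set (enc_pair enc_nat enc_nat) (parcs D) a"
    using encodes_set_exists[OF pair_finite_arcs] by blast
  moreover obtain s where "encodes_set enc_nat S s"
    using encodes_set_exists[OF finite_subset[OF sub(1) pair_finite_verts]] by blast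
  moreover obtain t where "encodes_set enc_nat T t"
    using encodes_set_exists[OF finite_subset[OF sub(2) pair_finite_verts]] by blast
  ultimately have "udtm_encodes i (Node v (Node a (Node s (Node t (enc_nat l)))))"
    using assms unfolding fields udtm_encodes.simps by blast
  then show ?thesis ..
qed

end

theory Submission
  imports Defs
begin

text \<open>
  The optimum is the least number of tokens in a vertex set \<open>W\<close> that supports an uncapacitated flow from
  the sources \<open>S - T\<close> to the targets \<open>T - S\<close>. The free paths of a transforming sequence add up to such a
  flow, and every token in \<open>W\<close> has to move. Conversely, in an acyclic flow the targets can be filled
  starting from the last ones, so that every token in \<open>W\<close> moves at most once.

  Cancelling circulations turns the support of a flow into a forest. Its cost is therefore found by
  dynamic programming over triples of a set of terminals (there are at most \<open>4 ^ l\<close> such sets), a root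
  and a cost, as in the algorithm of Dreyfus and Wagner for Steiner trees. The trees that are joined
  may overlap, since this only makes the solution cheaper. A transforming sequence is then
  reconstructed backwards by self-reduction.

  All parts of the algorithm are polynomial once the list of the bit strings of length \<open>2 * l\<close> is available.
\<close>

section \<open>Polynomial-time programs\<close>

text \<open>A table over subsets of terminals cannot record how much flow each arc carries. In a
  forest this is no loss: an arc that cuts off a set \<open>X\<close> of terminals has to carry
  exactly the surplus of sources over targets in \<open>X\<close>, so the sign of this number alone
  decides which orientation the arc must have. Capacities never enter, since a token standing on a
  path is a relay rather than an obstacle: it moves on and is replaced. Terminal sets that are too
  large are never tested for. A sequence of \<open>l\<close> moves vacates at most \<open>l\<close>
  vertices, so a yes-instance has at most \<open>2 * l\<close> terminals, and on the other instances
  the table still contains only correct assertions. Running times are composed from combinators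
  relative to a measure that majorizes the input size. With the measure
  \<open>data_size x * 2 ^ l\<close>, a polynomial bound splits at once into a function of
  \<open>l\<close> times a power of the size. The reconstruction needs no search for free paths:
  whether a single move is possible is itself a question to the decision procedure, with budget
  1.\<close>

fun assigned :: "com \<Rightarrow> nat set" where
  "assigned Skip = {}"
| "assigned (Assign x e) = {x}"
| "assigned (Seq c d) = assigned c \<union> assigned d"
| "assigned (Cond e c d) = assigned c \<union> assigned d"
| "assigned (While e c) = assigned c"

lemma finite_assigned: "finite (assigned c)"
  by (induction c) auto

text \<open>Allows a value to be kept in a fresh variable while a program runs of which only the
  effect on variable 0 is known.\<close>

lemma exec_frame: "exec c \<sigma> n \<tau> \<Longrightarrow> x \<notin> assigned c \<Longrightarrow> \<tau> x = \<sigma> x"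
  by (induction rule: exec.induct) auto

lemma ex_fresh: "\<exists>v::nat. v \<noteq> 0 \<and> v \<notin> assigned c"
proof -
  have "finite (insert 0 (assigned c))" by (simp add: finite_assigned)
  then have "\<exists>v. v \<notin> insert 0 (assigned c)" using ex_new_if_finite infinite_UNIV_nat by blast
  then show ?thesis by auto
qed

lemma data_size_pos [simp]: "0 < data_size x"
  by (cases x) auto

lemma data_size_ge1: "1 \<le> data_size x"
  by (cases x) auto

section \<open>Polynomial bounds relative to a measure\<close>

text \<open>One number serves as coefficient and as exponent, so that there is a single witness; for
  measures that are at least 1, bounds are merged by enlarging it.\<close>

definition poly_bounded :: "('a \<Rightarrow> nat) \<Rightarrow> ('a \<Rightarrow> nat) \<Rightarrow> bool" where
  "poly_bounded m b \<longleftrightarrow> (\<exists>k. \<forall>x. b x \<le> k * m x ^ k)"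

lemma poly_boundedI: "(\<And>x. b x \<le> k * m x ^ k) \<Longrightarrow> poly_bounded m b"
  unfolding poly_bounded_def by blast

lemma poly_bounded_mono: "poly_bounded m b \<Longrightarrow> (\<And>x. a x \<le> b x) \<Longrightarrow> poly_bounded m a"
  unfolding poly_bounded_def by (meson le_trans)

lemma poly_bounded_measure: "poly_bounded m m"
  by (rule poly_boundedI[where k = 1]) simp

lemma poly_bounded_add:
  assumes "\<And>x. 1 \<le> m x" "poly_bounded m a" "poly_bounded m b"
  shows "poly_bounded m (\<lambda>x. a x + b x)"
proof -
  obtain k l where kl: "\<And>x. a x \<le> k * m x ^ k" "\<And>x. b x \<le> l * m x ^ l"
    using assms(2,3) unfolding poly_bounded_def by blast
  show ?thesis
  proof (rule poly_boundedI[where k = "k + l"])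
    fix x
    have "k * m x ^ k \<le> k * m x ^ (k + l)" "l * m x ^ l \<le> l * m x ^ (k + l)"
      using assms(1)[of x] by (auto intro!: mult_left_mono power_increasing)
    then show "a x + b x \<le> (k + l) * m x ^ (k + l)"
      using kl[of x] unfolding add_mult_distrib by linarith
  qed
qed

lemma poly_bounded_mult:
  assumes "\<And>x. 1 \<le> m x" "poly_bounded m a" "poly_bounded m b"
  shows "poly_bounded m (\<lambda>x. a x * b x)"
proof -
  obtain k l where kl: "\<And>x. a x \<le> k * m x ^ k" "\<And>x. b x \<le> l * m x ^ l"
    using assms(2,3) unfolding poly_bounded_def by blast
  show ?thesis
  proof (rule poly_boundedI[where k = "k + l + k * l"])
    fix x
    have "a x * b x \<le> (k * m x ^ k) * (l * m x ^ l)"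
      using kl[of x] by (simp add: mult_le_mono)
    also have "\<dots> = (k * l) * m x ^ (k + l)" by (simp add: power_add)
    also have "\<dots> \<le> (k + l + k * l) * m x ^ (k + l + k * l)"
      using assms(1)[of x] by (intro mult_le_mono power_increasing) auto
    finally show "a x * b x \<le> (k + l + k * l) * m x ^ (k + l + k * l)" .
  qed
qed

lemma poly_bounded_const:
  assumes "\<And>x. 1 \<le> m x"
  shows "poly_bounded m (\<lambda>x. c)"
proof (rule poly_boundedI[where k = c])
  fix x
  show "c \<le> c * m x ^ c" using one_le_power[OF assms[of x], of c] by simp
qed

lemma poly_bounded_power:
  assumes "\<And>x. 1 \<le> m x" "poly_bounded m a"
  shows "poly_bounded m (\<lambda>x. a x ^ n)"
  by (induction n) (auto intro: poly_bounded_mult poly_bounded_const assms)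

lemma poly_bounded_comp:
  assumes "\<And>x. 1 \<le> m x" "poly_bounded r b" "poly_bounded m (\<lambda>x. r (f x))"
  shows "poly_bounded m (\<lambda>x. b (f x))"
proof -
  obtain k where k: "\<And>y. b y \<le> k * r y ^ k"
    using assms(2) unfolding poly_bounded_def by blast
  have "poly_bounded m (\<lambda>x. k * r (f x) ^ k)"
    by (intro poly_bounded_mult poly_bounded_const poly_bounded_power assms(1,3))
  then show ?thesis by (rule poly_bounded_mono) (rule k)
qed

section \<open>Polynomial-time functions and their closure properties\<close>

definition computes_within :: "com \<Rightarrow> (tree_data \<Rightarrow> tree_data) \<Rightarrow> (tree_data \<Rightarrow> nat) \<Rightarrow> bool" where
  "computes_within c f b \<longleftrightarrow>
     (\<forall>\<sigma>. \<exists>n \<tau>. exec c \<sigma> n \<tau> \<and> \<tau> 0 = f (\<sigma> 0) \<and> n \<le> b (\<sigma> 0))"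

lemma computes_withinE:
  assumes "computes_within c f b"
  obtains n \<tau> where "exec c \<sigma> n \<tau>" "\<tau> 0 = f (\<sigma> 0)" "n \<le> b (\<sigma> 0)"
  using assms unfolding computes_within_def by blast

text \<open>The measure \<open>m\<close> may exceed the size of the input: the part of the algorithm that depends
  exponentially on the parameter is polynomial with respect to a suitable \<open>m\<close>.\<close>

definition polytime :: "(tree_data \<Rightarrow> nat) \<Rightarrow> (tree_data \<Rightarrow> tree_data) \<Rightarrow> bool" where
  "polytime m f \<longleftrightarrow> (\<forall>x. data_size x \<le> m x) \<and> poly_bounded m (\<lambda>x. data_size (f x)) \<and>
     (\<exists>c b. poly_bounded m b \<and> computes_within c f b)"

lemma polytime_ge1: "polytime m f \<Longrightarrow> 1 \<le> m x"
  unfolding polytime_def by (metis data_size_ge1 le_trans)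

lemma polytime_size: "polytime m f \<Longrightarrow> poly_bounded m (\<lambda>x. data_size (f x))"
  unfolding polytime_def by blast

lemma polytime_measure: "polytime m f \<Longrightarrow> data_size x \<le> m x"
  unfolding polytime_def by blast

lemma polytimeI:
  assumes "\<And>x. data_size x \<le> m x" "poly_bounded m (\<lambda>x. data_size (f x))" "poly_bounded m b"
    "\<And>\<sigma>. \<exists>n \<tau>. exec c \<sigma> n \<tau> \<and> \<tau> 0 = f (\<sigma> 0) \<and> n \<le> b (\<sigma> 0)"
  shows "polytime m f"
  using assms unfolding polytime_def computes_within_def by blast

lemma polytimeE:
  assumes "polytime m f"
  obtains c b where "poly_bounded m b" "computes_within c f b"
  using assms unfolding polytime_def by blast

lemma ge1_if_data_size_le:
  fixes m :: "tree_data \<Rightarrow> nat"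
  assumes "\<And>x. data_size x \<le> m x" shows "1 \<le> m x"
  using le_trans[OF data_size_ge1 assms] .

lemma polytime_expr:
  assumes m: "\<And>x. data_size x \<le> m x" "poly_bounded m (\<lambda>x. data_size (f x))"
    and e: "\<And>\<sigma>. eval_expr e \<sigma> = f (\<sigma> 0)"
  shows "polytime m f"
proof (rule polytimeI[OF m])
  note ge1 = ge1_if_data_size_le[OF m(1)]
  show "poly_bounded m (\<lambda>x. 1 + expr_time e)" by (rule poly_bounded_const[OF ge1])
  fix \<sigma>
  show "\<exists>n \<tau>. exec (Assign 0 e) \<sigma> n \<tau> \<and> \<tau> 0 = f (\<sigma> 0) \<and> n \<le> 1 + expr_time e"
    using exec.Assign[of 0 e \<sigma>] e by fastforce
qed

lemma polytime_id:
  assumes "\<And>x. data_size x \<le> m x" shows "polytime m (\<lambda>x. x)"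
  by (rule polytime_expr[where e = "Var 0"])
     (auto intro: assms poly_bounded_mono[OF poly_bounded_measure])

lemma polytime_id_size: "polytime data_size (\<lambda>x. x)"
  by (rule polytime_id) simp

text \<open>The outer function has to be polynomial in the size of its own input, because the value
  of \<open>m\<close> at the intermediate result says nothing about \<open>m x\<close>.\<close>

lemma polytime_comp:
  assumes g: "polytime data_size g" and f: "polytime m f"
  shows "polytime m (\<lambda>x. g (f x))"
proof -
  obtain c a where ca: "poly_bounded m a" "computes_within c f a" using polytimeE[OF f] .
  obtain d b where db: "poly_bounded data_size b" "computes_within d g b" using polytimeE[OF g] .
  note ge1 = polytime_ge1[OF f]
  show ?thesis
  proof (rule polytimeI[OF polytime_measure[OF f]])
    show "poly_bounded m (\<lambda>x. data_size (g (f x)))"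
      by (rule poly_bounded_comp[OF ge1 polytime_size[OF g] polytime_size[OF f]])
    show "poly_bounded m (\<lambda>x. a x + b (f x))"
      by (intro poly_bounded_add poly_bounded_comp[OF ge1 db(1)] ge1 ca polytime_size[OF f])
    fix \<sigma>
    obtain n \<rho> where 1: "exec c \<sigma> n \<rho>" "\<rho> 0 = f (\<sigma> 0)" "n \<le> a (\<sigma> 0)"
      using computes_withinE[OF ca(2)] .
    obtain n' \<tau> where 2: "exec d \<rho> n' \<tau>" "\<tau> 0 = g (\<rho> 0)" "n' \<le> b (\<rho> 0)"
      using computes_withinE[OF db(2)] .
    show "\<exists>n \<tau>. exec (Seq c d) \<sigma> n \<tau> \<and> \<tau> 0 = g (f (\<sigma> 0)) \<and> n \<le> a (\<sigma> 0) + b (f (\<sigma> 0))"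
      using exec.Seq[OF 1(1) 2(1)] 1 2 by (intro exI[of _ "n + n'"] exI[of _ \<tau>] conjI) auto
  qed
qed

lemma polytime_Leaf:
  assumes "\<And>x. data_size x \<le> m x" shows "polytime m (\<lambda>x. Leaf)"
  by (rule polytime_expr[where e = LeafE])
     (auto intro: assms poly_bounded_const ge1_if_data_size_le[OF assms])

lemma data_size_hd_le: "data_size (hd_data x) \<le> data_size x"
  by (cases x) auto

lemma data_size_tl_le: "data_size (tl_data x) \<le> data_size x"
  by (cases x) auto

lemma polytime_hd:
  assumes "polytime m f" shows "polytime m (\<lambda>x. hd_data (f x))"
proof (rule polytime_comp[OF _ assms])
  show "polytime data_size hd_data"
    by (rule polytime_expr[where e = "HdE (Var 0)"])
      (auto intro: poly_bounded_mono[OF poly_bounded_measure] data_size_hd_le)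
qed

lemma polytime_tl:
  assumes "polytime m f" shows "polytime m (\<lambda>x. tl_data (f x))"
proof (rule polytime_comp[OF _ assms])
  show "polytime data_size tl_data"
    by (rule polytime_expr[where e = "TlE (Var 0)"])
      (auto intro: poly_bounded_mono[OF poly_bounded_measure] data_size_tl_le)
qed

text \<open>Both subprograms read and overwrite variable 0. The fresh variable \<open>v\<close>
  saves the input for the second one, and \<open>w\<close> saves the result of the first
  one.\<close>

lemma polytime_Node:
  assumes f: "polytime m f" and g: "polytime m g"
  shows "polytime m (\<lambda>x. Node (f x) (g x))"
proof -
  obtain c a where ca: "poly_bounded m a" "computes_within c f a" using polytimeE[OF f] .
  obtain d b where db: "poly_bounded m b" "computes_within d g b" using polytimeE[OF g] .
  note ge1 = polytime_ge1[OF f]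
  obtain v where v: "v \<noteq> 0" "v \<notin> assigned (Seq c d)" using ex_fresh by blast
  obtain w where w: "w \<noteq> 0" "w \<notin> assigned (Seq (Assign v (Var 0)) (Seq c d))" using ex_fresh by blast
  then have wv: "w \<noteq> v" by auto
  let ?p = "Seq (Assign v (Var 0)) (Seq c (Seq (Assign w (Var 0))
    (Seq (Assign 0 (Var v)) (Seq d (Assign 0 (NodeE (Var w) (Var 0)))))))"
  show ?thesis
  proof (rule polytimeI[OF polytime_measure[OF f]])
    have "poly_bounded m (\<lambda>x. 1 + (data_size (f x) + data_size (g x)))"
      by (intro poly_bounded_add poly_bounded_const ge1 polytime_size f g)
    then show "poly_bounded m (\<lambda>x. data_size (Node (f x) (g x)))" by simp
    show "poly_bounded m (\<lambda>x. 10 + (a x + b x))"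
      by (intro poly_bounded_add poly_bounded_const ge1 ca db)
    fix \<sigma> :: store
    let ?\<sigma>1 = "\<sigma>(v := \<sigma> 0)"
    have e1: "exec (Assign v (Var 0)) \<sigma> 2 ?\<sigma>1" using exec.Assign[of v "Var 0" \<sigma>] by (simp add: numeral_eq_Suc)
    obtain n \<rho> where 1: "exec c ?\<sigma>1 n \<rho>" "\<rho> 0 = f (?\<sigma>1 0)" "n \<le> a (?\<sigma>1 0)"
      using computes_withinE[OF ca(2)] .
    have \<rho>v: "\<rho> v = \<sigma> 0" using exec_frame[OF 1(1), of v] v by simp
    let ?\<rho>1 = "\<rho>(w := \<rho> 0)"
    have e2: "exec (Assign w (Var 0)) \<rho> 2 ?\<rho>1" using exec.Assign[of w "Var 0" \<rho>] by (simp add: numeral_eq_Suc)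
    let ?\<rho>2 = "?\<rho>1(0 := ?\<rho>1 v)"
    have e3: "exec (Assign 0 (Var v)) ?\<rho>1 2 ?\<rho>2" using exec.Assign[of 0 "Var v" ?\<rho>1] by (simp add: numeral_eq_Suc)
    have r0: "?\<rho>2 0 = \<sigma> 0" using \<rho>v wv by simp
    obtain n' \<tau> where 2: "exec d ?\<rho>2 n' \<tau>" "\<tau> 0 = g (?\<rho>2 0)" "n' \<le> b (?\<rho>2 0)"
      using computes_withinE[OF db(2)] .
    have \<tau>w: "\<tau> w = f (\<sigma> 0)" using exec_frame[OF 2(1), of w] w v 1(2) by simp
    let ?\<tau>1 = "\<tau>(0 := Node (\<tau> w) (\<tau> 0))"
    have e4: "exec (Assign 0 (NodeE (Var w) (Var 0))) \<tau> 4 ?\<tau>1"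
      using exec.Assign[of 0 "NodeE (Var w) (Var 0)" \<tau>] by (simp add: numeral_eq_Suc)
    have "exec ?p \<sigma> (2 + (n + (2 + (2 + (n' + 4))))) ?\<tau>1"
      by (intro exec.Seq[OF e1] exec.Seq[OF 1(1)] exec.Seq[OF e2] exec.Seq[OF e3] exec.Seq[OF 2(1)] e4)
    then show "\<exists>n \<tau>. exec ?p \<sigma> n \<tau> \<and> \<tau> 0 = Node (f (\<sigma> 0)) (g (\<sigma> 0)) \<and>
        n \<le> 10 + (a (\<sigma> 0) + b (\<sigma> 0))"
      using 1(3) 2 \<tau>w r0 v(1)
      by (intro exI[of _ "2 + (n + (2 + (2 + (n' + 4))))"] exI[of _ ?\<tau>1] conjI) auto
  qed
qed

lemma polytime_if_hd:
  assumes f: "polytime data_size f" and g: "polytime data_size g"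
  shows "polytime data_size (\<lambda>x. if hd_data x \<noteq> Leaf then f (tl_data x) else g (tl_data x))"
proof -
  have f': "polytime data_size (\<lambda>x. f (tl_data x))" and g': "polytime data_size (\<lambda>x. g (tl_data x))"
    by (intro polytime_comp[OF f] polytime_comp[OF g] polytime_tl polytime_id_size)+
  obtain c a where ca: "poly_bounded data_size a" "computes_within c (\<lambda>x. f (tl_data x)) a"
    using polytimeE[OF f'] .
  obtain d b where db: "poly_bounded data_size b" "computes_within d (\<lambda>x. g (tl_data x)) b"
    using polytimeE[OF g'] .
  let ?p = "Cond (HdE (Var 0)) c d"
  show ?thesis
  proof (rule polytimeI[OF order_refl])
    have "poly_bounded data_size (\<lambda>x. data_size (f (tl_data x)) + data_size (g (tl_data x)))"
      by (intro poly_bounded_add data_size_ge1 polytime_size f' g')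
    then show "poly_bounded data_size
        (\<lambda>x. data_size (if hd_data x \<noteq> Leaf then f (tl_data x) else g (tl_data x)))"
      by (rule poly_bounded_mono) simp
    show "poly_bounded data_size (\<lambda>x. 3 + (a x + b x))"
      by (intro poly_bounded_add poly_bounded_const data_size_ge1 ca db)
    fix \<sigma>
    obtain n \<rho> where 1: "exec c \<sigma> n \<rho>" "\<rho> 0 = f (tl_data (\<sigma> 0))" "n \<le> a (\<sigma> 0)"
      using computes_withinE[OF ca(2)] .
    obtain n' \<tau> where 2: "exec d \<sigma> n' \<tau>" "\<tau> 0 = g (tl_data (\<sigma> 0))" "n' \<le> b (\<sigma> 0)"
      using computes_withinE[OF db(2)] .
    show "\<exists>n \<tau>. exec ?p \<sigma> n \<tau> \<and> \<tau> 0 = (if hd_data (\<sigma> 0) \<noteq> Leaf then f (tl_data (\<sigma> 0))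
        else g (tl_data (\<sigma> 0))) \<and> n \<le> 3 + (a (\<sigma> 0) + b (\<sigma> 0))"
    proof (cases "hd_data (\<sigma> 0) = Leaf")
      case True
      then show ?thesis using exec.CondFalse[of "HdE (Var 0)" \<sigma> d n' \<tau> c] 2
        by (intro exI[of _ "3 + n'"] exI[of _ \<tau>] conjI) (auto simp: numeral_eq_Suc)
    next
      case False
      then show ?thesis using exec.CondTrue[of "HdE (Var 0)" \<sigma> c n \<rho> d] 1
        by (intro exI[of _ "3 + n"] exI[of _ \<rho>] conjI) (auto simp: numeral_eq_Suc)
    qed
  qed
qed

definition bool_data :: "bool \<Rightarrow> tree_data" where
  "bool_data P = (if P then Node Leaf Leaf else Leaf)"

lemma bool_data_eq_Leaf [simp]: "bool_data P = Leaf \<longleftrightarrow> \<not> P"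
  unfolding bool_data_def by simp

text \<open>Both branches are evaluated and a projection picks one of them, which costs no more than
  the sum of two polynomials.\<close>

lemma polytime_if:
  assumes P: "polytime m (\<lambda>x. bool_data (P x))" and f: "polytime m f" and g: "polytime m g"
  shows "polytime m (\<lambda>x. if P x then f x else g x)"
proof -
  have *: "polytime data_size (\<lambda>x. if hd_data x \<noteq> Leaf then hd_data (tl_data x) else tl_data (tl_data x))"
    by (rule polytime_if_hd[of hd_data tl_data])
      (rule polytime_hd[OF polytime_id_size] polytime_tl[OF polytime_id_size])+
  have "polytime m (\<lambda>x. Node (bool_data (P x)) (Node (f x) (g x)))"
    by (intro polytime_Node P f g)
  from polytime_comp[OF * this] show ?thesis by (simp cong: if_cong)
qed

lemma polytime_const:
  assumes "\<And>x. data_size x \<le> m x" shows "polytime m (\<lambda>x. t)"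
  by (induction t) (auto intro: polytime_Leaf polytime_Node assms)

lemma polytime_not:
  assumes "polytime m (\<lambda>x. bool_data (P x))"
  shows "polytime m (\<lambda>x. bool_data (\<not> P x))"
proof -
  have "polytime m (\<lambda>x. if P x then Leaf else Node Leaf Leaf)"
    by (intro polytime_if assms polytime_const polytime_measure[OF assms])
  moreover have "(\<lambda>x. if P x then Leaf else Node Leaf Leaf) = (\<lambda>x. bool_data (\<not> P x))"
    by (auto simp: bool_data_def)
  ultimately show ?thesis by simp
qed

lemma polytime_conj:
  assumes "polytime m (\<lambda>x. bool_data (P x))" "polytime m (\<lambda>x. bool_data (Q x))"
  shows "polytime m (\<lambda>x. bool_data (P x \<and> Q x))"
proof -
  have "polytime m (\<lambda>x. if P x then bool_data (Q x) else Leaf)"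
    by (intro polytime_if assms polytime_const polytime_measure[OF assms(1)])
  moreover have "(\<lambda>x. if P x then bool_data (Q x) else Leaf) = (\<lambda>x. bool_data (P x \<and> Q x))"
    by (auto simp: bool_data_def)
  ultimately show ?thesis by simp
qed

lemma polytime_disj:
  assumes "polytime m (\<lambda>x. bool_data (P x))" "polytime m (\<lambda>x. bool_data (Q x))"
  shows "polytime m (\<lambda>x. bool_data (P x \<or> Q x))"
proof -
  have "polytime m (\<lambda>x. if P x then Node Leaf Leaf else bool_data (Q x))"
    by (intro polytime_if assms polytime_const polytime_measure[OF assms(1)])
  moreover have "(\<lambda>x. if P x then Node Leaf Leaf else bool_data (Q x)) = (\<lambda>x. bool_data (P x \<or> Q x))"
    by (auto simp: bool_data_def)
  ultimately show ?thesis by simp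
qed

lemma polytime_is_Leaf:
  assumes "polytime m f" shows "polytime m (\<lambda>x. bool_data (f x = Leaf))"
proof -
  have *: "polytime data_size (\<lambda>x. if hd_data x \<noteq> Leaf then Leaf else Node Leaf Leaf)"
    by (rule polytime_if_hd[of "\<lambda>_. Leaf" "\<lambda>_. Node Leaf Leaf"]) (auto intro: polytime_const)
  have "polytime m (\<lambda>x. Node (f x) Leaf)"
    by (intro polytime_Node assms polytime_Leaf polytime_measure[OF assms])
  from polytime_comp[OF * this] show ?thesis
    by (rule back_subst[of "polytime m"]) (auto simp: bool_data_def)
qed

section \<open>Loops\<close>

lemma exec_loop:
  assumes c: "computes_within c F b"
    and "\<And>i. i < N \<Longrightarrow> hd_data ((F ^^ i) (\<sigma> 0)) \<noteq> Leaf" "hd_data ((F ^^ N) (\<sigma> 0)) = Leaf"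
  shows "\<exists>n \<tau>. exec (While (HdE (Var 0)) c) \<sigma> n \<tau> \<and> \<tau> 0 = (F ^^ N) (\<sigma> 0) \<and>
    n \<le> 3 + (\<Sum>i<N. 3 + b ((F ^^ i) (\<sigma> 0)))"
  using assms(2,3)
proof (induction N arbitrary: \<sigma>)
  case 0
  then show ?case using exec.WhileFalse[of "HdE (Var 0)" \<sigma> c]
    by (intro exI[of _ 3] exI[of _ \<sigma>] conjI) (auto simp: numeral_eq_Suc)
next
  case (Suc N)
  obtain n \<rho> where 1: "exec c \<sigma> n \<rho>" "\<rho> 0 = F (\<sigma> 0)" "n \<le> b (\<sigma> 0)"
    using computes_withinE[OF c] .
  have shift: "(F ^^ i) (\<rho> 0) = (F ^^ Suc i) (\<sigma> 0)" for i
    using 1(2) by (simp add: funpow_swap1)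
  have "hd_data ((F ^^ i) (\<rho> 0)) \<noteq> Leaf" if "i < N" for i
    unfolding shift using Suc.prems(1)[of "Suc i"] that by blast
  moreover have "hd_data ((F ^^ N) (\<rho> 0)) = Leaf"
    unfolding shift using Suc.prems(2) .
  ultimately obtain n' \<tau> where 2: "exec (While (HdE (Var 0)) c) \<rho> n' \<tau>"
    "\<tau> 0 = (F ^^ N) (\<rho> 0)" "n' \<le> 3 + (\<Sum>i<N. 3 + b ((F ^^ i) (\<rho> 0)))" using Suc.IH by blast
  have ne: "eval_expr (HdE (Var 0)) \<sigma> \<noteq> Leaf" using Suc.prems(1)[of 0] by simp
  have "(\<Sum>i<Suc N. 3 + b ((F ^^ i) (\<sigma> 0))) = 3 + b (\<sigma> 0) + (\<Sum>i<N. 3 + b ((F ^^ Suc i) (\<sigma> 0)))"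
    by (subst sum.lessThan_Suc_shift) simp
  then have "1 + expr_time (HdE (Var 0)) + n + n' \<le> 3 + (\<Sum>i<Suc N. 3 + b ((F ^^ i) (\<sigma> 0)))"
    using 1(3) 2(3) unfolding shift by simp
  then show ?case using exec.WhileTrue[OF ne 1(1) 2(1)] 2(2) unfolding shift by blast
qed

text \<open>Iterating a polynomial step can square the size in every round, so the bound
  \<open>B\<close> on all intermediate states has to be supplied. The running time is then the
  number of rounds times the cost of the step on states of size \<open>B\<close>.\<close>

lemma polytime_loop:
  assumes F: "polytime data_size F"
    and m: "\<And>x. data_size x \<le> m x"
    and i: "polytime m i"
    and N: "poly_bounded m N"
    and B: "poly_bounded m B" "\<And>x j. j \<le> N x \<Longrightarrow> data_size ((F ^^ j) (i x)) \<le> B x"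
    and stop: "\<And>x j. j < N x \<Longrightarrow> hd_data ((F ^^ j) (i x)) \<noteq> Leaf"
      "\<And>x. hd_data ((F ^^ N x) (i x)) = Leaf"
  shows "polytime m (\<lambda>x. (F ^^ N x) (i x))"
proof -
  obtain c b where cb: "poly_bounded data_size b" "computes_within c F b" using polytimeE[OF F] .
  obtain c0 a where ca: "poly_bounded m a" "computes_within c0 i a" using polytimeE[OF i] .
  obtain k where k: "\<And>y. b y \<le> k * data_size y ^ k"
    using cb(1) unfolding poly_bounded_def by blast
  note ge1 = ge1_if_data_size_le[OF m]
  show ?thesis
  proof (rule polytimeI[OF m])
    show "poly_bounded m (\<lambda>x. data_size ((F ^^ N x) (i x)))"
      using B by (intro poly_bounded_mono[OF B(1)]) auto
    show "poly_bounded m (\<lambda>x. a x + (3 + N x * (3 + k * B x ^ k)))"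
      by (intro poly_bounded_add poly_bounded_mult poly_bounded_const poly_bounded_power ge1 ca N B(1))
    fix \<sigma>
    obtain n \<rho> where 1: "exec c0 \<sigma> n \<rho>" "\<rho> 0 = i (\<sigma> 0)" "n \<le> a (\<sigma> 0)"
      using computes_withinE[OF ca(2)] .
    obtain n' \<tau> where 2: "exec (While (HdE (Var 0)) c) \<rho> n' \<tau>" "\<tau> 0 = (F ^^ N (\<sigma> 0)) (i (\<sigma> 0))"
      "n' \<le> 3 + (\<Sum>j<N (\<sigma> 0). 3 + b ((F ^^ j) (i (\<sigma> 0))))"
      using exec_loop[OF cb(2), of "N (\<sigma> 0)" \<rho>] stop[where x = "\<sigma> 0"] 1(2) by auto
    have "(\<Sum>j<N (\<sigma> 0). 3 + b ((F ^^ j) (i (\<sigma> 0)))) \<le> (\<Sum>j<N (\<sigma> 0). 3 + k * B (\<sigma> 0) ^ k)"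
    proof (rule sum_mono)
      fix j assume "j \<in> {..<N (\<sigma> 0)}"
      then have "k * data_size ((F ^^ j) (i (\<sigma> 0))) ^ k \<le> k * B (\<sigma> 0) ^ k"
        using B(2)[of j "\<sigma> 0"] by (intro mult_left_mono power_mono) auto
      then show "3 + b ((F ^^ j) (i (\<sigma> 0))) \<le> 3 + k * B (\<sigma> 0) ^ k"
        using k[of "(F ^^ j) (i (\<sigma> 0))"] by linarith
    qed
    then have "n + n' \<le> a (\<sigma> 0) + (3 + N (\<sigma> 0) * (3 + k * B (\<sigma> 0) ^ k))"
      using 1(3) 2(3) by simp
    then show "\<exists>n \<tau>. exec (Seq c0 (While (HdE (Var 0)) c)) \<sigma> n \<tau> \<and>
        \<tau> 0 = (F ^^ N (\<sigma> 0)) (i (\<sigma> 0)) \<and> n \<le> a (\<sigma> 0) + (3 + N (\<sigma> 0) * (3 + k * B (\<sigma> 0) ^ k))"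
      using exec.Seq[OF 1(1) 2(1)] 2(2) by blast
  qed
qed

section \<open>Trees as lists\<close>

fun to_list :: "tree_data \<Rightarrow> tree_data list" where
  "to_list Leaf = []"
| "to_list (Node a b) = a # to_list b"

fun from_list :: "tree_data list \<Rightarrow> tree_data" where
  "from_list [] = Leaf"
| "from_list (x # xs) = Node x (from_list xs)"

lemma to_list_from_list [simp]: "to_list (from_list xs) = xs"
  by (induction xs) auto

lemma from_list_to_list [simp]: "from_list (to_list x) = x"
  by (induction x) auto

lemma from_list_eq_Leaf [simp]: "from_list xs = Leaf \<longleftrightarrow> xs = []"
  by (cases xs) auto

lemma to_list_eq_Nil [simp]: "to_list x = [] \<longleftrightarrow> x = Leaf"
  by (cases x) auto

lemma hd_from_list: "xs \<noteq> [] \<Longrightarrow> hd_data (from_list xs) = hd xs"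
  by (cases xs) auto

lemma tl_from_list: "tl_data (from_list xs) = from_list (tl xs)"
  by (cases xs) auto

lemma to_list_tl: "to_list (tl_data t) = tl (to_list t)"
  by (cases t) auto

lemma enc_list_conv: "enc_list f xs = from_list (map f xs)"
  by (induction xs) auto

lemma data_size_from_list: "data_size (from_list xs) = 1 + (\<Sum>x\<leftarrow>xs. 1 + data_size x)"
  by (induction xs) auto

lemma data_size_mem: "e \<in> set (to_list t) \<Longrightarrow> data_size e \<le> data_size t"
  by (induction t) (auto intro: le_SucI trans_le_add2)

lemma length_to_list_le: "length (to_list t) \<le> data_size t"
  by (induction t) auto

lemma data_size_take: "data_size (from_list (take j xs)) \<le> data_size (from_list xs)"
  by (induction xs arbitrary: j) (auto simp: take_Cons split: nat.split)

lemma data_size_drop: "data_size (from_list (drop j xs)) \<le> data_size (from_list xs)"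
  by (induction xs arbitrary: j) (auto simp: drop_Cons le_SucI trans_le_add2 split: nat.split)

lemma data_size_filter: "data_size (from_list (filter P xs)) \<le> data_size (from_list xs)"
  by (induction xs) auto

lemma data_size_from_list_append:
  "data_size (from_list (xs @ ys)) + 1 = data_size (from_list xs) + data_size (from_list ys)"
  by (induction xs) auto

lemma data_size_from_list_le:
  assumes "\<And>x. x \<in> set xs \<Longrightarrow> data_size x \<le> b"
  shows "data_size (from_list xs) \<le> 1 + length xs * (1 + b)"
  using assms by (induction xs) fastforce+

section \<open>Folds over lists\<close>

text \<open>The state consists of the remaining list, the accumulator and the whole input, which is
  passed on unchanged. The list comes first because loops test the head of their state.\<close>

definition fold_step :: "(tree_data \<Rightarrow> tree_data \<Rightarrow> tree_data \<Rightarrow> tree_data) \<Rightarrow> tree_data \<Rightarrow> tree_data" where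
  "fold_step F s = Node (tl_data (hd_data s))
     (Node (F (hd_data (tl_data s)) (hd_data (hd_data s)) (tl_data (tl_data s))) (tl_data (tl_data s)))"

lemma funpow_fold_step:
  "j \<le> length xs \<Longrightarrow> (fold_step F ^^ j) (Node (from_list xs) (Node a x)) =
     Node (from_list (drop j xs)) (Node (foldl (\<lambda>a e. F a e x) a (take j xs)) x)"
proof (induction j)
  case (Suc j)
  then have "j < length xs" by simp
  then show ?case using Suc
    by (simp add: fold_step_def hd_from_list tl_from_list tl_drop drop_Suc[symmetric] hd_drop_conv_nth
        take_Suc_conv_app_nth flip: drop_Suc)
qed simp

lemma polytime_foldl:
  assumes F: "polytime data_size (\<lambda>z. F (hd_data z) (hd_data (tl_data z)) (tl_data (tl_data z)))"
    and i: "polytime m i" and f: "polytime m f"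
    and B: "poly_bounded m B"
      "\<And>x j. data_size (foldl (\<lambda>a e. F a e x) (i x) (take j (to_list (f x)))) \<le> B x"
  shows "polytime m (\<lambda>x. foldl (\<lambda>a e. F a e x) (i x) (to_list (f x)))"
proof -
  note m = polytime_measure[OF f] and ge1 = polytime_ge1[OF f]
  let ?st = "\<lambda>x. Node (f x) (Node (i x) x)" and ?N = "\<lambda>x. length (to_list (f x))"
  have st: "?st x = Node (from_list (to_list (f x))) (Node (i x) x)" for x by simp
  have "polytime data_size (\<lambda>s. F (hd_data (tl_data s)) (hd_data (hd_data s)) (tl_data (tl_data s)))"
    using polytime_comp[OF F, of data_size
        "\<lambda>s. Node (hd_data (tl_data s)) (Node (hd_data (hd_data s)) (tl_data (tl_data s)))"]
    by (simp add: polytime_Node polytime_hd polytime_tl polytime_id_size)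
  then have step: "polytime data_size (fold_step F)"
    unfolding fold_step_def by (intro polytime_Node polytime_hd polytime_tl polytime_id_size)
  have "polytime m (\<lambda>x. (fold_step F ^^ ?N x) (?st x))"
  proof (rule polytime_loop[OF step m])
    show "polytime m ?st" by (intro polytime_Node f i polytime_id m)
    show "poly_bounded m ?N"
      by (rule poly_bounded_mono[OF polytime_size[OF f] length_to_list_le])
    show "poly_bounded m (\<lambda>x. 2 + (data_size (f x) + (B x + m x)))"
      by (intro poly_bounded_add poly_bounded_const ge1 polytime_size f B(1) poly_bounded_measure)
    show "data_size ((fold_step F ^^ j) (?st x)) \<le> 2 + (data_size (f x) + (B x + m x))"
      if "j \<le> ?N x" for x j
      unfolding st funpow_fold_step[OF that]
      using data_size_drop[of j "to_list (f x)"] B(2)[of x j] m[of x] by simp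
    show "hd_data ((fold_step F ^^ j) (?st x)) \<noteq> Leaf" if "j < ?N x" for x j
      unfolding st funpow_fold_step[OF less_imp_le[OF that]] using that by simp
    show "hd_data ((fold_step F ^^ ?N x) (?st x)) = Leaf" for x
      unfolding st funpow_fold_step[OF order_refl] by simp
  qed
  then have "polytime m (\<lambda>x. hd_data (tl_data ((fold_step F ^^ ?N x) (?st x))))"
    by (intro polytime_hd polytime_tl)
  then show ?thesis unfolding st funpow_fold_step[OF order_refl] by simp
qed

lemma foldl_Node: "foldl (\<lambda>a e. Node e a) t xs = from_list (rev xs @ to_list t)"
  by (induction xs arbitrary: t) auto

lemma data_size_rev: "data_size (from_list (rev xs)) = data_size (from_list xs)"
  unfolding data_size_from_list by (simp add: rev_map[symmetric] sum_list_rev)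

text \<open>A fold can push elements only at the front, hence it reverses; appending is obtained by
  reversing twice.\<close>

lemma polytime_rev_append:
  assumes f: "polytime m f" and g: "polytime m g"
  shows "polytime m (\<lambda>x. from_list (rev (to_list (f x)) @ to_list (g x)))"
proof -
  note ge1 = polytime_ge1[OF f]
  have "polytime m (\<lambda>x. foldl (\<lambda>a e. Node e a) (g x) (to_list (f x)))"
  proof (rule polytime_foldl[where F = "\<lambda>a e x. Node e a", OF _ g f])
    show "polytime data_size (\<lambda>z. Node (hd_data (tl_data z)) (hd_data z))"
      by (intro polytime_Node polytime_hd polytime_tl polytime_id_size)
    show "poly_bounded m (\<lambda>x. data_size (f x) + data_size (g x))"
      by (intro poly_bounded_add ge1 polytime_size f g)
    fix x j
    have "data_size (from_list (rev (take j (to_list (f x))) @ to_list (g x))) + 1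
        = data_size (from_list (take j (to_list (f x)))) + data_size (g x)"
      unfolding data_size_from_list_append data_size_rev by simp
    then show "data_size (foldl (\<lambda>a e. Node e a) (g x) (take j (to_list (f x))))
        \<le> data_size (f x) + data_size (g x)"
      unfolding foldl_Node using data_size_take[of j "to_list (f x)"] by simp
  qed
  then show ?thesis unfolding foldl_Node .
qed

lemma polytime_rev:
  assumes "polytime m f" shows "polytime m (\<lambda>x. from_list (rev (to_list (f x))))"
  using polytime_rev_append[OF assms polytime_Leaf[OF polytime_measure[OF assms]]] by simp

definition append_data :: "tree_data \<Rightarrow> tree_data \<Rightarrow> tree_data" where
  "append_data s t = from_list (to_list s @ to_list t)"

lemma to_list_append [simp]: "to_list (append_data s t) = to_list s @ to_list t"
  unfolding append_data_def by simp

lemma polytime_append: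
  assumes "polytime m f" "polytime m g" shows "polytime m (\<lambda>x. append_data (f x) (g x))"
  using polytime_rev_append[OF polytime_rev[OF assms(1)] assms(2)]
  unfolding append_data_def by simp

section \<open>Maps, filters and bounded quantifiers\<close>

definition concat_map_data :: "(tree_data \<Rightarrow> tree_data) \<Rightarrow> tree_data \<Rightarrow> tree_data" where
  "concat_map_data F t = from_list (concat (map (\<lambda>e. to_list (F e)) (to_list t)))"

lemma to_list_concat_map [simp]:
  "to_list (concat_map_data F t) = concat (map (\<lambda>e. to_list (F e)) (to_list t))"
  unfolding concat_map_data_def by simp

lemma foldl_append_data:
  "foldl (\<lambda>a e. append_data a (F e)) t xs = from_list (to_list t @ concat (map (\<lambda>e. to_list (F e)) xs))"
  by (induction xs arbitrary: t) auto

text \<open>Unlike in a general fold, each piece is computed from a list element and the fixed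
  input, never from the accumulator. The pieces are therefore uniformly bounded, and the total size
  is linear in their number.\<close>

lemma polytime_concat_map:
  assumes F: "polytime data_size (\<lambda>z. F (hd_data z) (tl_data z))" and f: "polytime m f"
  shows "polytime m (\<lambda>x. concat_map_data (\<lambda>e. F e x) (f x))"
proof -
  note m = polytime_measure[OF f] and ge1 = polytime_ge1[OF f]
  obtain k where "\<And>z. data_size (F (hd_data z) (tl_data z)) \<le> k * data_size z ^ k"
    using polytime_size[OF F] unfolding poly_bounded_def by blast
  from this[of "Node e x" for e x]
  have k: "data_size (F e x) \<le> k * (1 + data_size e + data_size x) ^ k" for e x by simp
  let ?b = "\<lambda>x. k * (1 + data_size (f x) + m x) ^ k"
  let ?B = "\<lambda>x. 1 + data_size (f x) * ?b x"
  have "polytime data_size (\<lambda>z. F (hd_data (tl_data z)) (tl_data (tl_data z)))"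
    using polytime_comp[OF F, of data_size tl_data] by (simp add: polytime_tl polytime_id_size)
  then have step: "polytime data_size
      (\<lambda>z. append_data (hd_data z) (F (hd_data (tl_data z)) (tl_data (tl_data z))))"
    by (intro polytime_append polytime_hd polytime_id_size)
  have "polytime m (\<lambda>x. foldl (\<lambda>a e. append_data a (F e x)) Leaf (to_list (f x)))"
  proof (rule polytime_foldl[where F = "\<lambda>a e x. append_data a (F e x)", OF step polytime_Leaf[OF m] f])
    show "poly_bounded m ?B"
      by (intro poly_bounded_add poly_bounded_mult poly_bounded_power poly_bounded_const ge1
          polytime_size f poly_bounded_measure)
    fix x j
    have bound: "data_size (from_list (concat (map (\<lambda>e. to_list (F e x)) xs))) \<le> 1 + length xs * ?b x"
      if "set xs \<subseteq> set (to_list (f x))" for xs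
      using that
    proof (induction xs)
      case (Cons e xs)
      have "k * (1 + data_size e + data_size x) ^ k \<le> ?b x"
        using data_size_mem[of e "f x"] Cons.prems m[of x] by (intro mult_left_mono power_mono) auto
      then have "data_size (F e x) \<le> ?b x" using k[of e x] by linarith
      moreover have "data_size (from_list (concat (map (\<lambda>e. to_list (F e x)) (e # xs)))) + 1
        = data_size (F e x) + data_size (from_list (concat (map (\<lambda>e. to_list (F e x)) xs)))"
        using data_size_from_list_append[of "to_list (F e x)"] by simp
      moreover have "data_size (from_list (concat (map (\<lambda>e. to_list (F e x)) xs))) \<le> 1 + length xs * ?b x"
        using Cons by simp
      ultimately show ?case by simp
    qed simp
    have "length (take j (to_list (f x))) \<le> data_size (f x)"
      using length_to_list_le[of "f x"] by simp
    then have "length (take j (to_list (f x))) * ?b x \<le> data_size (f x) * ?b x"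
      by (rule mult_right_mono) simp
    then have "data_size (from_list (concat (map (\<lambda>e. to_list (F e x)) (take j (to_list (f x)))))) \<le> ?B x"
      using le_trans[OF bound[OF set_take_subset]] by simp
    then show "data_size (foldl (\<lambda>a e. append_data a (F e x)) Leaf (take j (to_list (f x)))) \<le> ?B x"
      unfolding foldl_append_data by simp
  qed
  then show ?thesis unfolding foldl_append_data concat_map_data_def by simp
qed

definition map_data :: "(tree_data \<Rightarrow> tree_data) \<Rightarrow> tree_data \<Rightarrow> tree_data" where
  "map_data F t = from_list (map F (to_list t))"

lemma to_list_map [simp]: "to_list (map_data F t) = map F (to_list t)"
  unfolding map_data_def by simp

lemma polytime_map:
  assumes F: "polytime data_size (\<lambda>z. F (hd_data z) (tl_data z))" and f: "polytime m f"
  shows "polytime m (\<lambda>x. map_data (\<lambda>e. F e x) (f x))"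
proof -
  have "polytime data_size (\<lambda>z. Node (F (hd_data z) (tl_data z)) Leaf)"
    by (intro polytime_Node F polytime_Leaf order_refl)
  from polytime_concat_map[where F = "\<lambda>e x. Node (F e x) Leaf", OF this f]
  have "polytime m (\<lambda>x. concat_map_data (\<lambda>e. Node (F e x) Leaf) (f x))" .
  moreover have "concat (map (\<lambda>e. [g e]) xs) = map g xs" for g :: "tree_data \<Rightarrow> tree_data" and xs
    by (induction xs) auto
  ultimately show ?thesis unfolding concat_map_data_def map_data_def by simp
qed

definition filter_data :: "(tree_data \<Rightarrow> bool) \<Rightarrow> tree_data \<Rightarrow> tree_data" where
  "filter_data P t = from_list (filter P (to_list t))"

lemma to_list_filter [simp]: "to_list (filter_data P t) = filter P (to_list t)"
  unfolding filter_data_def by simp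

lemma data_size_filter_data: "data_size (filter_data P t) \<le> data_size t"
  unfolding filter_data_def using data_size_filter[of P "to_list t"] by simp

lemma polytime_filter:
  assumes P: "polytime data_size (\<lambda>z. bool_data (P (hd_data z) (tl_data z)))" and f: "polytime m f"
  shows "polytime m (\<lambda>x. filter_data (\<lambda>e. P e x) (f x))"
proof -
  have "polytime data_size (\<lambda>z. if P (hd_data z) (tl_data z) then Node (hd_data z) Leaf else Leaf)"
    by (intro polytime_if P polytime_Node polytime_hd polytime_id_size polytime_Leaf order_refl)
  from polytime_concat_map[where F = "\<lambda>e x. if P e x then Node e Leaf else Leaf", OF this f]
  have "polytime m (\<lambda>x. concat_map_data (\<lambda>e. if P e x then Node e Leaf else Leaf) (f x))" .
  moreover have "concat (map (\<lambda>e. to_list (if Q e then Node e Leaf else Leaf)) xs) = filter Q xs"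
    for Q and xs :: "tree_data list"
    by (induction xs) auto
  ultimately show ?thesis unfolding concat_map_data_def filter_data_def by simp
qed

lemma data_size_bool_data: "data_size (bool_data P) \<le> 3"
  unfolding bool_data_def by simp

lemma polytime_ex:
  assumes P: "polytime data_size (\<lambda>z. bool_data (P (hd_data z) (tl_data z)))" and f: "polytime m f"
  shows "polytime m (\<lambda>x. bool_data (\<exists>e\<in>set (to_list (f x)). P e x))"
proof -
  have "filter_data (\<lambda>e. P e x) (f x) \<noteq> Leaf \<longleftrightarrow> (\<exists>e\<in>set (to_list (f x)). P e x)" for x
    unfolding filter_data_def by (auto simp: filter_empty_conv)
  then show ?thesis
    using polytime_not[OF polytime_is_Leaf[OF polytime_filter[OF P f]]] by simp
qed

lemma polytime_all:
  assumes P: "polytime data_size (\<lambda>z. bool_data (P (hd_data z) (tl_data z)))" and f: "polytime m f"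
  shows "polytime m (\<lambda>x. bool_data (\<forall>e\<in>set (to_list (f x)). P e x))"
  using polytime_not[OF polytime_ex[where P = "\<lambda>e x. \<not> P e x", OF polytime_not[OF P] f]] by simp

section \<open>Equality and membership of trees\<close>

text \<open>Equality of trees is decided with a stack of pairs of subtrees that remain to be compared.\<close>

definition eq_step :: "tree_data \<Rightarrow> tree_data" where
  "eq_step s =
    (if hd_data (hd_data (hd_data s)) = Leaf \<and> tl_data (hd_data (hd_data s)) = Leaf
     then Node (tl_data (hd_data s)) (tl_data s)
     else if hd_data (hd_data (hd_data s)) = Leaf \<or> tl_data (hd_data (hd_data s)) = Leaf
     then Node Leaf Leaf
     else Node
       (Node (Node (hd_data (hd_data (hd_data (hd_data s)))) (hd_data (tl_data (hd_data (hd_data s)))))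
         (Node (Node (tl_data (hd_data (hd_data (hd_data s)))) (tl_data (tl_data (hd_data (hd_data s)))))
           (tl_data (hd_data s))))
       (tl_data s))"

definition eq_state :: "(tree_data \<times> tree_data) list \<Rightarrow> bool \<Rightarrow> tree_data" where
  "eq_state ps b = Node (from_list (map (\<lambda>(s, t). Node s t) ps)) (bool_data b)"

lemma eq_step_state:
  "eq_step (eq_state ((Leaf, Leaf) # ps) b) = eq_state ps b"
  "eq_step (eq_state ((Leaf, Node s t) # ps) b) = eq_state [] False"
  "eq_step (eq_state ((Node s t, Leaf) # ps) b) = eq_state [] False"
  "eq_step (eq_state ((Node s t, Node u v) # ps) b) = eq_state ((s, u) # (t, v) # ps) b"
  unfolding eq_step_def eq_state_def by (simp_all add: bool_data_def)

text \<open>Every step shrinks the total size of the left components on the stack, which bounds the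
  number of steps. Replacing a pair by the pairs of its subtrees keeps the size of the state, and a
  mismatch empties the stack, so that the loop stops at once.\<close>

lemma eq_loop:
  "\<exists>n \<le> sum_list (map (data_size \<circ> fst) ps). (\<forall>j<n. hd_data ((eq_step ^^ j) (eq_state ps b)) \<noteq> Leaf) \<and>
     (eq_step ^^ n) (eq_state ps b) = eq_state [] (b \<and> (\<forall>(s, t)\<in>set ps. s = t)) \<and>
     (\<forall>j\<le>n. data_size ((eq_step ^^ j) (eq_state ps b)) \<le> data_size (eq_state ps b) + 2)"
proof (induction "sum_list (map (data_size \<circ> fst) ps)" arbitrary: ps b rule: less_induct)
  case less
  let ?w = "\<lambda>ps. sum_list (map (data_size \<circ> fst) ps)"
  have step: ?case
    if "ps \<noteq> []" "eq_step (eq_state ps b) = eq_state qs c" "?w qs < ?w ps"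
      "data_size (eq_state qs c) \<le> data_size (eq_state ps b)"
      "(c \<and> (\<forall>(s, t)\<in>set qs. s = t)) \<longleftrightarrow> (b \<and> (\<forall>(s, t)\<in>set ps. s = t))" for qs c
  proof -
    from less[OF that(3), of c] obtain n where n: "n \<le> ?w qs"
      "\<forall>j<n. hd_data ((eq_step ^^ j) (eq_state qs c)) \<noteq> Leaf"
      "(eq_step ^^ n) (eq_state qs c) = eq_state [] (c \<and> (\<forall>(s, t)\<in>set qs. s = t))"
      "\<forall>j\<le>n. data_size ((eq_step ^^ j) (eq_state qs c)) \<le> data_size (eq_state qs c) + 2" by blast
    have shift: "(eq_step ^^ Suc j) (eq_state ps b) = (eq_step ^^ j) (eq_state qs c)" for j
      by (metis comp_apply funpow_Suc_right that(2))
    have "hd_data ((eq_step ^^ j) (eq_state ps b)) \<noteq> Leaf" if "j < Suc n" for j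
    proof (cases j)
      case 0
      then show ?thesis using \<open>ps \<noteq> []\<close> by (simp add: eq_state_def)
    next
      case (Suc i)
      then show ?thesis using shift[of i] n(2) that by auto
    qed
    moreover have "data_size ((eq_step ^^ j) (eq_state ps b)) \<le> data_size (eq_state ps b) + 2"
      if "j \<le> Suc n" for j
    proof (cases j)
      case (Suc i)
      then show ?thesis
        using shift[of i] n(4)[rule_format, of i] that \<open>data_size (eq_state qs c) \<le> _\<close> by simp
    qed simp
    ultimately show ?thesis
      using n(1,3) that(3) shift[of n] unfolding that(5)
      by (intro exI[of _ "Suc n"]) auto
  qed
  show ?case
  proof (cases ps)
    case Nil
    then show ?thesis by (auto intro!: exI[of _ 0])
  next
    case (Cons p ps')
    obtain s t where p: "p = (s, t)" by fastforce
    show ?thesis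
    proof (cases s; cases t)
      assume "s = Leaf" "t = Leaf"
      then show ?thesis using Cons p eq_step_state
        by (intro step[of ps' b]) (auto simp: eq_state_def)
    next
      fix u v assume "s = Leaf" "t = Node u v"
      then show ?thesis using Cons p eq_step_state
        by (intro step[of "[]" False]) (auto simp: eq_state_def bool_data_def)
    next
      fix u v assume "s = Node u v" "t = Leaf"
      then show ?thesis using Cons p eq_step_state
        by (intro step[of "[]" False]) (auto simp: eq_state_def bool_data_def)
    next
      fix u v x y assume "s = Node u v" "t = Node x y"
      then show ?thesis using Cons p eq_step_state
        by (intro step[of "(u, x) # (v, y) # ps'" b]) (auto simp: eq_state_def)
    qed
  qed
qed

lemma polytime_eq:
  assumes f: "polytime m f" and g: "polytime m g"
  shows "polytime m (\<lambda>x. bool_data (f x = g x))"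
proof -
  note m = polytime_measure[OF f] and ge1 = polytime_ge1[OF f]
  let ?i = "\<lambda>x. Node (Node (Node (f x) (g x)) Leaf) (Node Leaf Leaf)"
  have i: "?i x = eq_state [(f x, g x)] True" for x
    by (simp add: eq_state_def bool_data_def)
  have step: "polytime data_size eq_step"
    unfolding eq_step_def
    by (intro polytime_if polytime_conj polytime_disj polytime_is_Leaf polytime_Node polytime_hd
        polytime_tl polytime_id_size polytime_Leaf order_refl)
  have "\<exists>n. n \<le> data_size (f x) \<and> (\<forall>j<n. hd_data ((eq_step ^^ j) (?i x)) \<noteq> Leaf) \<and>
      (eq_step ^^ n) (?i x) = eq_state [] (f x = g x) \<and>
      (\<forall>j\<le>n. data_size ((eq_step ^^ j) (?i x)) \<le> data_size (?i x) + 2)" for x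
    using eq_loop[of "[(f x, g x)]" True] unfolding i by auto
  then obtain N where N: "\<And>x. N x \<le> data_size (f x)"
    "\<And>x j. j < N x \<Longrightarrow> hd_data ((eq_step ^^ j) (?i x)) \<noteq> Leaf"
    "\<And>x. (eq_step ^^ N x) (?i x) = eq_state [] (f x = g x)"
    "\<And>x j. j \<le> N x \<Longrightarrow> data_size ((eq_step ^^ j) (?i x)) \<le> data_size (?i x) + 2"
    by metis
  have pi: "polytime m ?i" by (intro polytime_Node f g polytime_Leaf m)
  have "polytime m (\<lambda>x. (eq_step ^^ N x) (?i x))"
  proof (rule polytime_loop[OF step m pi])
    show "poly_bounded m N" by (rule poly_bounded_mono[OF polytime_size[OF f] N(1)])
    show "poly_bounded m (\<lambda>x. data_size (?i x) + 2)"
      by (intro poly_bounded_add poly_bounded_const ge1 polytime_size pi)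
    show "hd_data ((eq_step ^^ N x) (?i x)) = Leaf" for x
      unfolding N(3) by (simp add: eq_state_def)
  qed (use N in blast)+
  from polytime_tl[OF this] show ?thesis unfolding N(3) by (simp add: eq_state_def)
qed

lemma polytime_member:
  assumes "polytime m f" "polytime m g"
  shows "polytime m (\<lambda>x. bool_data (f x \<in> set (to_list (g x))))"
proof -
  have "polytime data_size (\<lambda>z. bool_data (\<exists>e\<in>set (to_list (tl_data z)). hd_data z = e))"
    by (rule polytime_ex[where P = "\<lambda>e z. hd_data z = e"])
      (intro polytime_eq polytime_hd polytime_tl polytime_id_size)+
  from polytime_comp[OF this polytime_Node[OF assms]] show ?thesis by (simp add: eq_commute)
qed

section \<open>Least fixed points over finite universes\<close>

text \<open>The least fixed point of a monotone operator on the subsets of a list is reached after as many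
  iterations as the list has elements, so that inductive definitions over a polynomial universe are
  polynomial.\<close>

definition iterate_filter :: "(tree_data \<Rightarrow> tree_data \<Rightarrow> bool) \<Rightarrow> tree_data \<Rightarrow> tree_data" where
  "iterate_filter P u = foldl (\<lambda>r _. filter_data (P r) u) Leaf (to_list u)"

lemma polytime_iterate_filter:
  assumes P: "polytime data_size
      (\<lambda>z. bool_data (P (hd_data (tl_data z)) (hd_data z) (tl_data (tl_data z))))"
    and u: "polytime m u"
  shows "polytime m (\<lambda>x. iterate_filter (\<lambda>r e. P r e x) (u x))"
proof -
  note m = polytime_measure[OF u] and ge1 = polytime_ge1[OF u]
  have "polytime data_size (\<lambda>z. bool_data
      (P (hd_data (tl_data z)) (hd_data z) (tl_data (tl_data (tl_data (tl_data z))))))"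
    using polytime_comp[OF P, of data_size "\<lambda>z. Node (hd_data z) (Node (hd_data (tl_data z))
      (tl_data (tl_data (tl_data (tl_data z)))))"]
    by (simp add: polytime_Node polytime_hd polytime_tl polytime_id_size)
  then have step: "polytime data_size (\<lambda>z. filter_data
      (\<lambda>e. P (hd_data z) e (tl_data (tl_data (tl_data z)))) (hd_data (tl_data (tl_data z))))"
    by (intro polytime_filter[where P = "\<lambda>e z. P (hd_data z) e (tl_data (tl_data (tl_data z)))"]
        polytime_hd polytime_tl polytime_id_size)
  \<comment> \<open>The universe is polynomial only in \<open>m\<close>, whereas the step of a fold
    must be polynomial in the size of its own input. It is therefore computed once and handed over
    in front of the input.\<close>
  have px: "polytime m (\<lambda>x. Node (u x) x)" by (intro polytime_Node u polytime_id m)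
  let ?it = "\<lambda>x xs. foldl (\<lambda>r e. filter_data (\<lambda>e. P r e (tl_data x)) (hd_data x)) Leaf xs"
  have "polytime data_size (\<lambda>x. ?it x (to_list (hd_data x)))"
  proof (rule polytime_foldl[where F = "\<lambda>r e x. filter_data (\<lambda>e. P r e (tl_data x)) (hd_data x)"
        and i = "\<lambda>x. Leaf" and f = hd_data and B = data_size, OF step])
    fix x j
    have "data_size (?it x xs) \<le> data_size (hd_data x)" for xs
      by (cases xs rule: rev_cases) (auto simp: data_size_filter_data Suc_le_eq)
    then show "data_size (?it x (take j (to_list (hd_data x)))) \<le> data_size x"
      using data_size_hd_le le_trans by blast
  qed (intro polytime_Leaf polytime_hd polytime_id_size poly_bounded_measure order_refl)+
  from polytime_comp[OF this px] show ?thesis unfolding iterate_filter_def by simp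
qed

text \<open>Every iterate is filtered by its predecessor and the first one is empty, so that rule
  induction is sound even for an operator that is not monotone.\<close>

lemma iterate_filter_induct:
  assumes "e \<in> set (to_list (iterate_filter P u))"
    and "\<And>r e. (\<And>e'. e' \<in> set (to_list r) \<Longrightarrow> Q e') \<Longrightarrow> e \<in> set (to_list u) \<Longrightarrow> P r e \<Longrightarrow> Q e"
  shows "Q e"
proof -
  have "\<forall>e \<in> set (to_list (foldl (\<lambda>r _. filter_data (P r) u) Leaf xs)). Q e" for xs :: "tree_data list"
    by (induction xs rule: rev_induct) (auto intro: assms(2))
  then show ?thesis using assms(1) unfolding iterate_filter_def by blast
qed

lemma iterate_filter_fixed:
  assumes mono: "\<And>r s e. set (to_list r) \<subseteq> set (to_list s) \<Longrightarrow> P r e \<Longrightarrow> P s e"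
    and "e \<in> set (to_list u)" "P (iterate_filter P u) e"
  shows "e \<in> set (to_list (iterate_filter P u))"
proof -
  define R where "R n = ((\<lambda>r. filter_data (P r) u) ^^ n) Leaf" for n
  let ?S = "\<lambda>n. set (to_list (R n))"
  have foldl_R: "foldl (\<lambda>r _. filter_data (P r) u) Leaf xs = R (length xs)" for xs :: "tree_data list"
    unfolding R_def by (induction xs rule: rev_induct) auto
  have RSuc: "R (Suc n) = filter_data (P (R n)) u" for n unfolding R_def by simp
  have inc: "?S n \<subseteq> ?S (Suc n)" for n
  proof (induction n)
    case (Suc n)
    then show ?case unfolding RSuc[of "Suc n"] by (subst RSuc) (auto intro: mono)
  qed (simp add: R_def)
  have sub: "?S n \<subseteq> set (to_list u)" for n by (cases n) (auto simp: RSuc, simp add: R_def)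
  \<comment> \<open>Until the chain of iterates becomes stationary, each iteration adds at least one
    element. A chain still growing after \<open>length (to_list u)\<close> iterations would outgrow
    the universe.\<close>
  have stable: "?S n = ?S (Suc n) \<or> n \<le> card (?S n)" for n
  proof (induction n)
    case (Suc n)
    show ?case
    proof (cases "?S n = ?S (Suc n)")
      case True
      then have "P (R n) e \<longleftrightarrow> P (R (Suc n)) e" for e using mono by blast
      then show ?thesis unfolding RSuc by simp
    next
      case False
      then have "n \<le> card (?S n)" "?S n \<subset> ?S (Suc n)" using Suc inc by auto
      then show ?thesis using psubset_card_mono[of "?S (Suc n)" "?S n"] by simp
    qed
  qed simp
  let ?n = "length (to_list u)"
  have "?S ?n = ?S (Suc ?n)"
  proof (rule ccontr)
    assume ne: "?S ?n \<noteq> ?S (Suc ?n)"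
    then have "?n \<le> card (?S ?n)" "?S ?n \<subset> ?S (Suc ?n)" using stable[of ?n] inc[of ?n] by auto
    then have "?n < card (?S (Suc ?n))" using psubset_card_mono[of "?S (Suc ?n)" "?S ?n"] by simp
    moreover have "card (?S (Suc ?n)) \<le> ?n"
      using card_mono[OF _ sub[of "Suc ?n"]] card_length[of "to_list u"] by simp
    ultimately show False by simp
  qed
  moreover have "iterate_filter P u = R ?n" unfolding iterate_filter_def foldl_R ..
  ultimately show ?thesis using assms(2,3) RSuc[of ?n] by simp
qed

section \<open>Flows and transforming sequences\<close>

text \<open>The values lie in an arbitrary group because sequences of moves give integral flows,
  while cancelling circulations involves quotients and takes place over the reals.\<close>

definition net :: "'a set \<Rightarrow> ('a \<times> 'a \<Rightarrow> 'b::ab_group_add) \<Rightarrow> 'a \<Rightarrow> 'b" where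
  "net V f x = (\<Sum>u\<in>V. f (x, u)) - (\<Sum>u\<in>V. f (u, x))"

lemma net_add: "net V (\<lambda>e. f e + g e) x = net V f x + net V g x"
  unfolding net_def by (simp add: sum.distrib algebra_simps)

lemma net_diff: "net V (\<lambda>e. f e - g e) x = net V f x - net V g x"
  unfolding net_def by (simp add: sum_subtractf algebra_simps)

lemma net_zero [simp]: "net V (\<lambda>e. 0) x = 0"
  unfolding net_def by simp

lemma net_scale:
  fixes c :: "'b::comm_ring_1"
  shows "net V (\<lambda>e. c * f e) x = c * net V f x"
  unfolding net_def by (simp add: sum_distrib_left algebra_simps)

lemma net_of_int: "net V (\<lambda>e. of_int (f e)) x = of_int (net V f x)"
  unfolding net_def by simp

lemma net_arc:
  assumes "finite V" "a \<in> V" "b \<in> V"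
  shows "net V (\<lambda>e. if e = (a, b) then c else 0) x =
    (if x = a then c else 0) - (if x = b then c else 0)"
proof -
  have "(\<Sum>u\<in>V. if (x, u) = (a, b) then c else 0) = (if x = a then c else 0)"
    using assms by (cases "x = a") (simp_all add: sum.delta)
  moreover have "(\<Sum>u\<in>V. if (u, x) = (a, b) then c else 0) = (if x = b then c else 0)"
    using assms by (cases "x = b") (simp_all add: sum.delta)
  ultimately show ?thesis unfolding net_def by simp
qed

lemma count_list_distinct: "distinct xs \<Longrightarrow> count_list xs x = of_bool (x \<in> set xs)"
  by (induction xs) auto

text \<open>The contributions of consecutive arcs telescope. Arcs are counted with multiplicity, as
  a walk may repeat them.\<close>

lemma net_walk:
  assumes "finite V" "set p \<subseteq> V \<times> V" "pcas s p t"
  shows "net V (\<lambda>e. int (count_list p e)) x = of_bool (x = s) - of_bool (x = t)"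
  using assms(2,3)
proof (induction p arbitrary: s)
  case (Cons e p)
  obtain a b where e: "e = (a, b)" by fastforce
  have "(\<lambda>e'. int (count_list (e # p) e')) =
      (\<lambda>e'. (if e' = (a, b) then 1 else 0) + int (count_list p e'))"
    using e by auto
  then have "net V (\<lambda>e'. int (count_list (e # p) e')) x =
      net V (\<lambda>e'. if e' = (a, b) then 1 else 0) x + net V (\<lambda>e'. int (count_list p e')) x"
    by (simp add: net_add)
  moreover have "net V (\<lambda>e'. if e' = (a, b) then (1::int) else 0) x =
      (if x = a then 1 else 0) - (if x = b then 1 else 0)"
    using Cons.prems e by (intro net_arc assms(1)) auto
  ultimately show ?case using Cons.IH[of b] Cons.prems e by auto
qed simp

definition is_flow ::
  "'a set \<Rightarrow> ('a \<times> 'a) set \<Rightarrow> 'a set \<Rightarrow> ('a \<times> 'a \<Rightarrow> 'b::linordered_idom) \<Rightarrow> ('a \<Rightarrow> 'b) \<Rightarrow> bool" where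
  "is_flow V E W f d \<longleftrightarrow> (\<forall>e. 0 \<le> f e) \<and> (\<forall>e. f e \<noteq> 0 \<longrightarrow> e \<in> E \<inter> W \<times> W) \<and> (\<forall>x. net V f x = d x)"

lemma is_flowD:
  assumes "is_flow V E W f d"
  shows "0 \<le> f e" "f e \<noteq> 0 \<Longrightarrow> e \<in> E \<and> fst e \<in> W \<and> snd e \<in> W" "net V f x = d x"
  using assms unfolding is_flow_def by (simp_all del: split_paired_All add: mem_Times_iff)

section \<open>Sequences of moves versus flows\<close>

lemma transforming_flow:
  assumes D: "pair_fin_digraph D" and tr: "transforming D S ms T"
  shows "\<exists>W f. W \<subseteq> pverts D \<union> S \<and> finite W \<and>
    is_flow (pverts D) (parcs D) W f (\<lambda>x. of_bool (x \<in> S) - of_bool (x \<in> T) :: int) \<and>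
    card (W \<inter> S) \<le> length ms"
  using tr
proof (induction ms arbitrary: S)
  case Nil
  then show ?case
    by (intro exI[of _ "{}"] exI[of _ "\<lambda>_. 0"]) (auto simp: is_flow_def)
next
  case (Cons m ms)
  interpret pair_fin_digraph D by (rule D)
  obtain s t where m: "m = (s, t)" by fastforce
  define S' where "S' = insert t (S - {s})"
  from Cons.prems have v: "s \<in> S" "t \<notin> S" and "\<exists>p. free_path D S s p t"
    and tr': "transforming D S' ms T" by (auto simp: m S'_def)
  then obtain p where p: "apath s p t" "set (inner_verts p) \<inter> S = {}"
    unfolding free_path_def by auto
  from Cons.IH[OF tr'] obtain W f where W: "W \<subseteq> pverts D \<union> S'" "finite W"
    "is_flow (pverts D) (parcs D) W f (\<lambda>x. of_bool (x \<in> S') - of_bool (x \<in> T) :: int)"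
    "card (W \<inter> S') \<le> length ms" by blast
  let ?W = "W \<union> set (pawalk_verts s p)"
  let ?f = "\<lambda>e. f e + int (count_list p e)"
  have aw: "awalk s p t" using p(1) by (simp add: apath_def)
  have pv: "set (pawalk_verts s p) \<subseteq> pverts D" and pa: "set p \<subseteq> parcs D" and cas: "pcas s p t"
    using awalkE[OF aw] by blast+
  have t: "t \<in> pverts D" using awalk_last_in_verts[OF aw] .
  have pa_in: "a \<in> set (pawalk_verts s p) \<and> b \<in> set (pawalk_verts s p)" if "(a, b) \<in> set p" for a b
    using awalk_verts_arc1[OF that] awalk_verts_arc2[OF aw that] by simp
  have "set p \<subseteq> pverts D \<times> pverts D" using pa by (auto dest: wellformed')
  then have nw: "net (pverts D) (\<lambda>e. int (count_list p e)) x = of_bool (x = s) - of_bool (x = t)" for x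
    by (rule net_walk[OF pair_finite_verts _ cas])
  have "is_flow (pverts D) (parcs D) ?W ?f (\<lambda>x. of_bool (x \<in> S) - of_bool (x \<in> T))"
    unfolding is_flow_def
  proof (intro conjI allI impI)
    fix e show "0 \<le> ?f e" using is_flowD(1)[OF W(3), of e] by simp
    assume "?f e \<noteq> 0"
    then have "f e \<noteq> 0 \<or> e \<in> set p" by (auto simp: count_list_0_iff)
    then show "e \<in> parcs D \<inter> ?W \<times> ?W"
      using is_flowD(2)[OF W(3), of e] pa pa_in by (cases e) auto
  next
    fix x show "net (pverts D) ?f x = of_bool (x \<in> S) - of_bool (x \<in> T)"
      using v unfolding net_add nw is_flowD(3)[OF W(3)] S'_def by auto
  qed
  moreover have "card (?W \<inter> S) \<le> length (m # ms)"
  proof -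
    \<comment> \<open>The path of the first move meets tokens only in its start, and all tokens of
      \<open>S\<close> except \<open>s\<close> are still present in \<open>S'\<close>. Hence
      prepending the move adds at most the token on \<open>s\<close> to the cost.\<close>
    have "set (pawalk_verts s p) \<inter> S \<subseteq> {s}"
      using set_inner_verts[OF p(1)] p(2) v by auto
    then have "?W \<inter> S \<subseteq> insert s (W \<inter> S')" unfolding S'_def by auto
    then have "card (?W \<inter> S) \<le> card (insert s (W \<inter> S'))"
      using W(2) by (intro card_mono) auto
    also have "\<dots> \<le> Suc (card (W \<inter> S'))" by (simp add: W(2) card_insert_if)
    finally show ?thesis using W(4) by simp
  qed
  moreover have "?W \<subseteq> pverts D \<union> S" "finite ?W" using W(1,2) pv t by (auto simp: S'_def)
  ultimately show ?case by (intro exI[of _ ?W] exI[of _ ?f] conjI)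
qed

text \<open>In an acyclic flow, a target without outgoing flow is filled from the nearest token upstream.
  The flow then avoids this target, so that no token moves twice.\<close>

lemma flow_transforming:
  assumes D: "pair_fin_digraph D"
    and flow: "is_flow (pverts D) (parcs D) W f (\<lambda>x. of_bool (x \<in> S) - of_bool (x \<in> T) :: int)"
    and W: "W \<subseteq> pverts D" and ST: "S \<subseteq> pverts D" "T \<subseteq> pverts D"
  shows "\<exists>ms. transforming D S ms T \<and> length ms \<le> card (W \<inter> S)"
  using flow W ST(1)
proof (induction "nat (\<Sum>e\<in>parcs D. f e)" arbitrary: S W f rule: less_induct)
  case less
  interpret pair_fin_digraph D by (rule D)
  let ?V = "pverts D" and ?E = "parcs D"
  define R where "R = {e. f e \<noteq> 0}"
  have f0: "0 \<le> f e" and fR: "e \<in> R \<Longrightarrow> e \<in> ?E \<and> fst e \<in> W \<and> snd e \<in> W"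
    and net: "net ?V f x = of_bool (x \<in> S) - of_bool (x \<in> T)" for e x
    using is_flowD[OF less.prems(1)] unfolding R_def by blast+
  define H where "H = \<lparr>pverts = ?V, parcs = R\<rparr>"
  have H [simp]: "pverts H = ?V" "parcs H = R" unfolding H_def by simp_all
  interpret H: pair_wf_digraph H
    by standard (use fR in \<open>auto simp: arc_fst_in_verts arc_snd_in_verts\<close>)
  have finR: "finite R" using fR by (meson finite_subset pair_finite_arcs subsetI)
  have smaller: "nat (\<Sum>e\<in>?E. f e - int (count_list p e)) < nat (\<Sum>e\<in>?E. f e)"
    and nonneg: "0 \<le> f e - int (count_list p e)"
    if "p \<noteq> []" "distinct p" "set p \<subseteq> R" for p e
  proof -
    \<comment> \<open>Integrality is essential here: a nonzero value is at least 1, and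
      \<open>p\<close> uses each arc at most once.\<close>
    have c: "int (count_list p e) \<le> f e" for e
    proof (cases "e \<in> set p")
      case True
      then have "f e \<noteq> 0" using that(3) unfolding R_def by auto
      then show ?thesis using f0[of e] True that(2) by (simp add: count_list_distinct)
    next
      case False then show ?thesis using f0[of e] by (simp add: count_list_0_iff)
    qed
    then show "0 \<le> f e - int (count_list p e)" by simp
    have e0: "hd p \<in> set p" using that(1) by simp
    have "(\<Sum>e\<in>?E. f e - int (count_list p e)) < (\<Sum>e\<in>?E. f e)"
    proof (rule sum_strict_mono_ex1)
      show "\<exists>e\<in>?E. f e - int (count_list p e) < f e"
        using e0 that(2,3) fR[of "hd p"] by (intro bexI[of _ "hd p"]) (auto simp: count_list_distinct)
    qed (simp_all add: pair_finite_arcs)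
    moreover have "0 \<le> (\<Sum>e\<in>?E. f e - int (count_list p e))"
      using c by (intro sum_nonneg) simp
    ultimately show "nat (\<Sum>e\<in>?E. f e - int (count_list p e)) < nat (\<Sum>e\<in>?E. f e)" by simp
  qed
  have net_sub: "net ?V (\<lambda>e. f e - int (count_list p e)) x =
      of_bool (x \<in> S) - of_bool (x \<in> T) - (of_bool (x = u) - of_bool (x = v))"
    if "H.awalk u p v" for u p v x
  proof -
    have "set p \<subseteq> R" "pcas u p v" using that by (auto simp: H.awalk_def)
    moreover from this(1) fR have "set p \<subseteq> ?V \<times> ?V" by (auto dest: wellformed')
    ultimately show ?thesis using net_walk[OF pair_finite_verts, of p u v x] by (simp add: net_diff net)
  qed
  show ?case
  \<comment> \<open>A cycle in the support is cancelled by one unit. This changes neither the net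
    values nor \<open>W\<close>, and it decreases the total flow, on which the induction
    runs.\<close>
  proof (cases "\<exists>p. H.cycle p")
    case True
    then obtain p u where p: "H.awalk u p u" "distinct p" "p \<noteq> []" unfolding H.cycle_conv by blast
    then have pR: "set p \<subseteq> R" by (auto simp: H.awalk_def)
    have "is_flow ?V ?E W (\<lambda>e. f e - int (count_list p e)) (\<lambda>x. of_bool (x \<in> S) - of_bool (x \<in> T))"
      unfolding is_flow_def
    proof (intro conjI allI impI)
      fix e assume "f e - int (count_list p e) \<noteq> 0"
      then have "e \<in> R" using pR by (auto simp: R_def count_list_0_iff)
      then show "e \<in> ?E \<inter> W \<times> W" using fR[of e] by (cases e) auto
    qed (use nonneg[OF p(3,2) pR] net_sub[OF p(1)] in auto)
    from less.hyps[OF smaller[OF p(3,2) pR] this less.prems(2,3)] show ?thesis .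
  next
    case nocyc: False
    show ?thesis
    proof (cases "S = T")
      case True
      then show ?thesis by (intro exI[of _ "[]"]) auto
    next
      case False
      have acyc: "acyclic R"
      proof (rule acyclicI, rule allI, rule notI)
        fix v assume "(v, v) \<in> R\<^sup>+"
        then obtain p where "H.awalk v p v" "p \<noteq> []" using H.reachable1_awalk[of v v] by auto
        then have "H.closed_w p" by (auto simp: H.closed_w_def)
        then show False using H.closed_w_imp_cycle nocyc by blast
      qed
      have apathH: "distinct (pawalk_verts u p)" if "H.awalk u p v" for u p v
        using H.awalk_not_distinct_decomp[OF that] H.closed_w_imp_cycle nocyc
        unfolding H.closed_w_def by (metis)
      have outR: "\<exists>u. (x, u) \<in> R" if "net ?V f x > 0" for x
      proof (rule ccontr)
        assume "\<nexists>u. (x, u) \<in> R"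
        then have "(\<Sum>u\<in>?V. f (x, u)) = 0" unfolding R_def by simp
        moreover have "0 \<le> (\<Sum>u\<in>?V. f (u, x))" by (intro sum_nonneg f0)
        ultimately show False using that unfolding net_def by simp
      qed
      have inR: "\<exists>u. (u, x) \<in> R" if "net ?V f x \<le> 0" "net ?V f x < 0 \<or> (\<exists>u. (x, u) \<in> R)" for x
      proof (rule ccontr)
        assume "\<nexists>u. (u, x) \<in> R"
        then have in0: "(\<Sum>u\<in>?V. f (u, x)) = 0" unfolding R_def by simp
        have out: "0 \<le> (\<Sum>u\<in>?V. f (x, u))" by (intro sum_nonneg f0)
        have "0 < (\<Sum>u\<in>?V. f (x, u))" if "(x, u) \<in> R" for u
        proof (rule sum_pos2[of _ u])
          show "u \<in> ?V" using fR[OF that] by (auto dest: wellformed')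
          show "0 < f (x, u)" using that f0[of "(x, u)"] unfolding R_def by auto
        qed (auto simp: pair_finite_verts f0)
        then show False using that in0 out unfolding net_def by fastforce
      qed
      have "R \<noteq> {}"
      proof -
        from False obtain x where "x \<in> S - T \<or> x \<in> T - S" by blast
        then show ?thesis
        proof
          assume "x \<in> S - T"
          then show ?thesis using outR[of x] net[of x] by auto
        next
          assume "x \<in> T - S"
          then show ?thesis using inR[of x] net[of x] by auto
        qed
      qed
      then obtain a b where ab: "(a, b) \<in> R" by auto
      \<comment> \<open>A minimal element of the range for the converse relation is a vertex that
        flow enters but does not leave. Its net value is negative, hence it is a target without a
        token.\<close>
      have "wf (R\<inverse>)" using finite_acyclic_wf_converse[OF finR acyc] .
      then obtain t where t: "t \<in> Range R" "\<And>u. (t, u) \<in> R \<Longrightarrow> u \<notin> Range R"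
        using ab by (elim wfE_min[of _ b "Range R"]) auto
      then have tout: "(t, u) \<notin> R" for u by blast
      have "net ?V f t < 0"
      proof -
        obtain u where u: "(u, t) \<in> R" using t(1) by blast
        have "(\<Sum>u\<in>?V. f (t, u)) = 0" using tout unfolding R_def by simp
        moreover have "0 < (\<Sum>u\<in>?V. f (u, t))"
        proof (rule sum_pos2[of _ u])
          show "u \<in> ?V" using fR[OF u] by (auto dest: wellformed')
          show "0 < f (u, t)" using u f0[of "(u, t)"] unfolding R_def by auto
        qed (auto simp: pair_finite_verts f0)
        ultimately show ?thesis unfolding net_def by simp
      qed
      then have tST: "t \<notin> S" "t \<in> T" using net[of t] by (auto simp: of_bool_def split: if_splits)
      have wfR: "wf R" using finite_acyclic_wf[OF finR acyc] .
      \<comment> \<open>Trace the flow backwards until the first token is met. A vertex without a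
        token that is \<open>t\<close> or has outgoing flow must also have incoming flow, and
        \<open>wf R\<close> ends the search. The sources of all arcs but the first are the inner
        vertices, so the path found is free.\<close>
      have "\<exists>s\<in>S. \<exists>p. p \<noteq> [] \<and> H.awalk s p v \<and> set (tl (map fst p)) \<inter> S = {}"
        if "v \<notin> S" "v = t \<or> v \<in> Domain R" for v
        using wfR that
      proof (induction v rule: wf_induct_rule)
        case (less v)
        have "net ?V f v \<le> 0" using net[of v] less.prems(1) by (simp add: of_bool_def)
        moreover have "net ?V f v < 0 \<or> (\<exists>u. (v, u) \<in> R)"
          using less.prems(2) \<open>net ?V f t < 0\<close> by blast
        ultimately obtain u where u: "(u, v) \<in> R" using inR by blast
        then have uv: "u \<in> ?V" "v \<in> ?V" using fR[OF u] by (auto dest: wellformed')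
        have step: "H.awalk u [(u, v)] v" using u uv by (auto simp: H.awalk_def)
        show ?case
        proof (cases "u \<in> S")
          case True
          then show ?thesis using step by (intro bexI[of _ u] exI[of _ "[(u, v)]"]) auto
        next
          case False
          with less.IH[OF u False] u obtain s p where sp: "s \<in> S" "p \<noteq> []" "H.awalk s p u"
            "set (tl (map fst p)) \<inter> S = {}" by blast
          have "H.awalk s (p @ [(u, v)]) v" using sp(3) step by (rule H.awalk_appendI)
          then show ?thesis using sp False
            by (intro bexI[of _ s] exI[of _ "p @ [(u, v)]"]) auto
        qed
      qed
      from this[OF tST(1)] obtain s p where s: "s \<in> S" "p \<noteq> []" "H.awalk s p t"
        and pS: "set (tl (map fst p)) \<inter> S = {}" by blast
      have pR: "set p \<subseteq> R" using s(3) by (auto simp: H.awalk_def)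
      have "awalk s p t" using s(3) fR by (auto simp: H.awalk_def awalk_def)
      then have "free_path D S s p t"
        unfolding free_path_def using apathH[OF s(3)] pS
        by (simp add: apath_def inner_verts_with_proj_def)
      then have valid: "valid_move D S (s, t)" using s(1) tST by auto
      have dp: "distinct p" using H.distinct_verts_imp_distinct[OF s(3)] apathH[OF s(3)] by simp
      define S' where "S' = execute_move S (s, t)"
      have S': "S' = insert t (S - {s})" unfolding S'_def by simp
      have snet: "net ?V (\<lambda>e. f e - int (count_list p e)) x = of_bool (x \<in> S') - of_bool (x \<in> T)" for x
        unfolding net_sub[OF s(3)] S' using s(1) tST by auto
      have sum0: "(\<Sum>u\<in>?V. f (u, t) - int (count_list p (u, t))) = 0"
      proof -
        have "(\<Sum>u\<in>?V. f (t, u) - int (count_list p (t, u))) = 0"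
        proof (rule sum.neutral, rule ballI)
          fix u assume "u \<in> ?V"
          show "f (t, u) - int (count_list p (t, u)) = 0"
            using tout[of u] pR by (auto simp: R_def count_list_0_iff)
        qed
        then show ?thesis using snet[of t] tST(2) unfolding net_def S' by simp
      qed
      have into_t: "f (u, t) - int (count_list p (u, t)) = 0" for u
      proof (cases "u \<in> ?V")
        case True
        then show ?thesis
          using sum_nonneg_eq_0_iff[OF pair_finite_verts, of "\<lambda>u. f (u, t) - int (count_list p (u, t))"]
            nonneg[OF s(2) dp pR] sum0 by auto
      next
        case False
        then have "(u, t) \<notin> R" using fR[of "(u, t)"] by (auto dest: wellformed')
        then show ?thesis using pR by (auto simp: R_def count_list_0_iff)
      qed
      have "is_flow ?V ?E (W - {t}) (\<lambda>e. f e - int (count_list p e)) (\<lambda>x. of_bool (x \<in> S') - of_bool (x \<in> T))"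
        unfolding is_flow_def
      proof (intro conjI allI impI)
        fix e assume ne: "f e - int (count_list p e) \<noteq> 0"
        then have "e \<in> R" using pR by (auto simp: R_def count_list_0_iff)
        moreover have "fst e \<noteq> t" using \<open>e \<in> R\<close> tout by (cases e) auto
        moreover have "snd e \<noteq> t" using ne into_t by (cases e) auto
        ultimately show "e \<in> ?E \<inter> (W - {t}) \<times> (W - {t})" using fR[of e] by (cases e) auto
      qed (use nonneg[OF s(2) dp pR] snet in auto)
      moreover have "S' \<subseteq> ?V" using less.prems(3) awalk_last_in_verts[OF \<open>awalk s p t\<close>] unfolding S' by auto
      ultimately obtain ms where ms: "transforming D S' ms T" "length ms \<le> card ((W - {t}) \<inter> S')"
        using less.hyps[OF smaller[OF s(2) dp pR], of "W - {t}" S'] less.prems(2) by blast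
      have "s \<in> W"
        using s(2,3) pR fR by (cases p) (auto simp: H.awalk_def)
      \<comment> \<open>The moved token ends up outside the new support. It is thus not counted
        again, and the cost drops by exactly the token on \<open>s\<close>.\<close>
      have "(W - {t}) \<inter> S' = W \<inter> S - {s}" using tST unfolding S' by auto
      moreover have "finite (W \<inter> S)" using less.prems(2) pair_finite_verts finite_subset by blast
      ultimately have "Suc (card ((W - {t}) \<inter> S')) = card (W \<inter> S)"
        using card_Suc_Diff1[of "W \<inter> S" s] \<open>s \<in> W\<close> s(1) by simp
      then show ?thesis using ms valid
        by (intro exI[of _ "(s, t) # ms"]) (auto simp: S'_def)
    qed
  qed
qed

section \<open>Dynamic programming over forests\<close>

text \<open>This is the flow that must leave \<open>X\<close>, or enter it if negative, across the
  only arc that joins a part of a tree with the terminals \<open>X\<close> to the rest.\<close>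

definition surplus :: "'a set \<Rightarrow> 'a set \<Rightarrow> 'a set \<Rightarrow> int" where
  "surplus S T X = int (card (X \<inter> S)) - int (card (X \<inter> T))"

definition routable :: "('a \<times> 'a) set \<Rightarrow> 'a set \<Rightarrow> 'a set \<Rightarrow> 'a set \<Rightarrow> 'a \<Rightarrow> 'a \<Rightarrow> bool" where
  "routable E S T X v u \<longleftrightarrow> (surplus S T X > 0 \<and> (v, u) \<in> E) \<or>
     (surplus S T X < 0 \<and> (u, v) \<in> E) \<or> surplus S T X = 0"

text \<open>\<open>bundled V E S T X v c\<close>: the terminals in \<open>X\<close> can be joined to \<open>v\<close> by a tree that routes
  their surplus to \<open>v\<close> and, apart from \<open>v\<close>, meets at most \<open>c\<close> vertices of \<open>S\<close>. A set without surplus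
  needs no arc, hence it may be moved to any vertex.\<close>

inductive bundled :: "'a set \<Rightarrow> ('a \<times> 'a) set \<Rightarrow> 'a set \<Rightarrow> 'a set \<Rightarrow> 'a set \<Rightarrow> 'a \<Rightarrow> nat \<Rightarrow> bool"
  for V E S T where
  start: "v \<in> V \<Longrightarrow> X \<subseteq> {v} \<inter> ((S - T) \<union> (T - S)) \<Longrightarrow> bundled V E S T X v c"
| extend: "bundled V E S T X v c \<Longrightarrow> u \<in> V \<Longrightarrow> routable E S T X v u \<Longrightarrow>
    bundled V E S T X u (c + of_bool (v \<in> S))"
| merge: "bundled V E S T X v c \<Longrightarrow> bundled V E S T Y v d \<Longrightarrow> X \<inter> Y = {} \<Longrightarrow>
    bundled V E S T (X \<union> Y) v (c + d)"

lemma bundled_subset: "bundled V E S T X v c \<Longrightarrow> v \<in> V \<and> X \<subseteq> V \<inter> ((S - T) \<union> (T - S))"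
  by (induction rule: bundled.induct) auto

lemma surplus_Un:
  assumes "finite X" "finite Y" "X \<inter> Y = {}"
  shows "surplus S T (X \<union> Y) = surplus S T X + surplus S T Y"
proof -
  have "card ((X \<union> Y) \<inter> A) = card (X \<inter> A) + card (Y \<inter> A)" for A
    unfolding Int_Un_distrib2 using assms by (intro card_Un_disjoint) auto
  then show ?thesis unfolding surplus_def by simp
qed

text \<open>The arcs of a derivation are superposed. Joined trees may overlap or carry flow in
  opposite directions, since there are no capacities, and the tokens of a union are at most the sum.
  The root is left out of the count so that \<open>merge\<close> does not charge it twice.\<close>

lemma bundled_flow:
  assumes "finite V"
  shows "bundled V E S T X v c \<Longrightarrow> \<exists>W f. W \<subseteq> V \<and> v \<in> W \<and> card (W \<inter> S - {v}) \<le> c \<and>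
    is_flow V (E \<inter> V \<times> V) W f
      (\<lambda>x. of_bool (x \<in> X \<inter> S) - of_bool (x \<in> X \<inter> T) - (if x = v then surplus S T X else 0))"
proof (induction rule: bundled.induct)
  case (start v X c)
  then consider "X = {}" | "X = {v}" by blast
  then have "is_flow V (E \<inter> V \<times> V) {v} (\<lambda>_. 0)
      (\<lambda>x. of_bool (x \<in> X \<inter> S) - of_bool (x \<in> X \<inter> T) - (if x = v then surplus S T X else 0))"
    by cases (auto simp: is_flow_def surplus_def)
  moreover have "card ({v} \<inter> S - {v}) \<le> c"
    by (metis Diff_eq_empty_iff card.empty inf_le1 le0)
  ultimately show ?case using start by (intro exI[of _ "{v}"] exI[of _ "\<lambda>_. 0"]) auto
next
  case (extend X v c u)
  then obtain W f where W: "W \<subseteq> V" "v \<in> W" "card (W \<inter> S - {v}) \<le> c"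
    and f: "is_flow V (E \<inter> V \<times> V) W f
      (\<lambda>x. of_bool (x \<in> X \<inter> S) - of_bool (x \<in> X \<inter> T) - (if x = v then surplus S T X else 0))"
    by blast
  have "v \<in> V" using W by blast
  \<comment> \<open>The sign of the surplus chooses the orientation. With surplus 0 the added flow
    vanishes, so that the pair chosen by default may fail to be an arc.\<close>
  define a where "a = (if surplus S T X \<ge> 0 then (v, u) else (u, v))"
  define g where "g e = (if e = a then \<bar>surplus S T X\<bar> else 0)" for e
  have "net V g x = (if x = v then surplus S T X else 0) - (if x = u then surplus S T X else 0)" for x
    unfolding g_def a_def
    using net_arc[OF assms, of v u "surplus S T X" x] net_arc[OF assms, of u v "- surplus S T X" x]
      \<open>v \<in> V\<close> \<open>u \<in> V\<close> by auto
  then have "is_flow V (E \<inter> V \<times> V) (W \<union> {u}) (\<lambda>e. f e + g e)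
      (\<lambda>x. of_bool (x \<in> X \<inter> S) - of_bool (x \<in> X \<inter> T) - (if x = u then surplus S T X else 0))"
    unfolding is_flow_def
  proof (intro conjI allI impI)
    fix e
    show "0 \<le> f e + g e" using is_flowD(1)[OF f, of e] unfolding g_def by simp
    assume "f e + g e \<noteq> 0"
    then have "f e \<noteq> 0 \<or> g e \<noteq> 0" by auto
    then show "e \<in> E \<inter> V \<times> V \<inter> (W \<union> {u}) \<times> (W \<union> {u})"
    proof
      assume "f e \<noteq> 0"
      then show ?thesis using is_flowD(2)[OF f, of e] by (cases e) auto
    next
      assume "g e \<noteq> 0"
      then show ?thesis using \<open>routable E S T X v u\<close> \<open>u \<in> V\<close> \<open>v \<in> V\<close> W(2)
        by (auto simp: g_def a_def routable_def split: if_splits)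
    qed
  next
    fix x
    assume "\<And>x. net V g x = (if x = v then surplus S T X else 0) - (if x = u then surplus S T X else 0)"
    then show "net V (\<lambda>e. f e + g e) x =
      of_bool (x \<in> X \<inter> S) - of_bool (x \<in> X \<inter> T) - (if x = u then surplus S T X else 0)"
      unfolding net_add is_flowD(3)[OF f] by simp
  qed
  moreover have "card ((W \<union> {u}) \<inter> S - {u}) \<le> c + of_bool (v \<in> S)"
  proof -
    have fin: "finite (W \<inter> S)" using W(1) assms finite_subset by blast
    have "card ((W \<union> {u}) \<inter> S - {u}) \<le> card (W \<inter> S)"
      using fin by (intro card_mono) auto
    also have "\<dots> = card (W \<inter> S - {v}) + of_bool (v \<in> S)"
    proof (cases "v \<in> S")
      case True
      then show ?thesis using card_Suc_Diff1[OF fin, of v] W(2) by simp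
    qed simp
    finally show ?thesis using W(3) by simp
  qed
  ultimately show ?case using W(1) \<open>u \<in> V\<close>
    by (intro exI[of _ "W \<union> {u}"] exI[of _ "\<lambda>e. f e + g e"]) auto
next
  case (merge X v c Y d)
  then obtain W f Z g where W: "W \<subseteq> V" "v \<in> W" "card (W \<inter> S - {v}) \<le> c"
    and Z: "Z \<subseteq> V" "v \<in> Z" "card (Z \<inter> S - {v}) \<le> d"
    and f: "is_flow V (E \<inter> V \<times> V) W f
      (\<lambda>x. of_bool (x \<in> X \<inter> S) - of_bool (x \<in> X \<inter> T) - (if x = v then surplus S T X else 0))"
    and g: "is_flow V (E \<inter> V \<times> V) Z g
      (\<lambda>x. of_bool (x \<in> Y \<inter> S) - of_bool (x \<in> Y \<inter> T) - (if x = v then surplus S T Y else 0))"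
    by blast
  have "finite X" "finite Y"
    using merge.hyps bundled_subset assms by (metis finite_Int finite_subset)+
  then have sur: "surplus S T (X \<union> Y) = surplus S T X + surplus S T Y"
    by (rule surplus_Un[OF _ _ \<open>X \<inter> Y = {}\<close>])
  have "is_flow V (E \<inter> V \<times> V) (W \<union> Z) (\<lambda>e. f e + g e) (\<lambda>x. of_bool (x \<in> (X \<union> Y) \<inter> S) -
      of_bool (x \<in> (X \<union> Y) \<inter> T) - (if x = v then surplus S T (X \<union> Y) else 0))"
    unfolding is_flow_def
  proof (intro conjI allI impI)
    fix e
    show "0 \<le> f e + g e" using is_flowD(1)[OF f, of e] is_flowD(1)[OF g, of e] by simp
    assume "f e + g e \<noteq> 0"
    then have "f e \<noteq> 0 \<or> g e \<noteq> 0" by auto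
    then show "e \<in> E \<inter> V \<times> V \<inter> (W \<union> Z) \<times> (W \<union> Z)"
      using is_flowD(2)[OF f, of e] is_flowD(2)[OF g, of e] by (cases e) auto
  next
    fix x
    show "net V (\<lambda>e. f e + g e) x = of_bool (x \<in> (X \<union> Y) \<inter> S) -
      of_bool (x \<in> (X \<union> Y) \<inter> T) - (if x = v then surplus S T (X \<union> Y) else 0)"
      using \<open>X \<inter> Y = {}\<close> unfolding net_add is_flowD(3)[OF f] is_flowD(3)[OF g] sur by auto
  qed
  moreover have "card ((W \<union> Z) \<inter> S - {v}) \<le> c + d"
  proof -
    have "(W \<union> Z) \<inter> S - {v} = (W \<inter> S - {v}) \<union> (Z \<inter> S - {v})" by auto
    then show ?thesis using card_Un_le[of "W \<inter> S - {v}" "Z \<inter> S - {v}"] W(3) Z(3) by simp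
  qed
  ultimately show ?case using W(1,2) Z(1)
    by (intro exI[of _ "W \<union> Z"] exI[of _ "\<lambda>e. f e + g e"]) auto
qed

section \<open>Reducing the support of a flow to a forest\<close>

text \<open>By contraction of an arc that is not a loop.\<close>

lemma circulation_exists:
  fixes src tgt :: "'i \<Rightarrow> 'a"
  assumes "finite W" "W \<noteq> {}" "finite I" "card W \<le> card I" "src ` I \<subseteq> W" "tgt ` I \<subseteq> W"
  shows "\<exists>g :: 'i \<Rightarrow> real. (\<exists>i\<in>I. g i \<noteq> 0) \<and>
    (\<forall>w. (\<Sum>i\<in>I. (of_bool (src i = w) - of_bool (tgt i = w)) * g i) = 0)"
  using assms
proof (induction "card W" arbitrary: W I src tgt)
  case (Suc n)
  have "I \<noteq> {}" using Suc.prems by (metis card.empty card_0_eq le_zero_eq)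
  show ?case
  proof (cases "\<exists>i\<in>I. src i = tgt i")
    case True
    then obtain i where "i \<in> I" "src i = tgt i" by blast
    then show ?thesis
      by (intro exI[of _ "\<lambda>j. of_bool (j = i)"]) (auto intro!: sum.neutral)
  next
    case False
    obtain e where e: "e \<in> I" using \<open>I \<noteq> {}\<close> by blast
    let ?u = "src e" and ?v = "tgt e"
    have uv: "?u \<noteq> ?v" "?u \<in> W" "?v \<in> W" using False e Suc.prems by auto
    \<comment> \<open>The head of \<open>e\<close> is identified with its tail. This can create
      parallel arcs and loops, which is why arcs are indices with end maps and not pairs of
      vertices.\<close>
    let ?c = "\<lambda>x. if x = ?v then ?u else x"
    let ?I = "I - {e}"
    have "\<exists>g :: 'i \<Rightarrow> real. (\<exists>i\<in>?I. g i \<noteq> 0) \<and>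
      (\<forall>w. (\<Sum>i\<in>?I. (of_bool ((?c \<circ> src) i = w) - of_bool ((?c \<circ> tgt) i = w)) * g i) = 0)"
    proof (rule Suc.hyps(1)[of "W - {?v}"])
      show "n = card (W - {?v})" using Suc.hyps(2) Suc.prems(1) uv by simp
      show "card (W - {?v}) \<le> card ?I" using Suc.prems e uv by simp
      show "W - {?v} \<noteq> {}" using uv by blast
    qed (use Suc.prems uv in auto)
    then obtain g :: "'i \<Rightarrow> real" where g: "\<exists>i\<in>?I. g i \<noteq> 0"
      "\<And>w. (\<Sum>i\<in>?I. (of_bool (?c (src i) = w) - of_bool (?c (tgt i) = w)) * g i) = 0" by auto
    define s where "s w = (\<Sum>i\<in>?I. (of_bool (src i = w) - of_bool (tgt i = w)) * g i)" for w
    have suv: "s ?u + s ?v = 0"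
    proof -
      have "s ?u + s ?v = (\<Sum>i\<in>?I. (of_bool (?c (src i) = ?u) - of_bool (?c (tgt i) = ?u)) * g i)"
        unfolding s_def sum.distrib[symmetric] using uv
        by (intro sum.cong) (auto simp: algebra_simps)
      then show ?thesis using g(2) by simp
    qed
    have s0: "s w = 0" if "w \<noteq> ?u" "w \<noteq> ?v" for w
    proof -
      have "s w = (\<Sum>i\<in>?I. (of_bool (?c (src i) = w) - of_bool (?c (tgt i) = w)) * g i)"
        unfolding s_def using that by (intro sum.cong) auto
      then show ?thesis using g(2) by simp
    qed
    \<comment> \<open>The value on the contracted arc restores the balance at its head. The
      imbalances at its two ends are opposite, so the tail becomes balanced as well.\<close>
    let ?g = "g(e := s ?v)"
    have "(\<Sum>i\<in>I. (of_bool (src i = w) - of_bool (tgt i = w)) * ?g i) = 0" for w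
    proof -
      have "(\<Sum>i\<in>I. (of_bool (src i = w) - of_bool (tgt i = w)) * ?g i) =
        (of_bool (?u = w) - of_bool (?v = w)) * s ?v +
        (\<Sum>i\<in>?I. (of_bool (src i = w) - of_bool (tgt i = w)) * ?g i)"
        using Suc.prems(3) e by (subst sum.remove[of _ e]) auto
      also have "(\<Sum>i\<in>?I. (of_bool (src i = w) - of_bool (tgt i = w)) * ?g i) = s w"
        unfolding s_def by (intro sum.cong) auto
      finally show ?thesis using suv s0[of w] uv by (cases "w = ?u"; cases "w = ?v") auto
    qed
    moreover have "\<exists>i\<in>I. ?g i \<noteq> 0" using g(1) by auto
    ultimately show ?thesis by blast
  qed
qed simp

lemma net_sum: "net V (\<lambda>e. \<Sum>i\<in>I. h i e) x = (\<Sum>i\<in>I. net V (h i) x)"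
proof (cases "finite I")
  case True
  then show ?thesis by induction (auto simp: net_add)
qed simp

lemma net_conv_sum:
  fixes g :: "'a \<times> 'a \<Rightarrow> 'b::comm_ring_1"
  assumes "finite V" "I \<subseteq> V \<times> V" "\<And>e. e \<notin> I \<Longrightarrow> g e = 0"
  shows "net V g x = (\<Sum>e\<in>I. (of_bool (fst e = x) - of_bool (snd e = x)) * g e)"
proof -
  have I: "finite I" using assms finite_subset by blast
  have "g = (\<lambda>e'. \<Sum>e\<in>I. if e' = e then g e else 0)"
    using assms(3) I by (auto simp: sum.delta)
  then have "net V g x = (\<Sum>e\<in>I. net V (\<lambda>e'. if e' = e then g e else 0) x)"
    by (subst net_sum[symmetric]) simp
  also have "\<dots> = (\<Sum>e\<in>I. (of_bool (fst e = x) - of_bool (snd e = x)) * g e)"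
  proof (rule sum.cong[OF refl])
    fix e assume "e \<in> I"
    then have "fst e \<in> V" "snd e \<in> V" using assms(2) by auto
    then show "net V (\<lambda>e'. if e' = e then g e else 0) x =
      (of_bool (fst e = x) - of_bool (snd e = x)) * g e"
      using net_arc[OF assms(1), of "fst e" "snd e" "g e" x] by auto
  qed
  finally show ?thesis .
qed

text \<open>The ratio test of linear programming: a circulation inside the support is subtracted
  with the largest factor that keeps all values nonnegative, and an arc attaining the minimal ratio
  disappears.\<close>

lemma smaller_support:
  fixes f :: "'a \<times> 'a \<Rightarrow> real"
  assumes V: "finite V" "W \<subseteq> V" "W \<noteq> {}" and f: "is_flow V E W f d"
    and card: "card W \<le> card {e. f e \<noteq> 0}"
  shows "\<exists>f'. is_flow V E W f' d \<and> {e. f' e \<noteq> 0} \<subset> {e. f e \<noteq> 0}"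
proof -
  let ?I = "{e. f e \<noteq> 0}"
  have IW: "?I \<subseteq> W \<times> W" using is_flowD(2)[OF f] by (auto simp del: split_paired_All)
  have W: "finite W" using V finite_subset by blast
  have I: "finite ?I" using IW W finite_subset by blast
  have IV: "?I \<subseteq> V \<times> V" using IW V(2) by blast
  obtain g0 :: "'a \<times> 'a \<Rightarrow> real" where g0: "\<exists>e\<in>?I. g0 e \<noteq> 0"
    "\<And>w. (\<Sum>e\<in>?I. (of_bool (fst e = w) - of_bool (snd e = w)) * g0 e) = 0"
    using circulation_exists[OF W V(3) I card, of fst snd] IW by fastforce
  define g where "g e = (if e \<in> ?I then g0 e else 0)" for e
  have gI: "g e = 0" if "e \<notin> ?I" for e using that unfolding g_def by simp
  have "net V g x = (\<Sum>e\<in>?I. (of_bool (fst e = x) - of_bool (snd e = x)) * g e)" for x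
    by (rule net_conv_sum[OF V(1) IV gI])
  also have "\<dots> x = (\<Sum>e\<in>?I. (of_bool (fst e = x) - of_bool (snd e = x)) * g0 e)" for x
    by (rule sum.cong) (auto simp: g_def)
  finally have gnet: "net V g x = 0" for x using g0(2) by simp
  \<comment> \<open>The ratio test requires a positive entry. If the circulation has none, its
    negative has one.\<close>
  obtain h :: "'a \<times> 'a \<Rightarrow> real" where h: "\<And>e. e \<notin> ?I \<Longrightarrow> h e = 0" "\<And>x. net V h x = 0" "\<exists>e. h e > 0"
  proof (cases "\<exists>e. g e > 0")
    case True
    then show ?thesis using that[of g] gI gnet by blast
  next
    case False
    then have "\<exists>e. - 1 * g e > 0" using g0(1) unfolding g_def
      by (smt (verit, best) mult_minus1)
    moreover have "net V (\<lambda>e. - 1 * g e) x = 0" for x unfolding net_scale using gnet by simp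
    ultimately show ?thesis using that[of "\<lambda>e. - 1 * g e"] gI by simp
  qed
  let ?P = "{e. h e > 0}"
  have P: "?P \<subseteq> ?I" using h(1) by force
  then have finP: "finite ?P" using I finite_subset by blast
  define l where "l = Min ((\<lambda>e. f e / h e) ` ?P)"
  have "l \<in> (\<lambda>e. f e / h e) ` ?P" unfolding l_def using finP h(3) by (intro Min_in) auto
  then obtain e1 where e1: "h e1 > 0" "l = f e1 / h e1" by auto
  have l0: "0 \<le> l" using is_flowD(1)[OF f] e1 by simp
  have lle: "l * h e \<le> f e" for e
  proof (cases "h e > 0")
    case True
    then have "l \<le> f e / h e" unfolding l_def using finP by (intro Min_le) auto
    then show ?thesis using True by (simp add: field_simps)
  next
    case False
    then have "l * h e \<le> 0" using l0 by (simp add: mult_nonneg_nonpos)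
    then show ?thesis using is_flowD(1)[OF f, of e] by linarith
  qed
  let ?f = "\<lambda>e. f e - l * h e"
  have sup: "f e \<noteq> 0" if "?f e \<noteq> 0" for e using h(1)[of e] that by auto
  have "is_flow V E W ?f d"
    unfolding is_flow_def
  proof (intro conjI allI impI)
    fix e assume "?f e \<noteq> 0"
    then show "e \<in> E \<inter> W \<times> W" using is_flowD(2)[OF f sup] by (cases e) auto
  next
    fix x show "net V ?f x = d x" unfolding net_diff net_scale h(2) is_flowD(3)[OF f] by simp
  qed (use lle in simp)
  moreover have "{e. ?f e \<noteq> 0} \<subset> ?I"
  proof -
    have "?f e1 = 0" using e1 by simp
    moreover have "f e1 \<noteq> 0" using P e1(1) by auto
    ultimately show ?thesis using sup by blast
  qed
  ultimately show ?thesis by blast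
qed

text \<open>The degrees add up to \<open>2 * card I\<close>, which is less than
  \<open>2 * card W\<close>. A loop counts twice, so the vertex found carries none.\<close>

lemma low_degree_vertex:
  assumes "finite W" "I \<subseteq> W \<times> W" "card I < card W"
  shows "\<exists>v\<in>W. card {e \<in> I. fst e = v} + card {e \<in> I. snd e = v} \<le> 1"
proof (rule ccontr)
  have I: "finite I" using assms finite_subset by blast
  assume "\<not> ?thesis"
  then have "2 \<le> card {e \<in> I. fst e = v} + card {e \<in> I. snd e = v}" if "v \<in> W" for v
    using that by fastforce
  then have "(\<Sum>v\<in>W. 2) \<le> (\<Sum>v\<in>W. card {e \<in> I. fst e = v} + card {e \<in> I. snd e = v})"
    by (rule sum_mono)
  also have "\<dots> = (\<Sum>v\<in>W. card {e \<in> I. fst e = v}) + (\<Sum>v\<in>W. card {e \<in> I. snd e = v})"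
    by (rule sum.distrib)
  also have "(\<Sum>v\<in>W. card {e \<in> I. fst e = v}) = card I"
    using sum.group[OF I assms(1), of fst "\<lambda>_. 1::nat"] assms(2) by force
  also have "(\<Sum>v\<in>W. card {e \<in> I. snd e = v}) = card I"
    using sum.group[OF I assms(1), of snd "\<lambda>_. 1::nat"] assms(2) by force
  finally show False using assms(3) by simp
qed

text \<open>The statement is generalized so that the induction can peel off leaves: each vertex
  \<open>x\<close> already holds a bundle \<open>X x\<close> of cost \<open>c x\<close>, whose
  surplus is the supply of \<open>x\<close>. If there are at least as many arcs as vertices,
  \<open>smaller_support\<close> removes an arc. Otherwise some vertex of degree at most 1 passes
  its bundle on and leaves \<open>W\<close>. The total cost is invariant throughout.\<close>

lemma flow_bundled:
  fixes f :: "'a \<times> 'a \<Rightarrow> real"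
  assumes V: "finite V"
  shows "W \<subseteq> V \<Longrightarrow> W \<noteq> {} \<Longrightarrow>
    is_flow V E W f (\<lambda>x. if x \<in> W then of_int (surplus S T (X x)) else 0) \<Longrightarrow>
    (\<And>x. x \<in> W \<Longrightarrow> bundled V E S T (X x) x (c x)) \<Longrightarrow>
    (\<And>x y. x \<in> W \<Longrightarrow> y \<in> W \<Longrightarrow> x \<noteq> y \<Longrightarrow> X x \<inter> X y = {}) \<Longrightarrow>
    \<exists>v\<in>W. \<exists>k. bundled V E S T (\<Union>x\<in>W. X x) v k \<and>
      k + of_bool (v \<in> S) = (\<Sum>x\<in>W. c x + of_bool (x \<in> S))"
proof (induction "card W + card {e. f e \<noteq> 0}" arbitrary: W f X c rule: less_induct)
  case less
  note WV = less.prems(1) and f = less.prems(3) and B = less.prems(4) and disj = less.prems(5)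
  let ?I = "{e. f e \<noteq> 0}"
  have W: "finite W" using WV V finite_subset by blast
  have IW: "?I \<subseteq> W \<times> W" using is_flowD(2)[OF f] by (auto simp del: split_paired_All)
  have I: "finite ?I" using IW W finite_subset by blast
  show ?case
  proof (cases "\<exists>v. W = {v}")
    case True
    then obtain v where "W = {v}" by blast
    then show ?thesis using B[of v] by (intro bexI[of _ v] exI[of _ "c v"]) auto
  next
    case not_single: False
    show ?thesis
    proof (cases "card W \<le> card ?I")
      case True
      obtain f' :: "'a \<times> 'a \<Rightarrow> real" where f': "is_flow V E W f' (\<lambda>x. if x \<in> W then of_int (surplus S T (X x)) else 0)"
        "{e. f' e \<noteq> 0} \<subset> ?I" using smaller_support[OF V WV less.prems(2) f True] by blast
      have "card W + card {e. f' e \<noteq> 0} < card W + card ?I"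
        using psubset_card_mono[OF I f'(2)] by simp
      from less.hyps[OF this WV less.prems(2) f'(1) B disj] show ?thesis .
    next
      case False
      then have "card ?I < card W" by simp
      then obtain v where v: "v \<in> W" and
        deg: "card {e \<in> ?I. fst e = v} + card {e \<in> ?I. snd e = v} \<le> 1"
        using low_degree_vertex[OF W IW] by blast
      have vV: "v \<in> V" using v WV by blast
      \<comment> \<open>The vertex \<open>v\<close> is deleted and its bundle is merged into that of
        \<open>u\<close>. The cost of \<open>u\<close> grows by that of \<open>v\<close> and by the
        token that \<open>v\<close> may carry, which leaves the sum unchanged.\<close>
      have absorb: ?thesis
        if u: "u \<in> W" "u \<noteq> v" and r: "routable E S T (X v) v u"
          and f': "\<And>e. 0 \<le> f' e" "\<And>e. f' e \<noteq> 0 \<Longrightarrow> f e \<noteq> 0 \<and> fst e \<noteq> v \<and> snd e \<noteq> v"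
            "\<And>x. net V f' x = net V f x + (if x = u then of_int (surplus S T (X v)) else 0)
               - (if x = v then of_int (surplus S T (X v)) else 0)"
        for u f'
      proof -
        let ?W = "W - {v}"
        let ?X = "X(u := X u \<union> X v)" and ?c = "c(u := c u + (c v + of_bool (v \<in> S)))"
        have uV: "u \<in> V" using u WV by blast
        have fin: "finite (X x)" if "x \<in> W" for x
          using bundled_subset[OF B[OF that]] V by (meson finite_Int finite_subset)
        have Xuv: "X u \<inter> X v = {}" using disj u v by blast
        have sur: "surplus S T (X u \<union> X v) = surplus S T (X u) + surplus S T (X v)"
          by (rule surplus_Un[OF fin[OF u(1)] fin[OF v] Xuv])
        have "\<exists>w\<in>?W. \<exists>k. bundled V E S T (\<Union>x\<in>?W. ?X x) w k \<and>
          k + of_bool (w \<in> S) = (\<Sum>x\<in>?W. ?c x + of_bool (x \<in> S))"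
        proof (rule less.hyps[where f = f'])
          have "card {e. f' e \<noteq> 0} \<le> card ?I" using f'(2) I by (intro card_mono) auto
          moreover have "card ?W < card W" using W v by (intro psubset_card_mono) auto
          ultimately show "card ?W + card {e. f' e \<noteq> 0} < card W + card ?I" by simp
          show "is_flow V E ?W f' (\<lambda>x. if x \<in> ?W then of_int (surplus S T (?X x)) else 0)"
            unfolding is_flow_def
          proof (intro conjI allI impI)
            fix e assume "f' e \<noteq> 0"
            then show "e \<in> E \<inter> ?W \<times> ?W" using f'(2)[of e] is_flowD(2)[OF f, of e] by (cases e) auto
          next
            fix x show "net V f' x = (if x \<in> ?W then of_int (surplus S T (?X x)) else 0)"
              unfolding f'(3) is_flowD(3)[OF f] using u v sur by auto
          qed (rule f'(1))
          show "bundled V E S T (?X x) x (?c x)" if "x \<in> ?W" for x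
          proof (cases "x = u")
            case True
            then show ?thesis
              using bundled.merge[OF B[OF u(1)] bundled.extend[OF B[OF v] uV r] Xuv] by simp
          qed (use B that in auto)
          show "?X x \<inter> ?X y = {}" if "x \<in> ?W" "y \<in> ?W" "x \<noteq> y" for x y
            using disj[of x y] disj[of v x] disj[of v y] that v by auto
        qed (use WV u in auto)
        moreover have "(\<Union>x\<in>?W. ?X x) = (\<Union>x\<in>W. X x)" using u v by (auto split: if_splits)
        moreover have "(\<Sum>x\<in>?W. ?c x + of_bool (x \<in> S)) = (\<Sum>x\<in>W. c x + of_bool (x \<in> S))"
        proof -
          have "(\<Sum>x\<in>?W. ?c x + of_bool (x \<in> S)) =
              ?c u + of_bool (u \<in> S) + (\<Sum>x\<in>?W - {u}. ?c x + of_bool (x \<in> S))"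
            using W u by (subst sum.remove[of _ u]) auto
          also have "(\<Sum>x\<in>?W - {u}. ?c x + of_bool (x \<in> S)) = (\<Sum>x\<in>?W - {u}. c x + of_bool (x \<in> S))"
            by (intro sum.cong) auto
          also have "?c u + of_bool (u \<in> S) + (\<Sum>x\<in>?W - {u}. c x + of_bool (x \<in> S)) =
              (c v + of_bool (v \<in> S)) + (c u + of_bool (u \<in> S) + (\<Sum>x\<in>?W - {u}. c x + of_bool (x \<in> S)))"
            by simp
          also have "c u + of_bool (u \<in> S) + (\<Sum>x\<in>?W - {u}. c x + of_bool (x \<in> S)) =
              (\<Sum>x\<in>?W. c x + of_bool (x \<in> S))"
            using W u by (subst (2) sum.remove[of _ u]) auto
          also have "(c v + of_bool (v \<in> S)) + (\<Sum>x\<in>?W. c x + of_bool (x \<in> S)) =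
              (\<Sum>x\<in>W. c x + of_bool (x \<in> S))"
            using W v by (subst (2) sum.remove[of _ v]) auto
          finally show ?thesis .
        qed
        ultimately have "\<exists>w\<in>?W. \<exists>k. bundled V E S T (\<Union>x\<in>W. X x) w k \<and>
            k + of_bool (w \<in> S) = (\<Sum>x\<in>W. c x + of_bool (x \<in> S))"
          by (simp only:)
        then show ?thesis by blast
      qed
      have net_v: "net V g v = 0" if "\<And>e. fst e = v \<Longrightarrow> g e = 0" "\<And>e. snd e = v \<Longrightarrow> g e = 0"
        for g :: "'a \<times> 'a \<Rightarrow> real"
        unfolding net_def using that by simp
      have dv: "net V f v = of_int (surplus S T (X v))" using is_flowD(3)[OF f] v by simp
      show ?thesis
      proof (cases "\<exists>e\<in>?I. fst e = v \<or> snd e = v")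
        case False
        have f_v: "f e \<noteq> 0 \<Longrightarrow> fst e \<noteq> v \<and> snd e \<noteq> v" for e using False by blast
        have "net V f v = 0" by (rule net_v) (use False in blast)+
        then have "surplus S T (X v) = 0" using dv by simp
        \<comment> \<open>An isolated vertex has surplus 0, so its bundle can go to any other vertex
          without an arc. In this way the components of the forest are put together.\<close>
        moreover obtain u where "u \<in> W" "u \<noteq> v" using not_single v by blast
        ultimately show ?thesis
          using f_v is_flowD(1)[OF f] by (intro absorb[of u f]) (auto simp: routable_def)
      next
        case True
        then obtain a where a: "f a \<noteq> 0" "fst a = v \<or> snd a = v" by blast
        have apos: "f a > 0" using a(1) is_flowD(1)[OF f, of a] by simp
        \<comment> \<open>By the degree bound \<open>a\<close> is the only arc at \<open>v\<close>;
          it is not a loop, since a loop would be counted at both ends.\<close>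
        have only: "e = a" "fst a \<noteq> snd a" if "f e \<noteq> 0" "fst e = v \<or> snd e = v" for e
        proof -
          define F where "F = {e \<in> ?I. fst e = v}"
          define G where "G = {e \<in> ?I. snd e = v}"
          have fin: "finite F" "finite G" using I by (auto simp: F_def G_def)
          have le1: "card F + card G \<le> 1" using deg unfolding F_def G_def .
          then have "card F \<le> Suc 0" "card G \<le> Suc 0" by simp_all
          then have one: "\<forall>x\<in>F. \<forall>y\<in>F. x = y" "\<forall>x\<in>G. \<forall>y\<in>G. x = y"
            using card_le_Suc0_iff_eq[OF fin(1)] card_le_Suc0_iff_eq[OF fin(2)] by blast+
          have none: "x \<notin> F \<or> y \<notin> G" for x y
          proof (rule ccontr)
            assume "\<not> ?thesis"
            then have "F \<noteq> {}" "G \<noteq> {}" by blast+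
            then have "0 < card F" "0 < card G" using fin by (simp_all add: card_gt_0_iff)
            then show False using le1 by simp
          qed
          have "e \<in> F \<or> e \<in> G" "a \<in> F \<or> a \<in> G" using that a unfolding F_def G_def by simp_all
          then show "e = a" using one none by metis
          have "a \<in> F \<and> a \<in> G" if "fst a = snd a" using a that unfolding F_def G_def by auto
          then show "fst a \<noteq> snd a" using none by blast
        qed
        have aE: "a \<in> E" "fst a \<in> W" "snd a \<in> W" using is_flowD(2)[OF f a(1)] by auto
        let ?f = "\<lambda>e. f e - (if e = a then f a else 0)"
        have netf: "net V ?f x = net V f x - ((if x = fst a then f a else 0) - (if x = snd a then f a else 0))"
          for x
        proof -
          have "fst a \<in> V" "snd a \<in> V" using aE WV by blast+
          from net_arc[OF V this, of "f a" x] show ?thesis unfolding net_diff by simp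
        qed
        have fv: "?f e = 0" if "fst e = v \<or> snd e = v" for e using only(1)[of e] that by auto
        have "net V ?f v = 0" using fv by (intro net_v) auto
        \<comment> \<open>Conservation at \<open>v\<close> forces the value of the only arc to be
          the absolute value of the surplus of the bundle, so its orientation is the one that
          \<open>routable\<close> demands.\<close>
        then have d0: "of_int (surplus S T (X v)) =
            (if v = fst a then f a else 0) - (if v = snd a then f a else 0)"
          using netf[of v] dv by simp
        have pos: "0 \<le> ?f e" for e using is_flowD(1)[OF f, of e] by simp
        have sup: "f e \<noteq> 0 \<and> fst e \<noteq> v \<and> snd e \<noteq> v" if "?f e \<noteq> 0" for e
          using fv[of e] that by (auto split: if_splits)
        have ne: "fst a \<noteq> snd a" using only(2)[OF a] .
        show ?thesis
        proof (cases "fst a = v")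
          case True
          then have s: "of_int (surplus S T (X v)) = f a" using d0 ne by simp
          then have "surplus S T (X v) > 0" using apos by linarith
          then have "routable E S T (X v) v (snd a)" using aE(1) True unfolding routable_def by force
          then show ?thesis using True ne aE s pos sup netf
            by (intro absorb[of "snd a" ?f]) auto
        next
          case False
          then have "snd a = v" using a(2) by simp
          then have s: "of_int (surplus S T (X v)) = - f a" using d0 ne by simp
          then have "surplus S T (X v) < 0" using apos by linarith
          then have "routable E S T (X v) v (fst a)" using aE(1) \<open>snd a = v\<close> unfolding routable_def by force
          then show ?thesis using \<open>snd a = v\<close> ne aE s pos sup netf
            by (intro absorb[of "fst a" ?f]) auto
        qed
      qed
    qed
  qed
qed

section \<open>Characterization of yes-instances\<close>

text \<open>Demanding a total of exactly \<open>l\<close> loses nothing, because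
  \<open>start\<close> admits every cost, so that unspent budget can be attached to a leaf; the
  algorithm can then test costs for equality. The token of the root, left out by
  \<open>bundled\<close>, is added here. The case \<open>S = T\<close> stands apart because a root
  need not exist and may carry a token, although no move has to be made.\<close>

definition reconfigurable :: "'a set \<Rightarrow> ('a \<times> 'a) set \<Rightarrow> 'a set \<Rightarrow> 'a set \<Rightarrow> nat \<Rightarrow> bool" where
  "reconfigurable V E S T l \<longleftrightarrow> S = T \<or>
     (\<exists>v c. bundled V E S T ((S - T) \<union> (T - S)) v c \<and> c + of_bool (v \<in> S) = l)"

theorem reconfigurable_iff:
  assumes D: "pair_fin_digraph D" and ST: "S \<subseteq> pverts D" "T \<subseteq> pverts D" "card S = card T"
  shows "reconfigurable (pverts D) (parcs D) S T l \<longleftrightarrow>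
    (\<exists>ms. transforming D S ms T \<and> length ms \<le> l)"
proof -
  interpret pair_fin_digraph D by (rule D)
  let ?V = "pverts D" and ?E = "parcs D" and ?Z = "(S - T) \<union> (T - S)"
  have fin: "finite S" "finite T" using ST pair_finite_verts finite_subset by blast+
  have E: "?E \<inter> ?V \<times> ?V = ?E" by (auto dest: wellformed')
  show ?thesis
  proof
    assume "reconfigurable ?V ?E S T l"
    then consider "S = T" | v c where "bundled ?V ?E S T ?Z v c" "c + of_bool (v \<in> S) = l"
      unfolding reconfigurable_def by blast
    then show "\<exists>ms. transforming D S ms T \<and> length ms \<le> l"
    proof cases
      case 1
      then show ?thesis by (intro exI[of _ "[]"]) auto
    next
      case 2
      \<comment> \<open>Equal cardinalities make the total surplus vanish, so nothing is left over
        at the root and the flow has the required net values.\<close>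
      have "card (S - T) = card (T - S)"
        using ST(3) fin by (simp add: card_Diff_subset_Int Int_commute)
      moreover have "?Z \<inter> S = S - T" "?Z \<inter> T = T - S" by auto
      ultimately have sur: "surplus S T ?Z = 0" unfolding surplus_def by simp
      obtain W f where W: "W \<subseteq> ?V" "v \<in> W" "card (W \<inter> S - {v}) \<le> c"
        and f: "is_flow ?V ?E W f (\<lambda>x. of_bool (x \<in> ?Z \<inter> S) - of_bool (x \<in> ?Z \<inter> T) -
          (if x = v then surplus S T ?Z else 0))"
        using bundled_flow[OF pair_finite_verts 2(1)] unfolding E by blast
      have "(\<lambda>x. of_bool (x \<in> ?Z \<inter> S) - of_bool (x \<in> ?Z \<inter> T) - (if x = v then surplus S T ?Z else 0))
          = (\<lambda>x. of_bool (x \<in> S) - of_bool (x \<in> T) :: int)"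
        unfolding sur by auto
      then have "\<exists>ms. transforming D S ms T \<and> length ms \<le> card (W \<inter> S)"
        using f by (intro flow_transforming[OF D _ W(1) ST(1,2)]) auto
      moreover have "card (W \<inter> S) \<le> l"
      proof (cases "v \<in> S")
        case True
        have "finite (W \<inter> S)" using fin by simp
        then show ?thesis using card_Suc_Diff1[of "W \<inter> S" v] W 2(2) True by simp
      next
        case False then show ?thesis using W 2(2) by simp
      qed
      ultimately show ?thesis by (meson le_trans)
    qed
  next
    assume "\<exists>ms. transforming D S ms T \<and> length ms \<le> l"
    then obtain ms where "transforming D S ms T" and ms: "length ms \<le> l" by blast
    from transforming_flow[OF D this(1)] obtain W f where W: "W \<subseteq> ?V" "finite W"
      and f: "is_flow ?V ?E W f (\<lambda>x. of_bool (x \<in> S) - of_bool (x \<in> T) :: int)"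
      and card: "card (W \<inter> S) \<le> length ms" using ST by (metis Un_absorb2)
    show "reconfigurable ?V ?E S T l"
    proof (cases "S = T")
      case False
      have supp: "e \<in> ?E \<inter> W \<times> W" if "f e \<noteq> 0" for e
        using is_flowD(2)[OF f that] by (cases e) auto
      have ZW: "?Z \<subseteq> W"
      proof
        fix x assume "x \<in> ?Z"
        then have "net ?V f x \<noteq> 0" unfolding is_flowD(3)[OF f] by auto
        then have "\<exists>u. f (x, u) \<noteq> 0 \<or> f (u, x) \<noteq> 0"
          unfolding net_def by (metis (no_types, lifting) diff_self sum.neutral)
        then show "x \<in> W" using supp by blast
      qed
      then obtain w where w: "w \<in> W" using False by blast
      define X where "X x = {x} \<inter> ?Z" for x
      \<comment> \<open>The budget that the sequence does not spend is charged to the arbitrary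
        vertex \<open>w\<close>, which makes the total exactly \<open>l\<close>.\<close>
      define c where "c x = (if x = w then l - card (W \<inter> S) else 0)" for x
      have sur: "surplus S T (X x) = of_bool (x \<in> S) - of_bool (x \<in> T)" for x
        unfolding surplus_def X_def by (cases "x \<in> S"; cases "x \<in> T") auto
      have "\<exists>v\<in>W. \<exists>k. bundled ?V ?E S T (\<Union>x\<in>W. X x) v k \<and>
          k + of_bool (v \<in> S) = (\<Sum>x\<in>W. c x + of_bool (x \<in> S))"
      proof (rule flow_bundled[where f = "\<lambda>e. real_of_int (f e)"])
        show "is_flow ?V ?E W (\<lambda>e. real_of_int (f e))
            (\<lambda>x. if x \<in> W then real_of_int (surplus S T (X x)) else 0)"
          unfolding is_flow_def
        proof (intro conjI allI impI)
          fix x show "net ?V (\<lambda>e. real_of_int (f e)) x = (if x \<in> W then real_of_int (surplus S T (X x)) else 0)"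
            unfolding net_of_int is_flowD(3)[OF f] sur using ZW by auto
        qed (use is_flowD(1)[OF f] supp in auto)
        show "bundled ?V ?E S T (X x) x (c x)" if "x \<in> W" for x
          using W(1) that by (intro bundled.start) (auto simp: X_def)
      qed (use pair_finite_verts W w in \<open>auto simp: X_def\<close>)
      moreover have "(\<Union>x\<in>W. X x) = ?Z" using ZW by (auto simp: X_def)
      moreover have "(\<Sum>x\<in>W. c x + of_bool (x \<in> S)) = l"
      proof -
        have "(\<Sum>x\<in>W. of_bool (x \<in> S)) = card (W \<inter> S)"
          using W(2) by (simp add: sum.If_cases of_bool_def)
        moreover have "(\<Sum>x\<in>W. c x) = l - card (W \<inter> S)"
          unfolding c_def using w W(2) by simp
        ultimately show ?thesis using card ms by (simp add: sum.distrib)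
      qed
      ultimately have "\<exists>v\<in>W. \<exists>k. bundled ?V ?E S T ?Z v k \<and> k + of_bool (v \<in> S) = l"
        by (simp only:)
      then show ?thesis unfolding reconfigurable_def by blast
    qed (simp add: reconfigurable_def)
  qed
qed

section \<open>The algorithm\<close>

lemmas polytime_intros = polytime_if polytime_not polytime_conj polytime_disj
  polytime_eq polytime_member polytime_ex polytime_all polytime_filter polytime_map
  polytime_concat_map polytime_append polytime_Node polytime_hd polytime_tl polytime_const
  polytime_id_size order_refl

section \<open>Surplus and bundles on encoded data\<close>

text \<open>Serves to compare two lengths without arithmetic; only the emptiness of the result is of
  interest.\<close>

definition drop_data :: "tree_data \<Rightarrow> tree_data \<Rightarrow> tree_data" where
  "drop_data s t = foldl (\<lambda>a _. tl_data a) s (to_list t)"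

lemma foldl_tl_data: "to_list (foldl (\<lambda>a _. tl_data a) s xs) = drop (length xs) (to_list s)"
  by (induction xs arbitrary: s) (auto simp: to_list_tl drop_Suc)

lemma drop_data_eq_Leaf: "drop_data s t = Leaf \<longleftrightarrow> length (to_list s) \<le> length (to_list t)"
  unfolding drop_data_def by (metis to_list_eq_Nil foldl_tl_data drop_eq_Nil)

lemma polytime_drop:
  assumes "polytime m f" "polytime m g"
  shows "polytime m (\<lambda>x. drop_data (f x) (g x))"
  unfolding drop_data_def
proof (rule polytime_foldl[where F = "\<lambda>a e x. tl_data a" and B = "\<lambda>x. data_size (f x)"])
  fix x j
  have "data_size (foldl (\<lambda>a e. tl_data a) t xs) \<le> data_size t" for t and xs :: "tree_data list"
    by (induction xs arbitrary: t) (auto intro: le_trans data_size_tl_le)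
  then show "data_size (foldl (\<lambda>a e. tl_data a) (f x) (take j (to_list (g x)))) \<le> data_size (f x)" .
qed (intro polytime_tl polytime_hd polytime_id_size assms polytime_size)+

definition more_data :: "tree_data \<Rightarrow> tree_data \<Rightarrow> tree_data \<Rightarrow> bool" where
  "more_data s t x \<longleftrightarrow> drop_data (filter_data (\<lambda>e. e \<in> set (to_list s)) x)
     (filter_data (\<lambda>e. e \<in> set (to_list t)) x) \<noteq> Leaf"

text \<open>For functions of several arguments, the arguments are packed into one tree and the bound
  is shown in the size of that tree. Composition then transfers it to arbitrary measures. The larger
  subprograms below are treated in the same way.\<close>

lemma polytime_more_size:
  "polytime data_size (\<lambda>z. bool_data (more_data (hd_data z) (hd_data (tl_data z)) (tl_data (tl_data z))))"
  unfolding more_data_def by (intro polytime_drop polytime_intros)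

lemma polytime_more:
  assumes "polytime m s" "polytime m t" "polytime m x"
  shows "polytime m (\<lambda>z. bool_data (more_data (s z) (t z) (x z)))"
  using polytime_comp[OF polytime_more_size polytime_Node[OF assms(1) polytime_Node[OF assms(2,3)]]]
  by simp

lemma more_data_iff:
  assumes "distinct (to_list x)"
  shows "more_data s t x \<longleftrightarrow> surplus (set (to_list s)) (set (to_list t)) (set (to_list x)) > 0"
proof -
  have "length (filter (\<lambda>e. e \<in> A) (to_list x)) = card (set (to_list x) \<inter> A)" for A
    using distinct_card[of "filter (\<lambda>e. e \<in> A) (to_list x)"] assms by (simp add: Int_def)
  then show ?thesis unfolding more_data_def drop_data_eq_Leaf surplus_def by auto
qed

definition routable_data ::
  "tree_data \<Rightarrow> tree_data \<Rightarrow> tree_data \<Rightarrow> tree_data \<Rightarrow> tree_data \<Rightarrow> tree_data \<Rightarrow> bool" where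
  "routable_data a s t x v u \<longleftrightarrow>
     (more_data s t x \<and> Node v u \<in> set (to_list a)) \<or> (more_data t s x \<and> Node u v \<in> set (to_list a)) \<or>
     (\<not> more_data s t x \<and> \<not> more_data t s x)"

definition pair_set :: "tree_data \<Rightarrow> (tree_data \<times> tree_data) set" where
  "pair_set a = {(u, v). Node u v \<in> set (to_list a)}"

lemma routable_data_iff:
  assumes "distinct (to_list x)"
  shows "routable_data a s t x v u \<longleftrightarrow>
    routable (pair_set a) (set (to_list s)) (set (to_list t)) (set (to_list x)) v u"
proof -
  have "surplus A B X = - surplus B A X" for A B and X :: "tree_data set"
    unfolding surplus_def by simp
  from this[of "set (to_list t)" "set (to_list s)" "set (to_list x)"]
  show ?thesis unfolding routable_data_def routable_def more_data_iff[OF assms] pair_set_def by auto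
qed

text \<open>The state \<open>Node x (Node v c)\<close> encodes the assertion \<open>bundled _ _ _ _ x v c\<close>, with \<open>c\<close> in unary.\<close>

definition bundle_step ::
  "tree_data \<Rightarrow> tree_data \<Rightarrow> tree_data \<Rightarrow> tree_data \<Rightarrow> tree_data \<Rightarrow> bool" where
  "bundle_step a s t r e \<longleftrightarrow>
     (\<forall>y\<in>set (to_list (hd_data e)). y = hd_data (tl_data e)) \<or>
     (\<exists>d\<in>set (to_list r). hd_data d = hd_data e \<and>
        tl_data (tl_data e) = (if hd_data (tl_data d) \<in> set (to_list s)
          then Node Leaf (tl_data (tl_data d)) else tl_data (tl_data d)) \<and>
        routable_data a s t (hd_data e) (hd_data (tl_data d)) (hd_data (tl_data e))) \<or>
     (\<exists>d\<in>set (to_list r). \<exists>d'\<in>set (to_list r).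
        hd_data (tl_data d) = hd_data (tl_data e) \<and> hd_data (tl_data d') = hd_data (tl_data e) \<and>
        tl_data (tl_data e) = append_data (tl_data (tl_data d)) (tl_data (tl_data d')) \<and>
        (\<forall>y\<in>set (to_list (hd_data d)). y \<in> set (to_list (hd_data e)) \<and>
           \<not> y \<in> set (to_list (hd_data d'))) \<and>
        (\<forall>y\<in>set (to_list (hd_data d')). y \<in> set (to_list (hd_data e))) \<and>
        (\<forall>y\<in>set (to_list (hd_data e)). y \<in> set (to_list (hd_data d)) \<or>
           y \<in> set (to_list (hd_data d'))))"

definition states_data :: "tree_data \<Rightarrow> tree_data \<Rightarrow> tree_data \<Rightarrow> tree_data" where
  "states_data xs v k =
     concat_map_data (\<lambda>x. concat_map_data (\<lambda>u. map_data (\<lambda>c. Node x (Node u c)) k) v) xs"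

lemma states_data: "set (to_list (states_data xs v k)) =
    {Node x (Node u c) | x u c. x \<in> set (to_list xs) \<and> u \<in> set (to_list v) \<and> c \<in> set (to_list k)}"
  unfolding states_data_def by auto

definition bundles_data ::
  "tree_data \<Rightarrow> tree_data \<Rightarrow> tree_data \<Rightarrow> tree_data \<Rightarrow> tree_data \<Rightarrow> tree_data \<Rightarrow> tree_data" where
  "bundles_data v a s t xs k = iterate_filter (\<lambda>r e. bundle_step a s t r e) (states_data xs v k)"

text \<open>Costs are in unary so that adding is appending and comparing is equality of trees. They
  do not exceed the parameter, which makes their length harmless.\<close>

definition unary :: "nat \<Rightarrow> tree_data" where
  "unary n = from_list (replicate n Leaf)"

lemma unary_simps: "unary 0 = Leaf" "unary (Suc n) = Node Leaf (unary n)"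
  unfolding unary_def by simp_all

lemma length_unary [simp]: "length (to_list (unary n)) = n"
  unfolding unary_def by simp

lemma to_list_unary: "to_list (unary n) = replicate n Leaf"
  unfolding unary_def by simp

lemma unary_inject [simp]: "unary m = unary n \<longleftrightarrow> m = n"
  by (metis length_unary)

lemma append_unary: "append_data (unary m) (unary n) = unary (m + n)"
  by (simp add: append_data_def unary_def replicate_add)

lemma data_size_unary: "data_size (unary n) = 1 + 2 * n"
  by (induction n) (auto simp: unary_simps)

text \<open>The descending order suits the reconstruction: the head is the full budget, and the tail
  lists the budgets that remain as moves are undone.\<close>

definition unaries :: "nat \<Rightarrow> tree_data" where
  "unaries n = from_list (map unary (rev [0..<Suc n]))"

lemma set_unaries: "set (to_list (unaries n)) = unary ` {..n}"
  unfolding unaries_def by (auto simp: atLeast0AtMost[symmetric] simp del: upt_Suc)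

lemma bundles_data_sound:
  assumes "e \<in> set (to_list (bundles_data v a s t xs k))"
    and xs: "\<And>x. x \<in> set (to_list xs) \<Longrightarrow> distinct (to_list x) \<and>
      set (to_list x) \<subseteq> (set (to_list s) - set (to_list t)) \<union> (set (to_list t) - set (to_list s))"
  shows "bundled (set (to_list v)) (pair_set a) (set (to_list s)) (set (to_list t))
    (set (to_list (hd_data e))) (hd_data (tl_data e)) (length (to_list (tl_data (tl_data e)))) \<and>
    e \<in> set (to_list (states_data xs v k))"
proof (rule iterate_filter_induct[OF assms(1)[unfolded bundles_data_def], where Q = "\<lambda>e. bundled (set (to_list v)) (pair_set a)
    (set (to_list s)) (set (to_list t)) (set (to_list (hd_data e))) (hd_data (tl_data e))
    (length (to_list (tl_data (tl_data e)))) \<and> e \<in> set (to_list (states_data xs v k))"], goal_cases)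
  case (1 r e)
  let ?B = "bundled (set (to_list v)) (pair_set a) (set (to_list s)) (set (to_list t))"
  from 1(2) have e: "hd_data e \<in> set (to_list xs)" "hd_data (tl_data e) \<in> set (to_list v)"
    by (auto simp: states_data)
  have "?B (set (to_list (hd_data e))) (hd_data (tl_data e)) (length (to_list (tl_data (tl_data e))))"
    using 1(3) unfolding bundle_step_def
  proof (elim disjE bexE conjE)
    assume "\<forall>y\<in>set (to_list (hd_data e)). y = hd_data (tl_data e)"
    then show ?thesis using e xs by (intro bundled.start) blast+
  next
    fix d assume d: "d \<in> set (to_list r)" "hd_data d = hd_data e"
      "tl_data (tl_data e) = (if hd_data (tl_data d) \<in> set (to_list s)
          then Node Leaf (tl_data (tl_data d)) else tl_data (tl_data d))"
      "routable_data a s t (hd_data e) (hd_data (tl_data d)) (hd_data (tl_data e))"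
    have "routable (pair_set a) (set (to_list s)) (set (to_list t)) (set (to_list (hd_data e)))
        (hd_data (tl_data d)) (hd_data (tl_data e))"
      using d(4) routable_data_iff xs[OF e(1)] by blast
    moreover have "?B (set (to_list (hd_data e))) (hd_data (tl_data d)) (length (to_list (tl_data (tl_data d))))"
      using 1(1)[OF d(1)] d(2) by simp
    ultimately have "?B (set (to_list (hd_data e))) (hd_data (tl_data e))
        (length (to_list (tl_data (tl_data d))) + of_bool (hd_data (tl_data d) \<in> set (to_list s)))"
      by (intro bundled.extend e(2))
    then show ?thesis unfolding d(3) by (auto split: if_splits)
  next
    fix d d' assume d: "d \<in> set (to_list r)" "d' \<in> set (to_list r)"
      "hd_data (tl_data d) = hd_data (tl_data e)" "hd_data (tl_data d') = hd_data (tl_data e)"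
      "tl_data (tl_data e) = append_data (tl_data (tl_data d)) (tl_data (tl_data d'))"
      and u: "\<forall>y\<in>set (to_list (hd_data d)). y \<in> set (to_list (hd_data e)) \<and>
         \<not> y \<in> set (to_list (hd_data d'))"
      "\<forall>y\<in>set (to_list (hd_data d')). y \<in> set (to_list (hd_data e))"
      "\<forall>y\<in>set (to_list (hd_data e)). y \<in> set (to_list (hd_data d)) \<or>
         y \<in> set (to_list (hd_data d'))"
    have "set (to_list (hd_data d)) \<inter> set (to_list (hd_data d')) = {}" using u(1) by blast
    moreover have "set (to_list (hd_data e)) = set (to_list (hd_data d)) \<union> set (to_list (hd_data d'))"
      using u by blast
    ultimately show ?thesis
      using bundled.merge[of _ _ _ _ "set (to_list (hd_data d))" "hd_data (tl_data e)"
          "length (to_list (tl_data (tl_data d)))" "set (to_list (hd_data d'))"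
          "length (to_list (tl_data (tl_data d')))"] 1(1)[OF d(1)] 1(1)[OF d(2)] d by simp
  qed
  then show ?case using 1(2) by blast
qed

text \<open>The claim covers every list \<open>x\<close> that represents \<open>X\<close>, since
  \<open>bundle_step\<close> compares sets of terminals as trees when extending but by their
  elements when merging. The costs in a derivation never exceed the final one, so they stay among
  the available ones.\<close>

lemma bundles_data_complete:
  assumes "bundled (set (to_list v)) (pair_set a) (set (to_list s)) (set (to_list t)) X u c"
    and "c \<le> n" and k: "unary ` {..n} \<subseteq> set (to_list k)"
    and xs: "\<And>x. x \<in> set (to_list xs) \<Longrightarrow> distinct (to_list x)"
      "\<And>X. X \<subseteq> (set (to_list s) - set (to_list t)) \<union> (set (to_list t) - set (to_list s)) \<Longrightarrow>
         \<exists>x\<in>set (to_list xs). set (to_list x) = X"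
    and "x \<in> set (to_list xs)" "set (to_list x) = X"
  shows "Node x (Node u (unary c)) \<in> set (to_list (bundles_data v a s t xs k))"
proof -
  have fixed: "e \<in> set (to_list (bundles_data v a s t xs k))"
    if "e \<in> set (to_list (states_data xs v k))" "bundle_step a s t (bundles_data v a s t xs k) e" for e
    unfolding bundles_data_def
  proof (rule iterate_filter_fixed)
    show "bundle_step a s t r' e" if "set (to_list r) \<subseteq> set (to_list r')" "bundle_step a s t r e" for r r' e
      using that unfolding bundle_step_def by blast
  qed (use that in \<open>auto simp: bundles_data_def\<close>)
  from assms(1,2,6,7) show ?thesis
  proof (induction arbitrary: x rule: bundled.induct)
    case (start v' X c)
    then show ?case using k by (intro fixed) (auto simp: states_data bundle_step_def)
  next
    case (extend X w c u)
    have d: "Node x (Node w (unary c)) \<in> set (to_list (bundles_data v a s t xs k))"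
      using extend by simp
    have r: "routable_data a s t x w u" using extend routable_data_iff xs(1) by blast
    show ?case
    proof (rule fixed)
      show "Node x (Node u (unary (c + of_bool (w \<in> set (to_list s))))) \<in> set (to_list (states_data xs v k))"
        using extend k unfolding states_data by blast
      show "bundle_step a s t (bundles_data v a s t xs k)
          (Node x (Node u (unary (c + of_bool (w \<in> set (to_list s))))))"
        unfolding bundle_step_def using d r by (intro disjI2 disjI1 bexI[OF _ d]) (auto simp: unary_simps)
    qed
  next
    case (merge X u c Y d)
    have "X \<subseteq> (set (to_list s) - set (to_list t)) \<union> (set (to_list t) - set (to_list s))"
      "Y \<subseteq> (set (to_list s) - set (to_list t)) \<union> (set (to_list t) - set (to_list s))"
      using bundled_subset[OF merge.hyps(1)] bundled_subset[OF merge.hyps(2)] by auto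
    then obtain y z where y: "y \<in> set (to_list xs)" "set (to_list y) = X"
      and z: "z \<in> set (to_list xs)" "set (to_list z) = Y" using xs(2) by metis
    have dy: "Node y (Node u (unary c)) \<in> set (to_list (bundles_data v a s t xs k))"
      and dz: "Node z (Node u (unary d)) \<in> set (to_list (bundles_data v a s t xs k))"
      using merge y z by simp_all
    have uv: "u \<in> set (to_list v)" using bundled_subset[OF merge.hyps(1)] by simp
    show ?case
    proof (rule fixed)
      show "Node x (Node u (unary (c + d))) \<in> set (to_list (states_data xs v k))"
        using merge.prems uv k unfolding states_data by blast
      show "bundle_step a s t (bundles_data v a s t xs k) (Node x (Node u (unary (c + d))))"
        unfolding bundle_step_def using merge.prems merge.hyps(3) y z
        by (intro disjI2 bexI[OF _ dy] bexI[OF _ dz]) (auto simp: append_unary)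
    qed
  qed
qed

section \<open>Sets of terminals as bit strings\<close>

text \<open>Bit strings that are too short act as if padded with zeros, because head and tail of a
  leaf are leaves.\<close>

definition select_data :: "tree_data \<Rightarrow> tree_data \<Rightarrow> tree_data" where
  "select_data t b = tl_data (foldl (\<lambda>s e. Node (tl_data (hd_data s))
     (if hd_data (hd_data s) = Leaf then tl_data s else Node e (tl_data s))) (Node b Leaf) (to_list t))"

fun select :: "'a list \<Rightarrow> tree_data \<Rightarrow> 'a list" where
  "select [] b = []"
| "select (e # es) b = (if hd_data b = Leaf then [] else [e]) @ select es (tl_data b)"

lemma foldl_select: "foldl (\<lambda>s e. Node (tl_data (hd_data s))
    (if hd_data (hd_data s) = Leaf then tl_data s else Node e (tl_data s))) (Node b acc) es =
  Node ((tl_data ^^ length es) b) (from_list (rev (select es b) @ to_list acc))"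
  by (induction es arbitrary: b acc) (auto simp: funpow_swap1)

lemma to_list_select_data: "to_list (select_data t b) = rev (select (to_list t) b)"
  unfolding select_data_def foldl_select by simp

lemma set_select: "set (select es b) \<subseteq> set es"
  by (induction es arbitrary: b) auto

lemma distinct_select: "distinct es \<Longrightarrow> distinct (select es b)"
  by (induction es arbitrary: b) (use set_select in fastforce)+

lemma select_filter: "select es (from_list (map (\<lambda>e. bool_data (P e)) es @ bs)) = filter P es"
  by (induction es) auto

lemma data_size_select: "data_size (from_list (rev (select es b))) \<le> data_size (from_list es)"
  unfolding data_size_rev by (induction es arbitrary: b) (auto intro: le_SucI trans_le_add2)

lemma polytime_select:
  assumes "polytime m t" "polytime m b"
  shows "polytime m (\<lambda>x. select_data (t x) (b x))"
  unfolding select_data_def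
proof (rule polytime_tl, rule polytime_foldl[where F = "\<lambda>s e x. Node (tl_data (hd_data s))
     (if hd_data (hd_data s) = Leaf then tl_data s else Node e (tl_data s))"
    and i = "\<lambda>x. Node (b x) Leaf" and B = "\<lambda>x. 1 + (data_size (b x) + data_size (t x))"])
  note ge1 = polytime_ge1[OF assms(1)]
  show "poly_bounded m (\<lambda>x. 1 + (data_size (b x) + data_size (t x)))"
    by (intro poly_bounded_add poly_bounded_const ge1 polytime_size assms)
  show "polytime m (\<lambda>x. Node (b x) Leaf)"
    by (intro polytime_Node assms polytime_const polytime_measure[OF assms(1)])
  fix x j
  have "data_size ((tl_data ^^ n) y) \<le> data_size y" for n y
    by (induction n) (auto intro: le_trans data_size_tl_le)
  then show "data_size (foldl (\<lambda>s e. Node (tl_data (hd_data s))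
     (if hd_data (hd_data s) = Leaf then tl_data s else Node e (tl_data s))) (Node (b x) Leaf)
     (take j (to_list (t x)))) \<le> 1 + (data_size (b x) + data_size (t x))"
    unfolding foldl_select
    using le_trans[OF data_size_select data_size_take[of j "to_list (t x)"], of "b x"]
    by (simp add: add_mono)
qed (intro polytime_intros assms)+

definition terminals_data :: "tree_data \<Rightarrow> tree_data \<Rightarrow> tree_data \<Rightarrow> tree_data" where
  "terminals_data v s t = filter_data (\<lambda>e. (e \<in> set (to_list s) \<and> \<not> e \<in> set (to_list t)) \<or>
     (e \<in> set (to_list t) \<and> \<not> e \<in> set (to_list s))) v"

text \<open>The bit strings in \<open>g\<close> select the sets of terminals, the unary numbers in \<open>k\<close> are the
  available costs, and \<open>b\<close> is the cost to be achieved.\<close>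

definition decide_data :: "tree_data \<Rightarrow> tree_data \<Rightarrow> tree_data \<Rightarrow> tree_data \<Rightarrow> tree_data \<Rightarrow> tree_data \<Rightarrow>
    tree_data \<Rightarrow> bool" where
  "decide_data v a s t g k b \<longleftrightarrow> terminals_data v s t = Leaf \<or>
     (\<exists>e\<in>set (to_list (bundles_data v a s t (map_data (select_data (terminals_data v s t)) g) k)).
        (\<forall>y\<in>set (to_list (terminals_data v s t)). y \<in> set (to_list (hd_data e))) \<and>
        (if hd_data (tl_data e) \<in> set (to_list s) then Node Leaf (tl_data (tl_data e))
         else tl_data (tl_data e)) = b)"

lemma polytime_routable:
  assumes "polytime m a" "polytime m s" "polytime m t" "polytime m x" "polytime m v" "polytime m u"
  shows "polytime m (\<lambda>z. bool_data (routable_data (a z) (s z) (t z) (x z) (v z) (u z)))"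
  unfolding routable_data_def by (intro polytime_intros polytime_more assms)

lemma polytime_terminals:
  assumes "polytime m v" "polytime m s" "polytime m t"
  shows "polytime m (\<lambda>z. terminals_data (v z) (s z) (t z))"
proof -
  have "polytime data_size
      (\<lambda>z. terminals_data (hd_data z) (hd_data (tl_data z)) (tl_data (tl_data z)))"
    unfolding terminals_data_def by (intro polytime_intros)
  from polytime_comp[OF this polytime_Node[OF assms(1) polytime_Node[OF assms(2,3)]]]
  show ?thesis by simp
qed

lemma polytime_states:
  assumes "polytime m xs" "polytime m v" "polytime m k"
  shows "polytime m (\<lambda>z. states_data (xs z) (v z) (k z))"
proof -
  have "polytime data_size
      (\<lambda>z. states_data (hd_data z) (hd_data (tl_data z)) (tl_data (tl_data z)))"
    unfolding states_data_def by (intro polytime_intros)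
  from polytime_comp[OF this polytime_Node[OF assms(1) polytime_Node[OF assms(2,3)]]]
  show ?thesis by simp
qed

lemma polytime_bundle_step:
  assumes "polytime m a" "polytime m s" "polytime m t" "polytime m r" "polytime m e"
  shows "polytime m (\<lambda>z. bool_data (bundle_step (a z) (s z) (t z) (r z) (e z)))"
proof -
  have "polytime data_size (\<lambda>z. bool_data (bundle_step (hd_data z) (hd_data (tl_data z))
      (hd_data (tl_data (tl_data z))) (hd_data (tl_data (tl_data (tl_data z))))
      (tl_data (tl_data (tl_data (tl_data z))))))"
    unfolding bundle_step_def by (intro polytime_intros polytime_routable)
  from polytime_comp[OF this, of m "\<lambda>z. Node (a z) (Node (s z) (Node (t z) (Node (r z) (e z))))"]
  show ?thesis by (simp add: polytime_Node assms)
qed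

lemma polytime_bundles:
  assumes "polytime m v" "polytime m a" "polytime m s" "polytime m t" "polytime m xs" "polytime m k"
  shows "polytime m (\<lambda>z. bundles_data (v z) (a z) (s z) (t z) (xs z) (k z))"
proof -
  have "polytime data_size (\<lambda>z. bundles_data (hd_data z) (hd_data (tl_data z))
      (hd_data (tl_data (tl_data z))) (hd_data (tl_data (tl_data (tl_data z))))
      (hd_data (tl_data (tl_data (tl_data (tl_data z)))))
      (tl_data (tl_data (tl_data (tl_data (tl_data z))))))"
    unfolding bundles_data_def
    by (intro polytime_iterate_filter polytime_bundle_step polytime_states polytime_hd polytime_tl
        polytime_id_size)
  from polytime_comp[OF this, of m
      "\<lambda>z. Node (v z) (Node (a z) (Node (s z) (Node (t z) (Node (xs z) (k z)))))"]
  show ?thesis by (simp add: polytime_Node assms)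
qed

lemma polytime_decide_size:
  "polytime data_size (\<lambda>z. bool_data (decide_data (hd_data z) (hd_data (tl_data z))
     (hd_data (tl_data (tl_data z))) (hd_data (tl_data (tl_data (tl_data z))))
     (hd_data (tl_data (tl_data (tl_data (tl_data z)))))
     (hd_data (tl_data (tl_data (tl_data (tl_data (tl_data z))))))
     (tl_data (tl_data (tl_data (tl_data (tl_data (tl_data z))))))))"
  unfolding decide_data_def
  by (intro polytime_bundles polytime_terminals polytime_intros polytime_select)

lemma polytime_decide:
  assumes "polytime m v" "polytime m a" "polytime m s" "polytime m t" "polytime m g" "polytime m k"
    "polytime m b"
  shows "polytime m (\<lambda>z. bool_data (decide_data (v z) (a z) (s z) (t z) (g z) (k z) (b z)))"
  using polytime_comp[OF polytime_decide_size, of m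
    "\<lambda>z. Node (v z) (Node (a z) (Node (s z) (Node (t z) (Node (g z) (Node (k z) (b z))))))"]
  by (simp add: polytime_Node assms)

definition bit_strings :: "nat \<Rightarrow> tree_data list set" where
  "bit_strings n = {bs. length bs = n \<and> set bs \<subseteq> range bool_data}"

text \<open>The number of terminals is bounded only under the premise that the instance is solvable.
  This suffices: the bit strings have to reach all sets of terminals only for completeness, whereas
  accepting is sound for any number of terminals.\<close>

lemma decide_data_iff:
  assumes v: "distinct (to_list v)" "set (to_list s) \<subseteq> set (to_list v)" "set (to_list t) \<subseteq> set (to_list v)"
    and j: "j \<le> n"
    and small: "reconfigurable (set (to_list v)) (pair_set a) (set (to_list s)) (set (to_list t)) j \<Longrightarrow>
      length (to_list (terminals_data v s t)) \<le> 2 * n"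
    and g: "to_list ` set (to_list g) = bit_strings (2 * n)"
  shows "decide_data v a s t g (unaries n) (unary j) \<longleftrightarrow>
    reconfigurable (set (to_list v)) (pair_set a) (set (to_list s)) (set (to_list t)) j"
proof -
  let ?V = "set (to_list v)" and ?E = "pair_set a" and ?S = "set (to_list s)" and ?T = "set (to_list t)"
  let ?Z = "(?S - ?T) \<union> (?T - ?S)" and ?z = "terminals_data v s t"
  let ?xs = "map_data (select_data ?z) g"
  have z: "set (to_list ?z) = ?Z" "distinct (to_list ?z)"
    unfolding terminals_data_def using v by auto
  have ST: "?z = Leaf \<longleftrightarrow> ?S = ?T"
  proof -
    have "?z = Leaf \<longleftrightarrow> ?Z = {}" unfolding z(1)[symmetric] by simp
    then show ?thesis by blast
  qed
  have xs: "distinct (to_list x) \<and> set (to_list x) \<subseteq> ?Z" if "x \<in> set (to_list ?xs)" for x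
    using that set_select distinct_select[OF z(2)] z(1) by (fastforce simp: to_list_select_data)
  have cost: "length (to_list (if Q then Node Leaf c else c)) = length (to_list c) + of_bool Q" for Q c
    by simp
  show ?thesis
  proof
    assume "decide_data v a s t g (unaries n) (unary j)"
    then consider "?S = ?T" | e where "e \<in> set (to_list (bundles_data v a s t ?xs (unaries n)))"
      "?Z \<subseteq> set (to_list (hd_data e))"
      "(if hd_data (tl_data e) \<in> ?S then Node Leaf (tl_data (tl_data e)) else tl_data (tl_data e)) = unary j"
      unfolding decide_data_def ST z(1) by blast
    then show "reconfigurable ?V ?E ?S ?T j"
    proof cases
      case 2
      from bundles_data_sound[OF 2(1) xs]
      have B: "bundled ?V ?E ?S ?T (set (to_list (hd_data e))) (hd_data (tl_data e))
        (length (to_list (tl_data (tl_data e))))" by blast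
      have "set (to_list (hd_data e)) = ?Z" using bundled_subset[OF B] 2(2) by auto
      moreover have "length (to_list (tl_data (tl_data e))) + of_bool (hd_data (tl_data e) \<in> ?S) = j"
        unfolding cost[symmetric] 2(3) by simp
      ultimately show ?thesis using B unfolding reconfigurable_def by metis
    qed (simp add: reconfigurable_def)
  next
    assume r: "reconfigurable ?V ?E ?S ?T j"
    show "decide_data v a s t g (unaries n) (unary j)"
    proof (cases "?S = ?T")
      case True
      then show ?thesis unfolding decide_data_def ST by blast
    next
      case False
      then obtain u c where u: "bundled ?V ?E ?S ?T ?Z u c" "c + of_bool (u \<in> ?S) = j"
        using r unfolding reconfigurable_def by blast
      have all: "\<exists>x\<in>set (to_list ?xs). set (to_list x) = X" if "X \<subseteq> ?Z" for X
      proof -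
        \<comment> \<open>The available strings have length exactly \<open>2 * n\<close>, hence the
          characteristic vector of \<open>X\<close> is padded with zeros.\<close>
        let ?bs = "map (\<lambda>e. bool_data (e \<in> X)) (to_list ?z) @
          replicate (2 * n - length (to_list ?z)) (bool_data False)"
        have "?bs \<in> bit_strings (2 * n)"
          unfolding bit_strings_def using small[OF r] by auto
        then obtain b where b: "b \<in> set (to_list g)" "to_list b = ?bs" unfolding g[symmetric] by auto
        then have "b = from_list ?bs" by (metis from_list_to_list)
        then have "to_list (select_data ?z b) = rev (filter (\<lambda>e. e \<in> X) (to_list ?z))"
          unfolding to_list_select_data by (simp only: select_filter)
        then have "set (to_list (select_data ?z b)) = X" using that z(1) by auto
        then show ?thesis using b(1) by auto
      qed
      obtain x where x: "x \<in> set (to_list ?xs)" "set (to_list x) = ?Z" using all by blast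
      have mem: "Node x (Node u (unary c)) \<in> set (to_list (bundles_data v a s t ?xs (unaries n)))"
      proof (rule bundles_data_complete[OF u(1) _ _ _ _ x])
        show "c \<le> n" using u(2) j by simp
        show "unary ` {..n} \<subseteq> set (to_list (unaries n))" unfolding set_unaries ..
        show "distinct (to_list x)" if "x \<in> set (to_list ?xs)" for x using xs[OF that] by blast
      qed (rule all)
      have "(if u \<in> ?S then Node Leaf (unary c) else unary c) = unary j"
        using u(2) by (cases "u \<in> ?S") (simp_all flip: unary_simps(2))
      moreover have "\<forall>y\<in>set (to_list ?z). y \<in> set (to_list x)" unfolding x(2) z(1) by blast
      ultimately show ?thesis unfolding decide_data_def
        by (intro disjI2 bexI[OF _ mem] conjI) (simp_all only: hd_data.simps tl_data.simps)
    qed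
  qed
qed

section \<open>Binary and unary numbers\<close>

text \<open>Defined on all trees, with every bit other than a leaf read as 1, because running times
  are claimed for arbitrary inputs and the measures are built from this value.\<close>

fun bin_value :: "tree_data \<Rightarrow> nat" where
  "bin_value Leaf = 0"
| "bin_value (Node b r) = (if b = Leaf then 0 else 1) + 2 * bin_value r"

lemma bin_value_enc_nat [simp]: "bin_value (enc_nat n) = n"
proof (induction n rule: less_induct)
  case (less n)
  then show ?case by (cases "n = 0") (auto simp: enc_nat.simps[of n] enc_nat.simps[of 0])
qed

lemma enc_nat_inject [simp]: "enc_nat a = enc_nat b \<longleftrightarrow> a = b"
  by (metis bin_value_enc_nat)

lemma inj_enc_nat: "inj enc_nat"
  by (rule injI) simp

text \<open>Horner's rule from the most significant bit on, where doubling means appending the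
  accumulator to itself.\<close>

lemma foldl_unary: "foldl (\<lambda>a b. append_data (append_data a a) (if b = Leaf then Leaf else Node Leaf Leaf))
    Leaf (rev bs) = unary (bin_value (from_list bs))"
proof (induction bs)
  case (Cons b bs)
  have "(if b = Leaf then Leaf else Node Leaf Leaf) = unary (if b = Leaf then 0 else 1)"
    by (simp add: unary_simps)
  then show ?case using Cons by (simp add: append_unary)
qed (simp add: unary_simps)

lemma bin_value_drop: "bin_value (from_list (drop j bs)) \<le> bin_value (from_list bs)"
proof (induction bs arbitrary: j)
  case (Cons b bs)
  show ?case
  proof (cases j)
    case (Suc i)
    then show ?thesis using Cons.IH[of i] by simp
  qed simp
qed simp

text \<open>Unary notation can be exponentially longer than binary notation, so the value itself
  must be bounded in terms of \<open>m\<close>. A factor \<open>2 ^ l\<close> in the measure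
  achieves this.\<close>

lemma polytime_unary:
  assumes f: "polytime m f" and b: "poly_bounded m (\<lambda>x. bin_value (f x))"
  shows "polytime m (\<lambda>x. unary (bin_value (f x)))"
proof -
  note ge1 = polytime_ge1[OF f] and m = polytime_measure[OF f]
  let ?F = "\<lambda>a b. append_data (append_data a a) (if b = Leaf then Leaf else Node Leaf Leaf)"
  have "polytime m (\<lambda>x. foldl ?F Leaf (to_list (from_list (rev (to_list (f x))))))"
  proof (rule polytime_foldl[where F = "\<lambda>a b x. ?F a b" and B = "\<lambda>x. 1 + 2 * bin_value (f x)",
        OF _ polytime_Leaf[OF m] polytime_rev[OF f]])
    show "polytime data_size (\<lambda>z. ?F (hd_data z) (hd_data (tl_data z)))"
      by (intro polytime_intros)
    show "poly_bounded m (\<lambda>x. 1 + 2 * bin_value (f x))"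
      by (intro poly_bounded_add poly_bounded_mult poly_bounded_const ge1 b)
    fix x j
    show "data_size (foldl ?F Leaf (take j (to_list (from_list (rev (to_list (f x)))))))
        \<le> 1 + 2 * bin_value (f x)"
      \<comment> \<open>A prefix of the reversed bits is the number without its lowest bits, so the
        intermediate values never exceed the final one.\<close>
      using bin_value_drop[of "length (to_list (f x)) - j" "to_list (f x)"]
      by (simp add: take_rev foldl_unary data_size_unary)
  qed
  then show ?thesis by (simp add: foldl_unary)
qed

definition unaries_data :: "tree_data \<Rightarrow> tree_data" where
  "unaries_data u = foldl (\<lambda>a e. Node (Node e (hd_data a)) a) (Node Leaf Leaf) (to_list u)"

lemma foldl_unaries: "foldl (\<lambda>a e. Node (Node e (hd_data a)) a) (Node Leaf Leaf) us =
    from_list (map (\<lambda>i. from_list (rev (take i us))) (rev [0..<Suc (length us)]))"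
proof (induction us rule: rev_induct)
  case (snoc e us)
  have eq: "map (\<lambda>i. from_list (rev (take i (us @ [e])))) (rev [0..<length us]) =
      map (\<lambda>i. from_list (rev (take i us))) (rev [0..<length us])"
    by (rule map_cong) auto
  have "take (length us) (us @ [e]) = us" "take (Suc (length us)) (us @ [e]) = us @ [e]" by simp_all
  then show ?case using snoc by (simp add: eq del: take_append map_eq_conv)
qed simp

lemma unaries_data_unary: "unaries_data (unary n) = unaries n"
proof -
  have "map (\<lambda>i. from_list (rev (take i (replicate n Leaf)))) (rev [0..<Suc n]) = map unary (rev [0..<Suc n])"
    by (rule map_cong) (auto simp: unary_def min_def)
  then show ?thesis
    unfolding unaries_data_def foldl_unaries unaries_def to_list_unary length_replicate by (rule arg_cong)
qed

lemma polytime_unaries: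
  assumes u: "polytime m u" shows "polytime m (\<lambda>x. unaries_data (u x))"
  unfolding unaries_data_def
proof (rule polytime_foldl[where F = "\<lambda>a e x. Node (Node e (hd_data a)) a"
      and B = "\<lambda>x. 1 + (1 + data_size (u x)) * (1 + data_size (u x))"])
  note ge1 = polytime_ge1[OF u] and m = polytime_measure[OF u]
  show "polytime m (\<lambda>x. Node Leaf Leaf)" by (rule polytime_const[OF m])
  show "poly_bounded m (\<lambda>x. 1 + (1 + data_size (u x)) * (1 + data_size (u x)))"
    by (intro poly_bounded_add poly_bounded_mult poly_bounded_const ge1 polytime_size u)
  fix x j
  let ?us = "take j (to_list (u x))"
  let ?ks = "map (\<lambda>i. from_list (rev (take i ?us))) (rev [0..<Suc (length ?us)])"
  have "data_size k \<le> data_size (u x)" if k: "k \<in> set ?ks" for k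
  proof -
    obtain i where "k = from_list (rev (take i ?us))" using k unfolding set_map by blast
    then show ?thesis
      using data_size_take[of "min i j" "to_list (u x)"] by (simp add: data_size_rev min_def)
  qed
  from data_size_from_list_le[of ?ks, OF this]
  have "data_size (from_list ?ks) \<le> 1 + length ?ks * (1 + data_size (u x))" .
  also have "\<dots> \<le> 1 + (1 + data_size (u x)) * (1 + data_size (u x))"
    using length_to_list_le[of "u x"] by (intro add_left_mono mult_right_mono) auto
  finally show "data_size (foldl (\<lambda>a e. Node (Node e (hd_data a)) a) (Node Leaf Leaf) ?us)
      \<le> 1 + (1 + data_size (u x)) * (1 + data_size (u x))"
    unfolding foldl_unaries .
qed (intro polytime_intros u)+

section \<open>Enumeration of bit strings\<close>

definition bit_strings_step :: "tree_data \<Rightarrow> tree_data" where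
  "bit_strings_step a =
     concat_map_data (\<lambda>g. Node (Node Leaf g) (Node (Node (Node Leaf Leaf) g) Leaf)) a"

definition bit_strings_data :: "tree_data \<Rightarrow> tree_data" where
  "bit_strings_data u = foldl (\<lambda>a e. bit_strings_step a) (Node Leaf Leaf) (to_list u)"

lemma bit_strings_Suc: "bit_strings (Suc n) = (\<Union>bs\<in>bit_strings n. {Leaf # bs, Node Leaf Leaf # bs})"
proof -
  have "range bool_data = {Leaf, Node Leaf Leaf}"
    by (auto simp: bool_data_def image_iff split: if_splits)
  moreover have "{bs. length bs = Suc n \<and> set bs \<subseteq> B} =
      (\<Union>bs\<in>{bs. length bs = n \<and> set bs \<subseteq> B}. (\<lambda>b. b # bs) ` B)" for B :: "tree_data set"
    by (auto simp: length_Suc_conv image_iff)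
  ultimately show ?thesis unfolding bit_strings_def by simp
qed

lemma foldl_bit_strings:
  "to_list ` set (to_list (foldl (\<lambda>a e. bit_strings_step a) (Node Leaf Leaf) us)) = bit_strings (length us)"
  "length (to_list (foldl (\<lambda>a e. bit_strings_step a) (Node Leaf Leaf) us)) = 2 ^ length us"
proof (induction us rule: rev_induct)
  case Nil
  {
    case 1
    show ?case by (auto simp: bit_strings_def)
  next
    case 2
    show ?case by simp
  }
next
  case (snoc e us)
  {
    case 1
    show ?case
      by (simp add: bit_strings_Suc bit_strings_step_def image_UN flip: snoc(1))
  next
    case 2
    have "length (concat (map (\<lambda>g. [f g, h g]) gs)) = 2 * length gs"
      for f h :: "tree_data \<Rightarrow> tree_data" and gs
      by (induction gs) auto
    then show ?case using snoc(2) by (simp add: bit_strings_step_def)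
  }
qed

lemma data_size_bit_string:
  assumes "bs \<in> bit_strings n" shows "data_size (from_list bs) \<le> 1 + 4 * n"
proof -
  have "data_size b \<le> 3" if "b \<in> set bs" for b
    using assms that data_size_bool_data unfolding bit_strings_def by blast
  from data_size_from_list_le[of bs, OF this] show ?thesis using assms unfolding bit_strings_def by simp
qed

text \<open>The list doubles in every step. The assumption \<open>p\<close> shifts this exponential
  growth into the measure.\<close>

lemma polytime_bit_strings:
  assumes u: "polytime m u" and p: "poly_bounded m (\<lambda>x. 2 ^ length (to_list (u x)))"
  shows "polytime m (\<lambda>x. bit_strings_data (u x))"
  unfolding bit_strings_data_def
proof (rule polytime_foldl[where F = "\<lambda>a e x. bit_strings_step a"
      and B = "\<lambda>x. 1 + 2 ^ length (to_list (u x)) * (1 + (1 + 4 * data_size (u x)))"])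
  note ge1 = polytime_ge1[OF u] and m = polytime_measure[OF u]
  show "polytime m (\<lambda>x. Node Leaf Leaf)" by (rule polytime_const[OF m])
  show "poly_bounded m (\<lambda>x. 1 + 2 ^ length (to_list (u x)) * (1 + (1 + 4 * data_size (u x))))"
    by (intro poly_bounded_add poly_bounded_mult poly_bounded_const ge1 polytime_size u p)
  show "polytime data_size (\<lambda>z. bit_strings_step (hd_data z))"
    unfolding bit_strings_step_def by (intro polytime_intros)
  fix x j
  let ?us = "take j (to_list (u x))"
  let ?t = "foldl (\<lambda>a e. bit_strings_step a) (Node Leaf Leaf) ?us"
  have len: "length ?us \<le> length (to_list (u x))" by simp
  have "data_size g \<le> 1 + 4 * data_size (u x)" if "g \<in> set (to_list ?t)" for g
  proof -
    have "to_list g \<in> bit_strings (length ?us)" using that unfolding foldl_bit_strings(1)[symmetric] by blast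
    from data_size_bit_string[OF this] show ?thesis
      using le_trans[OF len length_to_list_le[of "u x"]] by simp
  qed
  from data_size_from_list_le[of "to_list ?t", OF this]
  have "data_size ?t \<le> 1 + 2 ^ length ?us * (1 + (1 + 4 * data_size (u x)))"
    unfolding from_list_to_list foldl_bit_strings(2) .
  also have "\<dots> \<le> 1 + 2 ^ length (to_list (u x)) * (1 + (1 + 4 * data_size (u x)))"
    using len by (intro add_left_mono mult_right_mono power_increasing) auto
  finally show "data_size ?t \<le> 1 + 2 ^ length (to_list (u x)) * (1 + (1 + 4 * data_size (u x)))" .
qed (rule u)

lemma bit_strings_data:
  "to_list ` set (to_list (bit_strings_data (append_data (unary n) (unary n)))) = bit_strings (2 * n)"
  unfolding bit_strings_data_def foldl_bit_strings(1) by (simp add: mult_2)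

section \<open>Reconstruction of a sequence\<close>

text \<open>Filtering the list of vertices instead of editing \<open>c\<close> keeps every
  configuration within the size of \<open>v\<close>, however many moves are undone.\<close>

definition undo_data :: "tree_data \<Rightarrow> tree_data \<Rightarrow> tree_data \<Rightarrow> tree_data" where
  "undo_data v c p = filter_data (\<lambda>e. e = hd_data p \<or> (e \<in> set (to_list c) \<and> \<not> e = tl_data p)) v"

text \<open>The second query has budget 1, which is \<open>Node Leaf Leaf\<close> in unary. It
  replaces a check that the move is valid.\<close>

definition last_moves_data :: "tree_data \<Rightarrow> tree_data \<Rightarrow> tree_data \<Rightarrow> tree_data \<Rightarrow> tree_data \<Rightarrow> tree_data \<Rightarrow>
    tree_data \<Rightarrow> tree_data" where
  "last_moves_data v a s c g k b =
     filter_data (\<lambda>p. tl_data p \<in> set (to_list c) \<and> \<not> hd_data p \<in> set (to_list c) \<and>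
         decide_data v a s (undo_data v c p) g k b \<and>
         decide_data v a (undo_data v c p) c g k (Node Leaf Leaf))
       (concat_map_data (\<lambda>x. map_data (\<lambda>y. Node x y) v) v)"

text \<open>If there is no candidate, the current configuration is already reachable with the
  smaller budget \<open>b\<close>, and it is kept for the next round.\<close>

definition undo_step :: "tree_data \<Rightarrow> tree_data \<Rightarrow> tree_data \<Rightarrow> tree_data \<Rightarrow> tree_data \<Rightarrow> tree_data \<Rightarrow>
    tree_data \<Rightarrow> tree_data" where
  "undo_step v a s g k c b =
     (if last_moves_data v a s (hd_data c) g k b = Leaf then c
      else Node (undo_data v (hd_data c) (hd_data (last_moves_data v a s (hd_data c) g k b)))
        (Node (hd_data (last_moves_data v a s (hd_data c) g k b)) (tl_data c)))"

definition solve_data :: "tree_data \<Rightarrow> tree_data \<Rightarrow> tree_data \<Rightarrow> tree_data \<Rightarrow> tree_data \<Rightarrow> tree_data \<Rightarrow>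
    tree_data" where
  "solve_data v a s t g k =
     (if decide_data v a s t g k (hd_data k)
      then Node Leaf (tl_data (foldl (\<lambda>c b. undo_step v a s g k c b) (Node t Leaf) (to_list (tl_data k))))
      else Leaf)"

lemma polytime_undo:
  assumes "polytime m v" "polytime m c" "polytime m p"
  shows "polytime m (\<lambda>z. undo_data (v z) (c z) (p z))"
proof -
  have "polytime data_size (\<lambda>z. undo_data (hd_data z) (hd_data (tl_data z)) (tl_data (tl_data z)))"
    unfolding undo_data_def by (intro polytime_intros)
  from polytime_comp[OF this polytime_Node[OF assms(1) polytime_Node[OF assms(2,3)]]]
  show ?thesis by simp
qed

lemma polytime_last_moves:
  assumes "polytime m v" "polytime m a" "polytime m s" "polytime m c" "polytime m g" "polytime m k"
    "polytime m b"
  shows "polytime m (\<lambda>z. last_moves_data (v z) (a z) (s z) (c z) (g z) (k z) (b z))"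
proof -
  have "polytime data_size (\<lambda>z. last_moves_data (hd_data z) (hd_data (tl_data z))
     (hd_data (tl_data (tl_data z))) (hd_data (tl_data (tl_data (tl_data z))))
     (hd_data (tl_data (tl_data (tl_data (tl_data z)))))
     (hd_data (tl_data (tl_data (tl_data (tl_data (tl_data z))))))
     (tl_data (tl_data (tl_data (tl_data (tl_data (tl_data z)))))))"
    unfolding last_moves_data_def by (intro polytime_decide polytime_undo polytime_intros)
  from polytime_comp[OF this, of m
    "\<lambda>z. Node (v z) (Node (a z) (Node (s z) (Node (c z) (Node (g z) (Node (k z) (b z))))))"]
  show ?thesis by (simp add: polytime_Node assms)
qed

lemma polytime_undo_step:
  assumes "polytime m v" "polytime m a" "polytime m s" "polytime m g" "polytime m k" "polytime m c"
    "polytime m b"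
  shows "polytime m (\<lambda>z. undo_step (v z) (a z) (s z) (g z) (k z) (c z) (b z))"
  unfolding undo_step_def
  by (intro polytime_if polytime_is_Leaf polytime_Node polytime_undo polytime_last_moves polytime_hd
      polytime_tl assms)

lemma undo_fold_size:
  "data_size (hd_data (foldl (\<lambda>c b. undo_step v a s g k c b) (Node t Leaf) bs)) \<le> data_size v + data_size t \<and>
   data_size (tl_data (foldl (\<lambda>c b. undo_step v a s g k c b) (Node t Leaf) bs)) \<le>
     1 + length bs * (2 + 2 * data_size v)"
proof (induction bs rule: rev_induct)
  case (snoc b bs)
  let ?c = "foldl (\<lambda>c b. undo_step v a s g k c b) (Node t Leaf) bs"
  let ?l = "last_moves_data v a s (hd_data ?c) g k b"
  show ?case
  proof (cases "?l = Leaf")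
    case True
    then show ?thesis using snoc by (simp add: undo_step_def)
  next
    case False
    then have "hd_data ?l \<in> set (to_list ?l)" by (cases ?l) auto
    then obtain x y where "hd_data ?l = Node x y" "x \<in> set (to_list v)" "y \<in> set (to_list v)"
      unfolding last_moves_data_def by auto
    then have "data_size (hd_data ?l) \<le> 1 + 2 * data_size v"
      using data_size_mem[of x v] data_size_mem[of y v] by simp
    moreover have "data_size (undo_data v (hd_data ?c) (hd_data ?l)) \<le> data_size v"
      unfolding undo_data_def by (rule data_size_filter_data)
    ultimately show ?thesis using snoc False by (simp add: undo_step_def)
  qed
qed simp

lemma data_size_le_parts: "data_size x \<le> 1 + data_size (hd_data x) + data_size (tl_data x)"
  by (cases x) auto

lemma polytime_solve_size:
  "polytime data_size (\<lambda>z. solve_data (hd_data z) (hd_data (tl_data z))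
     (hd_data (tl_data (tl_data z))) (hd_data (tl_data (tl_data (tl_data z))))
     (hd_data (tl_data (tl_data (tl_data (tl_data z)))))
     (tl_data (tl_data (tl_data (tl_data (tl_data z))))))"
proof -
  let ?v = "\<lambda>z. hd_data z" and ?a = "\<lambda>z. hd_data (tl_data z)"
    and ?s = "\<lambda>z. hd_data (tl_data (tl_data z))"
    and ?t = "\<lambda>z. hd_data (tl_data (tl_data (tl_data z)))"
    and ?g = "\<lambda>z. hd_data (tl_data (tl_data (tl_data (tl_data z))))"
    and ?k = "\<lambda>z. tl_data (tl_data (tl_data (tl_data (tl_data z))))"
  let ?B = "\<lambda>z. 2 + (data_size (?v z) + data_size (?t z) + data_size (?k z) * (2 + 2 * data_size (?v z)))"
  note proj = polytime_hd polytime_tl polytime_id_size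
  have "polytime data_size (\<lambda>z. foldl (\<lambda>c b. undo_step (?v z) (?a z) (?s z) (?g z) (?k z) c b)
      (Node (?t z) Leaf) (to_list (tl_data (?k z))))"
  proof (rule polytime_foldl[where F = "\<lambda>c b z. undo_step (?v z) (?a z) (?s z) (?g z) (?k z) c b"
        and B = ?B])
    show "poly_bounded data_size ?B"
      by (intro poly_bounded_add poly_bounded_mult poly_bounded_const data_size_ge1 polytime_size proj)
    fix z j
    let ?bs = "take j (to_list (tl_data (?k z)))"
    let ?c = "foldl (\<lambda>c b. undo_step (?v z) (?a z) (?s z) (?g z) (?k z) c b) (Node (?t z) Leaf) ?bs"
    have "length ?bs \<le> data_size (?k z)"
      using length_to_list_le[of "tl_data (?k z)"] data_size_tl_le[of "?k z"] by simp
    then have "length ?bs * (2 + 2 * data_size (?v z)) \<le> data_size (?k z) * (2 + 2 * data_size (?v z))"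
      by (rule mult_right_mono) simp
    then show "data_size ?c \<le> ?B z"
      using undo_fold_size[of "?v z" "?a z" "?s z" "?g z" "?k z" "?t z" ?bs] data_size_le_parts[of ?c]
      by linarith
  qed (intro polytime_undo_step polytime_Node polytime_const order_refl proj)+
  then show ?thesis unfolding solve_data_def
    by (intro polytime_if polytime_decide polytime_Node polytime_const order_refl proj)
qed

lemma polytime_solve:
  assumes "polytime m v" "polytime m a" "polytime m s" "polytime m t" "polytime m g" "polytime m k"
  shows "polytime m (\<lambda>z. solve_data (v z) (a z) (s z) (t z) (g z) (k z))"
  using polytime_comp[OF polytime_solve_size, of m
    "\<lambda>z. Node (v z) (Node (a z) (Node (s z) (Node (t z) (Node (g z) (k z)))))"]
  by (simp add: polytime_Node assms)

section \<open>Correctness\<close>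

lemma surplus_image:
  assumes "inj_on h V" "S \<subseteq> V" "T \<subseteq> V" "X \<subseteq> V"
  shows "surplus (h ` S) (h ` T) (h ` X) = surplus S T X"
proof -
  have "card (h ` X \<inter> h ` A) = card (X \<inter> A)" if "A \<subseteq> V" for A
  proof -
    have "h ` X \<inter> h ` A = h ` (X \<inter> A)" using inj_on_image_Int[OF assms(1,4) that] by simp
    moreover have "inj_on h (X \<inter> A)" using assms(1,4) by (meson inf.coboundedI1 inj_on_subset)
    ultimately show ?thesis by (simp add: card_image)
  qed
  then show ?thesis unfolding surplus_def using assms by simp
qed

lemma bundled_image:
  assumes h: "inj_on h V" and ST: "S \<subseteq> V" "T \<subseteq> V"
  shows "bundled V E S T X v c \<Longrightarrow>
    bundled (h ` V) (map_prod h h ` E) (h ` S) (h ` T) (h ` X) (h v) c"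
proof (induction rule: bundled.induct)
  case (start v X c)
  have mem: "h v \<in> h ` A \<longleftrightarrow> v \<in> A" if "A \<subseteq> V" for A
    using inj_on_image_mem_iff[OF h start(1) that] .
  have "h ` X \<subseteq> {h v} \<inter> ((h ` S - h ` T) \<union> (h ` T - h ` S))"
    using start(2) mem[OF ST(1)] mem[OF ST(2)] by auto
  then show ?case using start(1) by (intro bundled.start) auto
next
  case (extend X v c u)
  have X: "X \<subseteq> V" "v \<in> V" using bundled_subset[OF extend.hyps(1)] by auto
  have "(h v \<in> h ` S) = (v \<in> S)" using inj_on_image_mem_iff[OF h X(2) ST(1)] .
  moreover have "routable (map_prod h h ` E) (h ` S) (h ` T) (h ` X) (h v) (h u)"
    using \<open>routable E S T X v u\<close> surplus_image[OF h ST X(1)] unfolding routable_def by force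
  ultimately show ?case
    using bundled.extend[OF extend.IH, of "h u"] extend.hyps(2) by auto
next
  case (merge X v c Y d)
  have "X \<subseteq> V" "Y \<subseteq> V" using bundled_subset[OF merge.hyps(1)] bundled_subset[OF merge.hyps(2)] by auto
  then have "h ` X \<inter> h ` Y = {}" using inj_on_image_Int[OF h, of X Y] merge.hyps(3) by simp
  from bundled.merge[OF merge.IH this] show ?case by (simp add: image_Un)
qed

text \<open>The algorithm handles codes of vertices as opaque names. Injective renaming preserves
  all counts and arcs, so the answer is the same for the coded instance.\<close>

lemma reconfigurable_image:
  assumes h: "inj h" and ST: "S \<subseteq> V" "T \<subseteq> V"
  shows "reconfigurable (h ` V) (map_prod h h ` E) (h ` S) (h ` T) l \<longleftrightarrow> reconfigurable V E S T l"
proof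
  have sd: "h ` ((S - T) \<union> (T - S)) = (h ` S - h ` T) \<union> (h ` T - h ` S)"
    using h by (simp add: image_Un image_set_diff)
  have hV: "inj_on h V" using h inj_on_subset by blast
  {
    assume "reconfigurable V E S T l"
    then consider "S = T" | v c where "bundled V E S T ((S - T) \<union> (T - S)) v c" "c + of_bool (v \<in> S) = l"
      unfolding reconfigurable_def by blast
    then show "reconfigurable (h ` V) (map_prod h h ` E) (h ` S) (h ` T) l"
    proof cases
      case 2
      have "h v \<in> h ` S \<longleftrightarrow> v \<in> S" using h by (simp add: inj_image_mem_iff)
      then show ?thesis
        using bundled_image[OF hV ST 2(1)] 2(2) unfolding sd reconfigurable_def by auto
    qed (simp add: reconfigurable_def)
  next
    assume "reconfigurable (h ` V) (map_prod h h ` E) (h ` S) (h ` T) l"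
    then consider "h ` S = h ` T" | v c where
      "bundled (h ` V) (map_prod h h ` E) (h ` S) (h ` T) (h ` ((S - T) \<union> (T - S))) v c"
      "c + of_bool (v \<in> h ` S) = l"
      unfolding reconfigurable_def sd by blast
    then show "reconfigurable V E S T l"
    proof cases
      case 1
      then show ?thesis using h by (simp add: reconfigurable_def inj_image_eq_iff)
    next
      case 2
      obtain w where w: "v = h w" using bundled_subset[OF 2(1)] by blast
      \<comment> \<open>The reverse implication is the forward one applied to the inverse
        renaming.\<close>
      have "inj_on (inv h) (h ` V)" by (rule inj_onI) (use h in auto)
      from bundled_image[OF this _ _ 2(1)] ST
      have "bundled (inv h ` h ` V) (map_prod (inv h) (inv h) ` map_prod h h ` E) (inv h ` h ` S)
          (inv h ` h ` T) (inv h ` h ` ((S - T) \<union> (T - S))) (inv h v) c" by blast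
      moreover have "map_prod (inv h) (inv h) ` map_prod h h ` E = E"
        unfolding image_image using h by (force simp: map_prod_def)
      ultimately have "bundled V E S T ((S - T) \<union> (T - S)) w c"
        using h w by (simp add: image_inv_f_f)
      moreover have "v \<in> h ` S \<longleftrightarrow> w \<in> S" using h w by (simp add: inj_image_mem_iff)
      ultimately show ?thesis using 2(2) unfolding reconfigurable_def by auto
    qed
  }
qed

section \<open>Basic facts on sequences of moves\<close>

text \<open>A move vacates only one vertex. Since \<open>S - T\<close> and \<open>T - S\<close> are
  equally large, a solvable instance has at most \<open>2 * l\<close> terminals, which explains the
  length of the bit strings.\<close>

lemma transforming_card_diff: "transforming D S ms T \<Longrightarrow> finite S \<Longrightarrow> card (S - T) \<le> length ms"
proof (induction ms arbitrary: S)
  case (Cons m ms)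
  obtain s t where m: "m = (s, t)" by fastforce
  let ?S = "insert t (S - {s})"
  have "card (?S - T) \<le> length ms" using Cons m by auto
  moreover have "card (S - T) \<le> card (insert s (?S - T))" using Cons.prems by (intro card_mono) auto
  moreover have "card (insert s (?S - T)) \<le> Suc (card (?S - T))"
    using Cons.prems by (simp add: card_insert_if)
  ultimately show ?case by simp
qed simp

lemma transforming_snoc:
  "transforming D S (ms @ [m]) T \<longleftrightarrow>
    (\<exists>U. transforming D S ms U \<and> valid_move D U m \<and> execute_move U m = T)"
  by (induction ms arbitrary: S) auto

lemma valid_move_ends:
  assumes "pair_fin_digraph D" "valid_move D S (s, t)"
  shows "s \<in> S" "t \<notin> S" "s \<in> pverts D" "t \<in> pverts D"
proof -
  interpret pair_fin_digraph D by fact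
  show "s \<in> S" "t \<notin> S" using assms(2) by auto
  obtain p where "apath s p t" using assms(2) by (auto simp: free_path_def)
  then have "awalk s p t" by (simp add: apath_def)
  then show "s \<in> pverts D" "t \<in> pverts D" using awalk_hd_in_verts awalk_last_in_verts by blast+
qed

abbreviation reaches_within ::
  "'a pair_pre_digraph \<Rightarrow> 'a set \<Rightarrow> 'a set \<Rightarrow> nat \<Rightarrow> bool" where
  "reaches_within D S T l \<equiv> \<exists>ms. transforming D S ms T \<and> length ms \<le> l"

text \<open>The two configurations differ, so a sequence within budget 1 is a single move. It has to
  vacate \<open>x\<close> and to fill \<open>y\<close>, so it can only be
  \<open>(x, y)\<close>.\<close>

lemma single_move:
  assumes "reaches_within D (insert x (C - {y})) C 1" "y \<in> C" "x \<notin> C"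
  shows "transforming D (insert x (C - {y})) [(x, y)] C"
proof -
  let ?U = "insert x (C - {y})"
  obtain ms where ms: "transforming D ?U ms C" "length ms \<le> 1" using assms(1) by blast
  have "?U \<noteq> C" using assms(3) by blast
  then obtain m where "ms = [m]" using ms by (cases ms) auto
  then obtain s t where st: "valid_move D ?U (s, t)" "insert t (?U - {s}) = C"
    using ms(1) by (cases m) auto
  have "x \<notin> insert t (?U - {s})" "y \<in> insert t (?U - {s})" unfolding st(2) by (fact assms)+
  moreover have "y \<notin> ?U" using assms(2,3) by blast
  ultimately have "s = x" "t = y" by blast+
  then show ?thesis using st by auto
qed

section \<open>Correctness of decision and reconstruction\<close>

locale udtm_encoding =
  fixes D :: "nat pair_pre_digraph" and v a :: tree_data and n :: nat and g :: tree_data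
  assumes D: "pair_fin_digraph D"
    and v: "distinct (to_list v)" "set (to_list v) = enc_nat ` pverts D"
    and a: "set (to_list a) = enc_pair enc_nat enc_nat ` parcs D"
    and g: "to_list ` set (to_list g) = bit_strings (2 * n)"
begin

lemma pair_set_a: "pair_set a = map_prod enc_nat enc_nat ` parcs D"
  unfolding pair_set_def a by (auto simp: image_iff Bex_def map_prod_def split: prod.splits)

lemma decide_data_correct:
  assumes ST: "S \<subseteq> pverts D" "T \<subseteq> pverts D" "card S = card T"
    and s: "set (to_list s) = enc_nat ` S" and t: "set (to_list t) = enc_nat ` T"
    and j: "j \<le> n"
  shows "decide_data v a s t g (unaries n) (unary j) \<longleftrightarrow> reaches_within D S T j"
proof -
  let ?V = "pverts D"
  have fin: "finite S" "finite T"
    using ST pair_fin_digraph.pair_finite_verts[OF D] finite_subset by blast+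
  have "reconfigurable (set (to_list v)) (pair_set a) (set (to_list s)) (set (to_list t)) j \<longleftrightarrow>
      reconfigurable ?V (parcs D) S T j"
    unfolding v(2) pair_set_a s t by (rule reconfigurable_image[OF inj_enc_nat ST(1,2)])
  also have "\<dots> \<longleftrightarrow> reaches_within D S T j" by (rule reconfigurable_iff[OF D ST])
  finally have iff: "reconfigurable (set (to_list v)) (pair_set a) (set (to_list s)) (set (to_list t)) j \<longleftrightarrow>
      reaches_within D S T j" .
  have "decide_data v a s t g (unaries n) (unary j) \<longleftrightarrow>
      reconfigurable (set (to_list v)) (pair_set a) (set (to_list s)) (set (to_list t)) j"
  proof (rule decide_data_iff[OF v(1) _ _ j _ g])
    show "set (to_list s) \<subseteq> set (to_list v)" "set (to_list t) \<subseteq> set (to_list v)"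
      unfolding s t v(2) using ST by blast+
    assume "reconfigurable (set (to_list v)) (pair_set a) (set (to_list s)) (set (to_list t)) j"
    then obtain ms where "transforming D S ms T" "length ms \<le> j" using iff by blast
    then have le: "card (S - T) \<le> n" using transforming_card_diff[of D S ms T] fin j by simp
    have eq: "card (S - T) = card (T - S)"
      using ST(3) fin by (simp add: card_Diff_subset_Int Int_commute)
    have "set (to_list (terminals_data v s t)) \<subseteq> enc_nat ` ((S - T) \<union> (T - S))"
      unfolding terminals_data_def using s t by auto
    then have "card (set (to_list (terminals_data v s t))) \<le> card (enc_nat ` ((S - T) \<union> (T - S)))"
      using fin by (intro card_mono) auto
    also have "\<dots> \<le> card ((S - T) \<union> (T - S))" using fin by (intro card_image_le) auto
    also have "\<dots> \<le> card (S - T) + card (T - S)" by (rule card_Un_le)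
    finally have "card (set (to_list (terminals_data v s t))) \<le> 2 * n" using le eq by simp
    moreover have "distinct (to_list (terminals_data v s t))"
      unfolding terminals_data_def using v(1) by simp
    ultimately show "length (to_list (terminals_data v s t)) \<le> 2 * n"
      by (simp add: distinct_card)
  qed
  then show ?thesis using iff by simp
qed

lemma set_undo_data:
  assumes "C \<subseteq> pverts D" "set (to_list c) = enc_nat ` C" "x \<in> pverts D"
  shows "set (to_list (undo_data v c (Node (enc_nat x) (enc_nat y)))) = enc_nat ` insert x (C - {y})"
  unfolding undo_data_def using assms v(2) by auto

lemma last_moves_data_iff:
  assumes S: "S \<subseteq> pverts D" "set (to_list s) = enc_nat ` S"
    and C: "C \<subseteq> pverts D" "card C = card S" "set (to_list c) = enc_nat ` C"
    and i: "i < n"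
  shows "p \<in> set (to_list (last_moves_data v a s c g (unaries n) (unary i))) \<longleftrightarrow>
    (\<exists>x y. p = Node (enc_nat x) (enc_nat y) \<and> x \<in> pverts D \<and> y \<in> C \<and> x \<notin> C \<and>
       reaches_within D S (insert x (C - {y})) i \<and> reaches_within D (insert x (C - {y})) C 1)"
proof -
  have one: "Node Leaf Leaf = unary 1" by (simp add: unary_simps)
  have finC: "finite C" using C(1) pair_fin_digraph.pair_finite_verts[OF D] finite_subset by blast
  have dec: "decide_data v a s (undo_data v c (Node (enc_nat x) (enc_nat y))) g (unaries n) (unary i) \<longleftrightarrow>
      reaches_within D S (insert x (C - {y})) i"
    "decide_data v a (undo_data v c (Node (enc_nat x) (enc_nat y))) c g (unaries n) (Node Leaf Leaf) \<longleftrightarrow>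
      reaches_within D (insert x (C - {y})) C 1"
    if "x \<in> pverts D" "y \<in> C" "x \<notin> C" for x y
  proof -
    have "card (insert x (C - {y})) = card C"
      using that finC card_Suc_Diff1[of C y] by simp
    moreover have "insert x (C - {y}) \<subseteq> pverts D" using that C(1) by auto
    ultimately show
      "decide_data v a s (undo_data v c (Node (enc_nat x) (enc_nat y))) g (unaries n) (unary i) \<longleftrightarrow>
        reaches_within D S (insert x (C - {y})) i"
      "decide_data v a (undo_data v c (Node (enc_nat x) (enc_nat y))) c g (unaries n) (Node Leaf Leaf) \<longleftrightarrow>
        reaches_within D (insert x (C - {y})) C 1"
      unfolding one using decide_data_correct S C i set_undo_data[OF C(1,3) that(1)] by simp_all
  qed
  have mem: "enc_nat x \<in> set (to_list c) \<longleftrightarrow> x \<in> C" for x unfolding C(3) by auto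
  have "p \<in> set (to_list (last_moves_data v a s c g (unaries n) (unary i))) \<longleftrightarrow>
      (\<exists>x\<in>pverts D. \<exists>y\<in>pverts D. p = Node (enc_nat x) (enc_nat y) \<and> y \<in> C \<and> x \<notin> C \<and>
       decide_data v a s (undo_data v c (Node (enc_nat x) (enc_nat y))) g (unaries n) (unary i) \<and>
       decide_data v a (undo_data v c (Node (enc_nat x) (enc_nat y))) c g (unaries n) (Node Leaf Leaf))"
  proof -
    have "p \<in> set (to_list (filter_data Q (concat_map_data (\<lambda>x. map_data (Node x) v) v))) \<longleftrightarrow>
        (\<exists>x\<in>pverts D. \<exists>y\<in>pverts D. p = Node (enc_nat x) (enc_nat y) \<and> Q (Node (enc_nat x) (enc_nat y)))"
      for Q by (auto simp: v(2))
    then show ?thesis unfolding last_moves_data_def by (simp only: hd_data.simps tl_data.simps mem)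
  qed
  also have "\<dots> \<longleftrightarrow> (\<exists>x y. p = Node (enc_nat x) (enc_nat y) \<and> x \<in> pverts D \<and> y \<in> C \<and> x \<notin> C \<and>
       reaches_within D S (insert x (C - {y})) i \<and> reaches_within D (insert x (C - {y})) C 1)"
    (is "?lhs \<longleftrightarrow> ?rhs")
  proof
    assume ?lhs
    then obtain x y where xy: "p = Node (enc_nat x) (enc_nat y)" "x \<in> pverts D" "y \<in> C" "x \<notin> C"
      and d: "decide_data v a s (undo_data v c (Node (enc_nat x) (enc_nat y))) g (unaries n) (unary i)"
        "decide_data v a (undo_data v c (Node (enc_nat x) (enc_nat y))) c g (unaries n) (Node Leaf Leaf)"
      by blast
    show ?rhs
      by (intro exI[of _ x] exI[of _ y] conjI xy dec(1)[OF xy(2-4), THEN iffD1, OF d(1)]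
          dec(2)[OF xy(2-4), THEN iffD1, OF d(2)])
  next
    assume ?rhs
    then obtain x y where xy: "p = Node (enc_nat x) (enc_nat y)" "x \<in> pverts D" "y \<in> C" "x \<notin> C"
      and d: "reaches_within D S (insert x (C - {y})) i" "reaches_within D (insert x (C - {y})) C 1"
      by blast
    show ?lhs
      by (intro bexI[of _ x] bexI[of _ y] conjI xy dec(1)[OF xy(2-4), THEN iffD2, OF d(1)]
          dec(2)[OF xy(2-4), THEN iffD2, OF d(2)] subsetD[OF C(1) xy(3)])
  qed
  finally show ?thesis .
qed

text \<open>The length condition is an inequality because the budget decreases in every round, even
  in one that undoes no move.\<close>

definition undo_invariant :: "nat set \<Rightarrow> nat set \<Rightarrow> nat \<Rightarrow> tree_data \<Rightarrow> bool" where
  "undo_invariant S T i r \<longleftrightarrow> (\<exists>c C ms. r = Node c (enc_list (enc_pair enc_nat enc_nat) ms) \<and>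
     set (to_list c) = enc_nat ` C \<and> C \<subseteq> pverts D \<and> card C = card S \<and>
     reaches_within D S C i \<and> transforming D C ms T \<and> length ms + i \<le> n)"

lemma undo_step_invariant:
  assumes S: "S \<subseteq> pverts D" "set (to_list s) = enc_nat ` S"
    and inv: "undo_invariant S T (Suc i) r" and i: "i < n"
  shows "undo_invariant S T i (undo_step v a s g (unaries n) r (unary i))"
proof -
  obtain c C ms where r: "r = Node c (enc_list (enc_pair enc_nat enc_nat) ms)"
    and C: "set (to_list c) = enc_nat ` C" "C \<subseteq> pverts D" "card C = card S"
    and reach: "reaches_within D S C (Suc i)" and ms: "transforming D C ms T" "length ms + Suc i \<le> n"
    using inv unfolding undo_invariant_def by blast
  let ?l = "last_moves_data v a s c g (unaries n) (unary i)"
  note l_iff = last_moves_data_iff[OF S C(2,3,1) i]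
  have finC: "finite C" using C(2) pair_fin_digraph.pair_finite_verts[OF D] finite_subset by blast
  show ?thesis
  proof (cases "?l = Leaf")
    case True
    obtain ns where ns: "transforming D S ns C" "length ns \<le> Suc i" using reach by blast
    \<comment> \<open>If the whole budget were used, the last move of \<open>ns\<close> would be a
      candidate, although the list of candidates is empty.\<close>
    have "length ns \<le> i"
    proof (rule ccontr)
      assume "\<not> length ns \<le> i"
      then have "length ns = Suc i" using ns(2) by simp
      then obtain ns' m where ns': "ns = ns' @ [m]" "length ns' = i"
        by (metis length_Suc_conv_rev)
      obtain x y where m: "m = (x, y)" by fastforce
      obtain U where U: "transforming D S ns' U" "valid_move D U (x, y)" "insert y (U - {x}) = C"
        using ns(1) unfolding ns' transforming_snoc m by auto
      have xy: "x \<in> U" "y \<notin> U" "x \<in> pverts D" using valid_move_ends[OF D U(2)] by blast+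
      have UC: "insert x (C - {y}) = U" using U(3) xy by blast
      have "transforming D U [(x, y)] C" using U(2,3) by auto
      then have "reaches_within D U C 1" by fastforce
      moreover have "reaches_within D S U i" using U(1) ns'(2) by blast
      moreover have "y \<in> C" "x \<notin> C" using U(3) xy by blast+
      ultimately have "Node (enc_nat x) (enc_nat y) \<in> set (to_list ?l)"
        unfolding l_iff using xy(3) UC by blast
      then show False using True by simp
    qed
    then have "reaches_within D S C i" using ns(1) by blast
    then show ?thesis unfolding undo_step_def r undo_invariant_def using True C ms by fastforce
  next
    case False
    then have "hd_data ?l \<in> set (to_list ?l)" by (cases ?l) auto
    then obtain x y where p: "hd_data ?l = Node (enc_nat x) (enc_nat y)" "x \<in> pverts D" "y \<in> C" "x \<notin> C"
      and U: "reaches_within D S (insert x (C - {y})) i" "reaches_within D (insert x (C - {y})) C 1"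
      unfolding l_iff by blast
    let ?U = "insert x (C - {y})"
    have "transforming D ?U ((x, y) # ms) T"
      using single_move[OF U(2) p(3,4)] ms(1) by auto
    moreover have "card ?U = card S" using p finC card_Suc_Diff1[of C y] C(3) by simp
    moreover have "?U \<subseteq> pverts D" using p(2) C(2) by auto
    moreover have "set (to_list (undo_data v c (hd_data ?l))) = enc_nat ` ?U"
      unfolding p(1) by (rule set_undo_data[OF C(2,1) p(2)])
    moreover have "undo_step v a s g (unaries n) r (unary i) = Node (undo_data v c (hd_data ?l))
        (enc_list (enc_pair enc_nat enc_nat) ((x, y) # ms))"
      unfolding undo_step_def r using False p(1) by simp
    moreover have "length ((x, y) # ms) + i \<le> n" using ms(2) by simp
    ultimately show ?thesis using U(1) unfolding undo_invariant_def by blast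
  qed
qed

lemma undo_fold_invariant:
  assumes "S \<subseteq> pverts D" "set (to_list s) = enc_nat ` S"
  shows "undo_invariant S T i r \<Longrightarrow> i \<le> n \<Longrightarrow>
    undo_invariant S T 0 (foldl (\<lambda>c b. undo_step v a s g (unaries n) c b) r (map unary (rev [0..<i])))"
  by (induction i arbitrary: r) (use undo_step_invariant[OF assms] in auto)

lemma solve_data_correct:
  assumes ST: "S \<subseteq> pverts D" "T \<subseteq> pverts D" "card S = card T"
    and s: "set (to_list s) = enc_nat ` S" and t: "set (to_list t) = enc_nat ` T"
  shows "udtm_answer (D, S, T, n) (solve_data v a s t g (unaries n))"
proof -
  have k: "hd_data (unaries n) = unary n" "tl_data (unaries n) = from_list (map unary (rev [0..<n]))"
    unfolding unaries_def by simp_all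
  have dec: "decide_data v a s t g (unaries n) (hd_data (unaries n)) \<longleftrightarrow> reaches_within D S T n"
    unfolding k by (rule decide_data_correct[OF ST s t order_refl])
  show ?thesis
  proof (cases "reaches_within D S T n")
    case True
    let ?r = "foldl (\<lambda>c b. undo_step v a s g (unaries n) c b) (Node t Leaf) (map unary (rev [0..<n]))"
    have "undo_invariant S T n (Node t Leaf)"
      unfolding undo_invariant_def
      by (intro exI[of _ t] exI[of _ T] exI[of _ "[]"]) (use True ST t in auto)
    then have "undo_invariant S T 0 ?r" by (rule undo_fold_invariant[OF ST(1) s]) simp
    then obtain c C ms where r: "?r = Node c (enc_list (enc_pair enc_nat enc_nat) ms)"
      "reaches_within D S C 0" "transforming D C ms T" "length ms + 0 \<le> n"
      unfolding undo_invariant_def by blast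
    \<comment> \<open>With budget 0 only the empty sequence remains, so the moves collected so far
      start from \<open>S\<close>.\<close>
    have "C = S" using r(2) by auto
    moreover have "solve_data v a s t g (unaries n) = Node Leaf (enc_list (enc_pair enc_nat enc_nat) ms)"
      unfolding solve_data_def dec k(2) using True r(1) by simp
    ultimately have "transforming D S ms T \<and> length ms \<le> n \<and> solve_data v a s t g (unaries n) =
        enc_option (enc_list (enc_pair enc_nat enc_nat)) (Some ms)"
      using r(3,4) by simp
    then show ?thesis unfolding udtm_answer.simps using True by (metis (no_types, lifting))
  next
    case False
    then show ?thesis unfolding udtm_answer.simps solve_data_def dec if_not_P[OF False] by simp
  qed
qed

end

section \<open>Fixed-parameter tractability\<close>

lemma computes_if_computes_within:
  assumes "computes_within c f b" shows "\<exists>n. computes c x n (f x) \<and> n \<le> b x"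
  using assms[unfolded computes_within_def, rule_format, of "(\<lambda>_. Leaf)(0 := x)"]
  unfolding computes_def by auto

lemma poly_bounded_exp_bin_value:
  assumes "\<And>x. data_size x * 2 ^ bin_value (f x) \<le> m x"
  shows "poly_bounded m (\<lambda>x. 2 ^ bin_value (f x))" "poly_bounded m (\<lambda>x. bin_value (f x))"
proof -
  have le: "2 ^ bin_value (f x) \<le> m x" for x
    using le_trans[OF mult_le_mono1[OF data_size_ge1] assms[of x]] by simp
  then show "poly_bounded m (\<lambda>x. 2 ^ bin_value (f x))"
    by (intro poly_boundedI[where k = 1]) simp
  then show "poly_bounded m (\<lambda>x. bin_value (f x))"
    by (rule poly_bounded_mono) (simp add: less_imp_le)
qed

text \<open>With the least significant bit first, putting a zero bit in front doubles a number. This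
  is done \<open>k\<close> times for each element of a list of length \<open>l + 1\<close>. The
  combinators for polynomial time are used only to obtain a program that halts.\<close>

lemma computable_exp: "computable (\<lambda>l. 2 ^ (k * (l + 1)))"
proof -
  define m where "m x = data_size x * 2 ^ bin_value x" for x
  have m: "data_size x \<le> m x" for x unfolding m_def by simp
  note ge1 = ge1_if_data_size_le[OF m]
  let ?u = "\<lambda>x. Node Leaf (unary (bin_value x))"
  let ?F = "\<lambda>c. (Node Leaf ^^ k) c"
  have u: "polytime m ?u"
    by (intro polytime_Node polytime_const polytime_unary polytime_id m
        poly_bounded_exp_bin_value) (simp add: m_def)
  have size: "data_size ((Node Leaf ^^ j) c) = 2 * j + data_size c" for j c
    by (induction j) auto
  have foldF: "foldl (\<lambda>c e. ?F c) c es = (Node Leaf ^^ (k * length es)) c" for c and es :: "tree_data list"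
    by (induction es arbitrary: c) (simp_all add: add.commute[of k] funpow_add)
  have "polytime m (\<lambda>x. foldl (\<lambda>c e. ?F c) (enc_nat 1) (to_list (?u x)))"
  proof (rule polytime_foldl[where F = "\<lambda>c e x. ?F c"
        and B = "\<lambda>x. 2 * (k * data_size (?u x)) + data_size (enc_nat 1)", OF _ _ u])
    show "polytime data_size (\<lambda>z. ?F (hd_data z))"
      by (induction k) (auto intro: polytime_intros)
    show "polytime m (\<lambda>x. enc_nat 1)" by (rule polytime_const[OF m])
    show "poly_bounded m (\<lambda>x. 2 * (k * data_size (?u x)) + data_size (enc_nat 1))"
      by (intro poly_bounded_add poly_bounded_mult poly_bounded_const ge1 polytime_size u)
    fix x j
    have "length (take j (to_list (?u x))) \<le> data_size (?u x)"
      using length_to_list_le[of "?u x"] by simp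
    then show "data_size (foldl (\<lambda>c e. ?F c) (enc_nat 1) (take j (to_list (?u x))))
        \<le> 2 * (k * data_size (?u x)) + data_size (enc_nat 1)"
      unfolding foldF size by (intro add_right_mono mult_left_mono) simp_all
  qed
  then obtain c b where c: "computes_within c (\<lambda>x. foldl (\<lambda>c e. ?F c) (enc_nat 1) (to_list (?u x))) b"
    by (rule polytimeE)
  have "\<exists>n. computes c (enc_nat l) n ((Node Leaf ^^ (k * (l + 1))) (enc_nat 1))" for l
    using computes_if_computes_within[OF c, of "enc_nat l"] unfolding foldF by auto
  moreover have "(Node Leaf ^^ j) (enc_nat 1) = enc_nat (2 ^ j)" for j
    by (induction j) (simp_all add: enc_nat.simps[of "2 * 2 ^ _"])
  ultimately show ?thesis unfolding computable_def by auto
qed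

theorem theorem3:
  shows "fixed_parameter_tractable udtm_encodes udtm_param udtm_answer"
proof -
  let ?l = "\<lambda>x. tl_data (tl_data (tl_data (tl_data x)))"
  \<comment> \<open>A bound polynomial in this product separates into a function of the parameter
    and a power of the input size. The factor \<open>2 ^ l\<close> pays for numbers in unary and for
    the bit strings.\<close>
  define m where "m x = data_size x * 2 ^ bin_value (?l x)" for x
  have m: "data_size x \<le> m x" for x unfolding m_def by simp
  note ge1 = ge1_if_data_size_le[OF m]
  let ?u = "\<lambda>x. unary (bin_value (?l x))"
  have exp: "poly_bounded m (\<lambda>x. 2 ^ bin_value (?l x))" "poly_bounded m (\<lambda>x. bin_value (?l x))"
    by (rule poly_bounded_exp_bin_value, simp add: m_def)+
  have u: "polytime m ?u"
    by (intro polytime_unary polytime_tl polytime_id m exp)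
  define f where "f x = solve_data (hd_data x) (hd_data (tl_data x)) (hd_data (tl_data (tl_data x)))
    (hd_data (tl_data (tl_data (tl_data x)))) (bit_strings_data (append_data (?u x) (?u x)))
    (unaries_data (?u x))" for x
  have "polytime m f"
    unfolding f_def
  proof (intro polytime_solve polytime_hd polytime_tl polytime_unaries polytime_bit_strings
      polytime_append u polytime_id m)
    \<comment> \<open>The strings have length \<open>2 * l\<close>. Their number
      \<open>4 ^ l\<close> is the square of the factor \<open>2 ^ l\<close> in the measure.\<close>
    have "poly_bounded m (\<lambda>x. 2 ^ bin_value (?l x) * 2 ^ bin_value (?l x))"
      by (intro poly_bounded_mult exp ge1)
    then show "poly_bounded m (\<lambda>x. 2 ^ length (to_list (append_data (?u x) (?u x))))"
      by (simp add: power_add)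
  qed
  then obtain c b where b: "poly_bounded m b" and c: "computes_within c f b"
    by (rule polytimeE)
  obtain k where k: "\<And>x. b x \<le> k * m x ^ k" using b unfolding poly_bounded_def by blast
  show ?thesis unfolding fixed_parameter_tractable_def
  proof (rule exI[of _ c], rule exI[of _ "\<lambda>l. 2 ^ (k * (l + 1))"], rule exI[of _ k],
      intro conjI allI impI)
    show "computable (\<lambda>l. 2 ^ (k * (l + 1)))" by (rule computable_exp)
    fix i x assume "udtm_encodes i x"
    obtain D S T l where i: "i = (D, S, T, l)" by (cases i) auto
    obtain v a s t where wf: "udtm_wf (D, S, T, l)"
      and sets: "encodes_set enc_nat (pverts D) v" "encodes_set (enc_pair enc_nat enc_nat) (parcs D) a"
        "encodes_set enc_nat S s" "encodes_set enc_nat T t"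
      and x: "x = Node v (Node a (Node s (Node t (enc_nat l))))"
      using \<open>udtm_encodes i x\<close> unfolding i udtm_encodes.simps by blast
    have enc: "set (to_list y) = e ` A" if "encodes_set e A y" for e :: "'x \<Rightarrow> tree_data" and A y
      using that unfolding encodes_set_def enc_list_conv by auto
    interpret udtm_encoding D v a l "bit_strings_data (append_data (unary l) (unary l))"
    proof (rule udtm_encoding.intro)
      show "pair_fin_digraph D" using wf by simp
      show "distinct (to_list v)"
        using sets(1) unfolding encodes_set_def enc_list_conv
        by (auto simp: distinct_map inj_on_def)
    qed (rule enc[OF sets(1)] enc[OF sets(2)] bit_strings_data)+
    have lx: "bin_value (?l x) = l" unfolding x by simp
    have fx: "f x = solve_data v a s t (bit_strings_data (append_data (unary l) (unary l))) (unaries l)"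
      unfolding f_def lx unfolding x by (simp add: unaries_data_unary)
    have "udtm_answer i (f x)"
      unfolding i fx using solve_data_correct[OF _ _ _ enc[OF sets(3)] enc[OF sets(4)]] wf by simp
    moreover obtain n where n: "computes c x n (f x)" "n \<le> b x"
      using computes_if_computes_within[OF c] by blast
    moreover have "n \<le> 2 ^ (k * (udtm_param i + 1)) * data_size x ^ k"
    proof -
      have "n \<le> k * (data_size x ^ k * 2 ^ (k * l))"
        using le_trans[OF n(2) k[of x]] unfolding m_def lx
        by (simp add: power_mult_distrib mult.commute flip: power_mult)
      \<comment> \<open>The coefficient \<open>k\<close> is absorbed by \<open>2 ^ k\<close>, which
        accounts for the summand 1 in the exponent \<open>k * (l + 1)\<close>.\<close>
      also have "\<dots> \<le> 2 ^ k * (data_size x ^ k * 2 ^ (k * l))"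
        by (intro mult_right_mono) (simp_all add: less_imp_le)
      also have "\<dots> = 2 ^ (k * (udtm_param i + 1)) * data_size x ^ k"
        unfolding i by (simp add: power_add)
      finally show ?thesis .
    qed
    ultimately show "\<exists>n y. computes c x n y \<and> udtm_answer i y \<and>
        n \<le> 2 ^ (k * (udtm_param i + 1)) * data_size x ^ k" by blast
  qed
qed

end
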